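(* Let $\Delta$ be a complete simplicial multi-fan in a lattice $L$ of rank $n$, $\mathcal V$ a set of edge vectors for $\Delta$, and $\xi\in H_T^2(\Delta,\mathcal V)\otimes\mathbb Q$. Let $N>1$ be an integer. Assume that $\xi=N\eta+u$ for some $T$-Cartier divisor $\eta\in H_T^2(\Delta,\mathcal V)$ and some $u\in L_{\mathcal V}^*\otimes\mathbb Q$. Then $\hat\varphi_{st}(\Delta,\mathcal V,\xi;\tau,\sigma)$ with $\sigma=\frac kN$, $0<k<N$, is rigid, that is, it is constant as a function of $w\in L_{\mathbb C}$. If, moreover, $\xi$ does not belong to $N\,H_T^2(\Delta,\mathcal V)$, then it vanishes identically.
   Context: **Multi-fans.** Let $L$ be a lattice of rank $n$, $L_{\mathbb R}=L\otimes\mathbb R$, $L_{\mathbb C}=L\otimes\mathbb C$, $L^*$ the dual lattice. A simplicial multi-fan in $L$ is a triple $\Delta=(\Sigma,C,w^\pm)$: $\Sigma$ is a finite abstract simplicial complex including the empty simplex; $\Sigma^{(k)}$ is the set of simplices with $k$ vertices ($\Sigma^{(1)}$ is identified with the vertex set); $\Sigma=\coprod_{k=0}^n\Sigma^{(k)}$, $\Sigma^{(n)}\ne\emptyset$, and every simplex lies in some $I\in\Sigma^{(n)}$. $C$ assigns to $J\in\Sigma^{(k)}$ a $k$-dimensional strongly convex rational polyhedral cone $C(J)\subset L_{\mathbb R}$, with $C(\emptyset)=\{0\}$, such that for each $I\in\Sigma$ the map $J\mapsto C(J)$ is an isomorphism of ordered sets from the faces of $I$ onto the faces of $C(I)$.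 $w^\pm:\Sigma^{(n)}\to\mathbb Z_{\ge0}$ are maps and $w=w^+-w^-$. **Completeness.** For $K\in\Sigma$ put $L_K=L\cap\operatorname{span}_{\mathbb R}C(K)$, $L^K=L/L_K$. The projected multi-fan $\Delta_K$ in $L^K$ has as simplices the $J\in\Sigma$ with $J\supset K$ (with $K$ as minimum), cones $C_K(J)$ = image of $C(J)$ in $L^K\otimes\mathbb R$, and $w^\pm$ restricted to the $I\in\Sigma^{(n)}$ with $I\supset K$. A vector is generic if it lies in no linear subspace spanned by a cone of dimension less than $n$. $\Delta$ is pre-complete if $d_v=\sum_{I\in\Sigma^{(n)},\,v\in C(I)}w(I)$ is independent of the generic vector $v$, and complete if $\Delta_K$ is pre-complete for every $K\in\Sigma$. **Edge vectors and divisors.** $\mathcal V=\{v_i\}_{i\in\Sigma^{(1)}}$ with $0\ne v_i\in L\cap C(i)$ (not necessarily primitive). For $I\in\Sigma^{(n)}$, $L_{I,\mathcal V}\subset L$ is the sublattice generated by $\{v_i\}_{i\in I}$, $\{u_i^I\}_{i\in I}$ the basis of $L_{I,\mathcal V}^*$ dual to $\{v_i\}_{i\in I}$, $H_I=L/L_{I,\mathcal V}$; $L_{\mathcal V}=\bigcap_{I\in\Sigma^{(n)}}L_{I,\mathcal V}$, so that $L^*\subset L_{I,\mathcal V}^*\subset L_{\mathcal V}^*$. $H_T^*(\Delta,\mathcal V)=\mathbb Z[x_i:i\in\Sigma^{(1)}]/(\prod_{i\in J}x_i:J\notin\Sigma)$, $\deg x_i=2$. An element $u\in L_{\mathcal V}^*\otimes\mathbb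 Q=L^*\otimes\mathbb Q$ is regarded as the element $\sum_i\langle u,v_i\rangle x_i$ of $H_T^2(\Delta,\mathcal V)\otimes\mathbb Q$. For $I\in\Sigma^{(n)}$, $\iota_I^*(x_i)=u_i^I$ if $i\in I$ and $0$ otherwise. A divisor $\eta\in H_T^2(\Delta,\mathcal V)$ is $T$-Cartier if $\iota_I^*(\eta)\in L^*$ for all $I\in\Sigma^{(n)}$. **Orbifold elliptic genus.** Put $q=e^{2\pi\sqrt{-1}\tau}$ ($\Im\tau>0$), $\zeta=e^{2\pi\sqrt{-1}\sigma}$, $\zeta^a:=e^{2\pi\sqrt{-1}a\sigma}$, and with $t=e^{2\pi\sqrt{-1}z}$, $$\phi_{st}(z,\tau,\sigma)=\frac{1-\zeta t}{(1-\zeta)(1-t)}\prod_{k\ge1}\frac{(1-q^k)^2(1-\zeta tq^k)(1-\zeta^{-1}t^{-1}q^k)}{(1-\zeta q^k)(1-\zeta^{-1}q^k)(1-tq^k)(1-t^{-1}q^k)}.$$ For $\xi=\sum_id_ix_i$ and $w\in L_{\mathbb C}$, $$\hat\varphi_{st}(\Delta,\mathcal V,\xi;\tau,\sigma)(w)=\sum_{I\in\Sigma^{(n)}}\frac{w(I)}{|H_I|}\sum_{(h_1,h_2)\in H_I\times H_I}\prod_{i\in I}\zeta^{d_i\langle u_i^I,v(h_1)\rangle}\phi_{st}\bigl(\langle u_i^I,-w+\tau v(h_1)-v(h_2)\rangle,\tau,d_i\sigma\bigr),$$ where $v(h)\in L$ is any representative of $h\in H_I$ (the value does not depend on the choices).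 It is understood that $d_i\sigma\notin\mathbb Z+\mathbb Z\tau$ for all $i$ (here: $d_ik/N\notin\mathbb Z$), so that the expression is defined. *)

theory Defs
  imports "HOL-Analysis.Analysis"
begin

section \<open>Lattices\<close>

text \<open>
  A lattice of rank \<open>n\<close> is realised as a subgroup \<open>L\<close> of a Euclidean space, generated by
  linearly independent vectors; it need not span the ambient space.  Then \<open>L\<^sub>\<real> = span L\<close>, the
  rank of \<open>L\<close> is \<open>dim L\<close>, and rank 0 and quotients of lattices are covered.
  The inner product only serves to identify \<open>span L\<close> with its dual space, and quotients
  of \<open>span L\<close> with subspaces.
\<close>

definition int_span :: "'v::real_vector set \<Rightarrow> 'v set" where
  "int_span S = {\<Sum>b\<in>T. real_of_int (c b) *\<^sub>R b | T c. finite T \<and> T \<subseteq> S}"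

definition is_lattice :: "'v::euclidean_space set \<Rightarrow> bool" where
  "is_lattice L \<longleftrightarrow> (\<exists>B. independent B \<and> L = int_span B)"

definition dual_lattice :: "'v::euclidean_space set \<Rightarrow> 'v set" where
  "dual_lattice L = {u \<in> span L. \<forall>x\<in>L. u \<bullet> x \<in> \<int>}"

text \<open>\<open>L\<^sup>* \<otimes> \<rat>\<close>\<close>
definition rat_dual_lattice :: "'v::euclidean_space set \<Rightarrow> 'v set" where
  "rat_dual_lattice L = {u. \<exists>m::nat. m > 0 \<and> real m *\<^sub>R u \<in> dual_lattice L}"

text \<open>
  The quotient map by \<open>span S\<close>, with values in the orthogonal complement.  Restricted to a
  lattice \<open>L\<close> its kernel is \<open>L \<inter> span S\<close>, so its image is a copy of \<open>L / (L \<inter> span S)\<close>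
  (see \<open>quot_proj_eq_iff\<close>).
\<close>
definition quot_proj :: "'v::euclidean_space set \<Rightarrow> 'v \<Rightarrow> 'v" where
  "quot_proj S x = (THE y. x - y \<in> span S \<and> y \<in> orthogonal_comp (span S))"

lemma quot_proj:
  "x - quot_proj S x \<in> span S" "quot_proj S x \<in> orthogonal_comp (span S)"
proof -
  obtain y z where yz: "y \<in> span S" "\<And>w. w \<in> span S \<Longrightarrow> orthogonal z w" "x = y + z"
    using orthogonal_subspace_decomp_exists[of S x] by metis
  have "x - z \<in> span S \<and> z \<in> orthogonal_comp (span S)"
    using yz by (auto simp: orthogonal_comp_def orthogonal_commute)
  moreover have "y' = z" if "x - y' \<in> span S \<and> y' \<in> orthogonal_comp (span S)" for y'
  proof -
    have "y' - z \<in> span S"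
      using span_diff[of "x - z" S "x - y'"] that yz by simp
    moreover have "y' - z \<in> orthogonal_comp (span S)"
      using that \<open>x - z \<in> span S \<and> _\<close> subspace_orthogonal_comp subspace_diff by blast
    ultimately show ?thesis
      by (auto simp: orthogonal_comp_def orthogonal_self)
  qed
  ultimately have "x - quot_proj S x \<in> span S \<and> quot_proj S x \<in> orthogonal_comp (span S)"
    unfolding quot_proj_def by (rule theI)
  then show "x - quot_proj S x \<in> span S" "quot_proj S x \<in> orthogonal_comp (span S)"
    by auto
qed

lemma quot_proj_eq_iff: "quot_proj S x = quot_proj S y \<longleftrightarrow> x - y \<in> span S"
proof
  assume "quot_proj S x = quot_proj S y"
  then show "x - y \<in> span S"
    using span_diff[OF quot_proj(1)[of x S] quot_proj(1)[of y S]] by simp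
next
  assume "x - y \<in> span S"
  then have "quot_proj S x - quot_proj S y \<in> span S"
    using span_diff[OF span_add[OF _ quot_proj(1)[of y S]] quot_proj(1)[of x S], of "x - y"]
    by (simp add: algebra_simps)
  moreover have "quot_proj S x - quot_proj S y \<in> orthogonal_comp (span S)"
    using quot_proj(2) subspace_orthogonal_comp subspace_diff by blast
  ultimately show "quot_proj S x = quot_proj S y"
    by (auto simp: orthogonal_comp_def orthogonal_self)
qed

section \<open>Multi-fans\<close>

record ('i, 'v) multifan =
  lat :: "'v set"
  simplices :: "'i set set"
  cone_at :: "'i set \<Rightarrow> 'v set"
  wplus :: "'i set \<Rightarrow> nat"
  wminus :: "'i set \<Rightarrow> nat"

definition lat_rank :: "('i, 'v::euclidean_space) multifan \<Rightarrow> nat" where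
  "lat_rank \<Delta> = dim (lat \<Delta>)"

text \<open>\<open>\<Sigma>\<^bsup>(1)\<^esup>\<close>, identified with the vertex set, and \<open>\<Sigma>\<^bsup>(n)\<^esup>\<close>\<close>

definition vertices :: "('i, 'v) multifan \<Rightarrow> 'i set" where
  "vertices \<Delta> = {i. {i} \<in> simplices \<Delta>}"

definition top_simplices :: "('i, 'v::euclidean_space) multifan \<Rightarrow> 'i set set" where
  "top_simplices \<Delta> = {I \<in> simplices \<Delta>. card I = lat_rank \<Delta>}"

definition weight :: "('i, 'v) multifan \<Rightarrow> 'i set \<Rightarrow> int" where
  "weight \<Delta> I = int (wplus \<Delta> I) - int (wminus \<Delta> I)"

definition strongly_convex_rational_cone :: "'v::euclidean_space set \<Rightarrow> 'v set \<Rightarrow> bool" where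
  "strongly_convex_rational_cone L C \<longleftrightarrow>
     (\<exists>S. finite S \<and> S \<subseteq> L \<and> C = convex_cone hull S) \<and> (\<forall>x\<in>C. - x \<in> C \<longrightarrow> x = 0)"

text \<open>The library relation \<open>face_of\<close> admits the empty set as a face; a cone does not.\<close>
definition cone_faces :: "'v::real_vector set \<Rightarrow> 'v set set" where
  "cone_faces C = {F. F face_of C \<and> F \<noteq> {}}"

definition simplicial_multifan :: "('i, 'v::euclidean_space) multifan \<Rightarrow> bool" where
  "simplicial_multifan \<Delta> \<longleftrightarrow>
     is_lattice (lat \<Delta>) \<and>
     finite (simplices \<Delta>) \<and> (\<forall>J\<in>simplices \<Delta>. finite J) \<and>
     {} \<in> simplices \<Delta> \<and> (\<forall>J\<in>simplices \<Delta>. \<forall>J'\<subseteq>J. J' \<in> simplices \<Delta>) \<and>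
     (\<forall>J\<in>simplices \<Delta>. card J \<le> lat_rank \<Delta>) \<and>
     top_simplices \<Delta> \<noteq> {} \<and> (\<forall>J\<in>simplices \<Delta>. \<exists>I\<in>top_simplices \<Delta>. J \<subseteq> I) \<and>
     (\<forall>J\<in>simplices \<Delta>. strongly_convex_rational_cone (lat \<Delta>) (cone_at \<Delta> J) \<and>
        dim (cone_at \<Delta> J) = card J) \<and>
     cone_at \<Delta> {} = {0} \<and>
     (\<forall>I\<in>simplices \<Delta>. bij_betw (cone_at \<Delta>) (Pow I) (cone_faces (cone_at \<Delta> I)) \<and>
        (\<forall>J\<subseteq>I. \<forall>J'\<subseteq>I. J \<subseteq> J' \<longleftrightarrow> cone_at \<Delta> J \<subseteq> cone_at \<Delta> J'))"

section \<open>Completeness\<close>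

definition generic :: "('i, 'v::euclidean_space) multifan \<Rightarrow> 'v \<Rightarrow> bool" where
  "generic \<Delta> x \<longleftrightarrow> x \<in> span (lat \<Delta>) \<and>
     (\<forall>J\<in>simplices \<Delta>. dim (cone_at \<Delta> J) < lat_rank \<Delta> \<longrightarrow> x \<notin> span (cone_at \<Delta> J))"

definition pre_complete :: "('i, 'v::euclidean_space) multifan \<Rightarrow> bool" where
  "pre_complete \<Delta> \<longleftrightarrow>
     (\<exists>d. \<forall>x. generic \<Delta> x \<longrightarrow> (\<Sum>I\<in>{I \<in> top_simplices \<Delta>. x \<in> cone_at \<Delta> I}. weight \<Delta> I) = d)"

text \<open>
  The simplices \<open>J \<supseteq> K\<close> of \<open>\<Delta>\<^sub>K\<close> are recorded as \<open>J - K\<close>, so that \<open>K\<close> becomes the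
  empty simplex and the number of vertices of a simplex is the dimension of its cone.
\<close>
definition projected :: "('i, 'v::euclidean_space) multifan \<Rightarrow> 'i set \<Rightarrow> ('i, 'v) multifan" where
  "projected \<Delta> K =
     \<lparr> lat = quot_proj (cone_at \<Delta> K) ` lat \<Delta>,
       simplices = {J - K | J. J \<in> simplices \<Delta> \<and> K \<subseteq> J},
       cone_at = (\<lambda>J. quot_proj (cone_at \<Delta> K) ` cone_at \<Delta> (J \<union> K)),
       wplus = (\<lambda>J. wplus \<Delta> (J \<union> K)),
       wminus = (\<lambda>J. wminus \<Delta> (J \<union> K)) \<rparr>"

definition complete_multifan :: "('i, 'v::euclidean_space) multifan \<Rightarrow> bool" where
  "complete_multifan \<Delta> \<longleftrightarrow> (\<forall>K\<in>simplices \<Delta>. pre_complete (projected \<Delta> K))"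

section \<open>Edge vectors and divisors\<close>

definition edge_vectors :: "('i, 'v::euclidean_space) multifan \<Rightarrow> ('i \<Rightarrow> 'v) \<Rightarrow> bool" where
  "edge_vectors \<Delta> v \<longleftrightarrow> (\<forall>i\<in>vertices \<Delta>. v i \<noteq> 0 \<and> v i \<in> lat \<Delta> \<inter> cone_at \<Delta> {i})"

text \<open>\<open>L\<^bsub>I,\<V>\<^esub>\<close>, \<open>L\<^bsub>\<V>\<^esub>\<close>, \<open>u\<^sub>i\<^sup>I\<close> and \<open>H\<^sub>I\<close>\<close>

definition sublat :: "('i \<Rightarrow> 'v::euclidean_space) \<Rightarrow> 'i set \<Rightarrow> 'v set" where
  "sublat v I = int_span (v ` I)"

definition lat_edge :: "('i, 'v::euclidean_space) multifan \<Rightarrow> ('i \<Rightarrow> 'v) \<Rightarrow> 'v set" where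
  "lat_edge \<Delta> v = (\<Inter>I\<in>top_simplices \<Delta>. sublat v I)"

definition dual_vec ::
    "('i, 'v::euclidean_space) multifan \<Rightarrow> ('i \<Rightarrow> 'v) \<Rightarrow> 'i set \<Rightarrow> 'i \<Rightarrow> 'v" where
  "dual_vec \<Delta> v I i =
     (THE u. u \<in> span (lat \<Delta>) \<and> (\<forall>j\<in>I. u \<bullet> v j = (if j = i then 1 else 0)))"

definition quot_group ::
    "('i, 'v::euclidean_space) multifan \<Rightarrow> ('i \<Rightarrow> 'v) \<Rightarrow> 'i set \<Rightarrow> 'v set set" where
  "quot_group \<Delta> v I = lat \<Delta> // {(x, y). x \<in> lat \<Delta> \<and> y \<in> lat \<Delta> \<and> x - y \<in> sublat v I}"

definition rep :: "'v set \<Rightarrow> 'v" where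
  "rep h = (SOME x. x \<in> h)"

text \<open>
  All Stanley-Reisner relations have polynomial degree at least 2, so \<open>H\<^sub>T\<^sup>2(\<Delta>,\<V>)\<close> is free
  on the \<open>x\<^sub>i\<close>, \<open>i \<in> \<Sigma>\<^bsup>(1)\<^esup>\<close>.  The element \<open>\<Sum>\<^sub>i d\<^sub>i x\<^sub>i\<close> is encoded by the function \<open>d\<close>, set to 0
  outside \<open>\<Sigma>\<^bsup>(1)\<^esup>\<close>.
\<close>
definition H2T :: "('i, 'v) multifan \<Rightarrow> ('i \<Rightarrow> real) set" where
  "H2T \<Delta> = {d. (\<forall>i\<in>vertices \<Delta>. d i \<in> \<int>) \<and> (\<forall>i. i \<notin> vertices \<Delta> \<longrightarrow> d i = 0)}"

definition H2T_rat :: "('i, 'v) multifan \<Rightarrow> ('i \<Rightarrow> real) set" where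
  "H2T_rat \<Delta> = {d. (\<forall>i\<in>vertices \<Delta>. d i \<in> \<rat>) \<and> (\<forall>i. i \<notin> vertices \<Delta> \<longrightarrow> d i = 0)}"

text \<open>\<open>u\<close> regarded as \<open>\<Sum>\<^sub>i \<langle>u, v\<^sub>i\<rangle> x\<^sub>i\<close>\<close>
definition divisor_of ::
    "('i, 'v::euclidean_space) multifan \<Rightarrow> ('i \<Rightarrow> 'v) \<Rightarrow> 'v \<Rightarrow> 'i \<Rightarrow> real" where
  "divisor_of \<Delta> v u = (\<lambda>i. if i \<in> vertices \<Delta> then u \<bullet> v i else 0)"

definition iota ::
    "('i, 'v::euclidean_space) multifan \<Rightarrow> ('i \<Rightarrow> 'v) \<Rightarrow> 'i set \<Rightarrow> ('i \<Rightarrow> real) \<Rightarrow> 'v" where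
  "iota \<Delta> v I d = (\<Sum>i\<in>vertices \<Delta>. d i *\<^sub>R (if i \<in> I then dual_vec \<Delta> v I i else 0))"

definition T_Cartier ::
    "('i, 'v::euclidean_space) multifan \<Rightarrow> ('i \<Rightarrow> 'v) \<Rightarrow> ('i \<Rightarrow> real) \<Rightarrow> bool" where
  "T_Cartier \<Delta> v \<eta> \<longleftrightarrow>
     \<eta> \<in> H2T \<Delta> \<and> (\<forall>I\<in>top_simplices \<Delta>. iota \<Delta> v I \<eta> \<in> dual_lattice (lat \<Delta>))"

section \<open>Orbifold elliptic genus\<close>

definition phi_st :: "complex \<Rightarrow> complex \<Rightarrow> complex \<Rightarrow> complex" where
  "phi_st z \<tau> \<sigma> =
     (let t = exp (2 * pi * \<i> * z); q = exp (2 * pi * \<i> * \<tau>); \<zeta> = exp (2 * pi * \<i> * \<sigma>) in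
      (1 - \<zeta> * t) / ((1 - \<zeta>) * (1 - t)) *
      (\<Prod>j. let k = Suc j in
         ((1 - q ^ k)\<^sup>2 * (1 - \<zeta> * t * q ^ k) * (1 - inverse \<zeta> * inverse t * q ^ k)) /
         ((1 - \<zeta> * q ^ k) * (1 - inverse \<zeta> * q ^ k) * (1 - t * q ^ k) * (1 - inverse t * q ^ k))))"

text \<open>
  A vector \<open>x + \<i>y\<close> of \<open>L\<^sub>\<complex>\<close> is the pair \<open>(x, y)\<close> of vectors of \<open>L\<^sub>\<real>\<close>; \<open>cpair\<close> is the complex
  linear extension of the pairing.
\<close>
definition complexified :: "'v::euclidean_space set \<Rightarrow> ('v \<times> 'v) set" where
  "complexified L = span L \<times> span L"

definition of_lat :: "'v::euclidean_space \<Rightarrow> 'v \<times> 'v" where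
  "of_lat x = (x, 0)"

definition cscale :: "complex \<Rightarrow> 'v::euclidean_space \<times> 'v \<Rightarrow> 'v \<times> 'v" where
  "cscale c w = (Re c *\<^sub>R fst w - Im c *\<^sub>R snd w, Re c *\<^sub>R snd w + Im c *\<^sub>R fst w)"

definition cpair :: "'v::euclidean_space \<Rightarrow> 'v \<times> 'v \<Rightarrow> complex" where
  "cpair u w = Complex (u \<bullet> fst w) (u \<bullet> snd w)"

definition genus_arg ::
    "('i, 'v::euclidean_space) multifan \<Rightarrow> ('i \<Rightarrow> 'v) \<Rightarrow> complex \<Rightarrow> 'v \<times> 'v \<Rightarrow>
     'i set \<Rightarrow> 'v set \<Rightarrow> 'v set \<Rightarrow> 'i \<Rightarrow> complex" where
  "genus_arg \<Delta> v \<tau> w I h1 h2 i =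
     cpair (dual_vec \<Delta> v I i) (- w + cscale \<tau> (of_lat (rep h1)) - of_lat (rep h2))"

definition orbifold_elliptic_genus ::
    "('i, 'v::euclidean_space) multifan \<Rightarrow> ('i \<Rightarrow> 'v) \<Rightarrow> ('i \<Rightarrow> real) \<Rightarrow>
     complex \<Rightarrow> complex \<Rightarrow> 'v \<times> 'v \<Rightarrow> complex" where
  "orbifold_elliptic_genus \<Delta> v d \<tau> \<sigma> w =
     (\<Sum>I\<in>top_simplices \<Delta>.
        of_int (weight \<Delta> I) / of_nat (card (quot_group \<Delta> v I)) *
        (\<Sum>(h1, h2)\<in>quot_group \<Delta> v I \<times> quot_group \<Delta> v I.
           \<Prod>i\<in>I. exp (2 * pi * \<i> * (d i * (dual_vec \<Delta> v I i \<bullet> rep h1)) * \<sigma>) *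
                phi_st (genus_arg \<Delta> v \<tau> w I h1 h2 i) \<tau> (d i * \<sigma>)))"

definition period_lattice :: "complex \<Rightarrow> complex set" where
  "period_lattice \<tau> = {of_int a + of_int b * \<tau> | a b. True}"

text \<open>
  \<open>z \<mapsto> phi_st z \<tau> \<sigma>\<close> has its poles exactly at \<open>z \<in> \<int> + \<int>\<tau>\<close>.  Hence the genus is a
  meromorphic function on \<open>L\<^sub>\<complex>\<close>, given by its defining formula on the set below, the complement of
  a locally finite union of hyperplanes.  Outside this set the formula has vanishing denominators,
  which HOL evaluates by \<open>x / 0 = 0\<close>.
\<close>
definition genus_domain ::
    "('i, 'v::euclidean_space) multifan \<Rightarrow> ('i \<Rightarrow> 'v) \<Rightarrow> complex \<Rightarrow> ('v \<times> 'v) set" where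
  "genus_domain \<Delta> v \<tau> =
     {w \<in> complexified (lat \<Delta>).
        \<forall>I\<in>top_simplices \<Delta>. \<forall>h1\<in>quot_group \<Delta> v I. \<forall>h2\<in>quot_group \<Delta> v I. \<forall>i\<in>I.
          genus_arg \<Delta> v \<tau> w I h1 h2 i \<notin> period_lattice \<tau>}"

end

theory Submission
  imports Defs "HOL-Complex_Analysis.Complex_Analysis"
begin

text \<open>
  Put \<open>s = (k/N) u\<close>.  Since \<open>\<eta>\<close> is \<open>T\<close>-Cartier, the genus at \<open>\<sigma> = k/N\<close> is a weighted sum over
  \<open>(a, b) \<in> H\<^sub>I \<times> H\<^sub>I\<close> of \<open>e(s\<cdot>a) \<Prod>\<^sub>i \<phi>(\<langle>u\<^sub>i, -w + \<tau>a - b\<rangle>, s\<cdot>v\<^sub>i)\<close>, with \<open>s\<cdot>v\<^sub>i \<notin> \<int>\<close>.  It is invariant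
  under \<open>w \<mapsto> w + x\<close> and multiplied by \<open>e(s\<cdot>x)\<close> under \<open>w \<mapsto> w + \<tau>x\<close>, for \<open>x \<in> L\<close>.  Restrict it to a
  generic line in a lattice direction \<open>d\<close> with \<open>s\<cdot>d \<notin> \<int>\<close>.  The poles are simple, and the residues
  coming from the simplices around a facet \<open>J\<close> agree up to the sign of \<open>\<langle>\<nu>, v\<^sub>i\<rangle>\<close>, where \<open>\<nu>\<close> is a
  primitive normal of \<open>J\<close>; they cancel because \<open>\<Delta>\<^sub>J\<close> is pre-complete.  So the restriction extends to
  a bounded entire function with a nontrivial multiplier and vanishes by Liouville.  Hence in positive
  rank the genus is identically 0, and only rank 0 leaves a nonzero constant.
\<close>

section \<open>Theta functions\<close>

text \<open>The groups \<open>H_I\<close> change from one simplex to the next, so residues of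
  neighbouring simplices cannot be compared term by term. For a pole along a hyperplane with
  primitive normal \<nu>, the sums over \<open>H_I\<close> are therefore taken over adapted
  representatives \<open>a + y + c e\<close>. Here e in L has height 1, y runs through a transversal
  of the lattice points of the hyperplane modulo \<open>L_J\<close>, chosen by J alone, and 0 \<le>
  c < |M| with M the height of \<open>v_i\<close>. Only the terms with c = 0 in both variables are
  singular. As \<open>u_i\<close> is \<nu> / M, they contribute a factor M, while
  |\<open>H_I\<close>| contributes |M|; what remains of \<open>v_i\<close> is the sign of M.
  Pre-completeness of the rank one multi-fan at J balances exactly these signs.

  All this needs the singular hyperplanes meeting at a point of the line to be parallel. The line is
  displaced by a real parameter r: countably many values of r are exceptional, and the given w is
  reached by continuity.

  That s pairs to a non-integer with every edge vector is the assumption that the genus is defined.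
  It is used twice: for the regularity of the coefficients of \<phi>, and for finding the direction
  d.\<close>

definition ee :: "complex \<Rightarrow> complex" where
  "ee z = exp (2 * pi * \<i> * z)"

lemma ee_add: "ee (x + y) = ee x * ee y"
  by (simp add: ee_def exp_add algebra_simps)

lemma ee_0 [simp]: "ee 0 = 1"
  by (simp add: ee_def)

lemma ee_nonzero [simp]: "ee z \<noteq> 0"
  by (simp add: ee_def)

lemma ee_minus: "ee (- x) = inverse (ee x)"
  by (simp add: ee_def exp_minus)

lemma ee_sum: "finite A \<Longrightarrow> ee (sum f A) = (\<Prod>x\<in>A. ee (f x))"
  by (induction rule: finite_induct) (auto simp: ee_add)

lemma ee_eq_1_iff: "ee z = 1 \<longleftrightarrow> z \<in> \<int>"
proof -
  have "ee z = 1 \<longleftrightarrow> Im z = 0 \<and> (\<exists>n::int. Re z = of_int n)"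
    by (auto simp: ee_def exp_eq_1)
  also have "\<dots> \<longleftrightarrow> z \<in> \<int>"
    by (auto simp: complex_eq_iff elim!: Ints_cases)
       (metis Ints_of_int complex_eq_iff complex_Re_of_int complex_Im_of_int)
  finally show ?thesis .
qed

lemma ee_Ints: "z \<in> \<int> \<Longrightarrow> ee z = 1"
  by (simp add: ee_eq_1_iff)

lemma norm_ee: "norm (ee z) = exp (- 2 * pi * Im z)"
  by (simp add: ee_def)

lemma ee_holomorphic [holomorphic_intros]:
  "f holomorphic_on A \<Longrightarrow> (\<lambda>z. ee (f z)) holomorphic_on A"
  unfolding ee_def by (intro holomorphic_intros)

lemma of_nat_mult_ee: "ee (of_nat n * z) = ee z ^ n"
  by (induction n) (auto simp: ee_add algebra_simps)

section \<open>Infinite q-products and the theta function\<close>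

definition qpoch :: "complex \<Rightarrow> complex \<Rightarrow> complex" where
  "qpoch q x = (\<Prod>j. 1 - x * q ^ Suc j)"

lemma convergent_prod_qpoch:
  fixes q x :: complex
  assumes "norm q < 1"
  shows "convergent_prod (\<lambda>j. 1 - x * q ^ Suc j)"
proof -
  have "summable (\<lambda>j. norm x * norm q * norm q ^ j)"
    using assms by (intro summable_mult summable_geometric) auto
  moreover have "norm ((1 - x * q ^ Suc j) - 1) = norm x * norm q * norm q ^ j" for j
    by (simp add: norm_mult norm_power)
  ultimately have "abs_convergent_prod (\<lambda>j. 1 - x * q ^ Suc j)"
    unfolding abs_convergent_prod_conv_summable by presburger
  then show ?thesis
    by (rule abs_convergent_prod_imp_convergent_prod)
qed

lemma qpoch_has_prod:
  assumes "norm q < 1"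
  shows "(\<lambda>j. 1 - x * q ^ Suc j) has_prod qpoch q x"
  unfolding qpoch_def using convergent_prod_qpoch[OF assms] by blast

lemma qpoch_step:
  assumes "norm q < 1"
  shows "qpoch q x = (1 - x * q) * qpoch q (x * q)"
proof -
  have "(\<lambda>j. 1 - x * q ^ Suc (Suc j)) has_prod qpoch q (x * q)"
    using qpoch_has_prod[OF assms, of "x * q"] by (simp add: mult_ac)
  from has_prod_Suc_imp[of "\<lambda>j. 1 - x * q ^ Suc j", OF this]
  have "(\<lambda>j. 1 - x * q ^ Suc j) has_prod (qpoch q (x * q) * (1 - x * q))"
    by simp
  with qpoch_has_prod[OF assms, of x] show ?thesis
    by (metis has_prod_unique2 mult.commute)
qed

text \<open>A convergent infinite product vanishes only through one of its factors; this locates the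
  zeros of \<open>theta\<close>.\<close>

lemma qpoch_eq_0_iff:
  assumes "norm q < 1"
  shows "qpoch q x = 0 \<longleftrightarrow> (\<exists>j. x * q ^ Suc j = 1)"
proof -
  have "qpoch q x = 0 \<longleftrightarrow> (\<exists>j. 0 = 1 - x * q ^ Suc j)"
    using has_prod_eq_0_iff[OF qpoch_has_prod[OF assms, of x]] unfolding image_iff by simp
  also have "\<dots> \<longleftrightarrow> (\<exists>j. x * q ^ Suc j = 1)"
    by (metis eq_iff_diff_eq_0)
  finally show ?thesis .
qed

text \<open>The partial products are polynomials in x and converge locally uniformly: on the closed
  unit ball around \<open>x0\<close> the deviations of the factors from 1 are dominated by a
  geometric series.\<close>

lemma qpoch_holomorphic:
  assumes "norm q < 1"
  shows "qpoch q holomorphic_on UNIV"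
proof (rule holomorphic_uniform_sequence)
  show "(\<lambda>x. \<Prod>j<n. 1 - x * q ^ Suc j) holomorphic_on UNIV" for n
    by (intro holomorphic_intros)
  fix x0 :: complex
  have conv: "uniformly_convergent_on (cball x0 1) (\<lambda>N x. \<Prod>j<N. 1 - x * q ^ Suc j)"
  proof (rule uniformly_convergent_on_prod')
    show "uniformly_convergent_on (cball x0 1) (\<lambda>N x. \<Sum>n<N. norm ((1 - x * q ^ Suc n) - 1))"
    proof (rule Weierstrass_m_test')
      show "summable (\<lambda>n. (norm x0 + 1) * norm q * norm q ^ n)"
        using assms by (intro summable_mult summable_geometric) auto
      fix n x assume "x \<in> cball x0 1"
      then have "norm x \<le> norm x0 + 1"
        using norm_triangle_ineq[of x0 "x - x0"] by (simp add: dist_norm norm_minus_commute)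
      then show "norm (norm ((1 - x * q ^ Suc n) - 1)) \<le> (norm x0 + 1) * norm q * norm q ^ n"
        by (simp add: norm_mult norm_power mult_right_mono mult.assoc)
    qed
  qed (auto intro!: continuous_intros)
  moreover have "lim (\<lambda>N. \<Prod>j<N. 1 - x * q ^ Suc j) = qpoch q x" for x
    using has_prod_imp_tendsto'[OF qpoch_has_prod[OF assms, of x]] by (rule limI)
  ultimately have "uniform_limit (cball x0 1) (\<lambda>N x. \<Prod>j<N. 1 - x * q ^ Suc j) (qpoch q) sequentially"
    by (simp add: uniformly_convergent_uniform_limit_iff)
  then show "\<exists>d>0. cball x0 d \<subseteq> UNIV \<and>
      uniform_limit (cball x0 d) (\<lambda>N x. \<Prod>j<N. 1 - x * q ^ Suc j) (qpoch q) sequentially"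
    by (intro exI[of _ 1]) auto
qed auto

lemma qpoch_holomorphic_compose [holomorphic_intros]:
  assumes "norm q < 1" "f holomorphic_on A"
  shows "(\<lambda>z. qpoch q (f z)) holomorphic_on A"
  using holomorphic_on_compose_gen[OF assms(2) qpoch_holomorphic[OF assms(1)]] by (simp add: o_def)

text \<open>Jacobi's theta product up to the constant \<open>qpoch q 1\<close>. The factor
  \<open>1 - t\<close> stands apart because \<open>qpoch\<close> starts with exponent 1; it carries
  the pole of \<open>phi_st\<close> at 0.\<close>

definition theta :: "complex \<Rightarrow> complex \<Rightarrow> complex" where
  "theta q t = (1 - t) * qpoch q t * qpoch q (inverse t)"

text \<open>The substitution removes a factor from \<open>qpoch q t\<close>, restored by the new
  leading factor, and adds \<open>1 - inverse t\<close> to the other product. Trading this for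
  \<open>1 - t\<close> leaves the multiplier.\<close>

lemma theta_step:
  assumes "norm q < 1" "q \<noteq> 0" "t \<noteq> 0"
  shows "theta q (q * t) = - inverse t * theta q t"
proof -
  have "qpoch q (inverse (q * t)) = (1 - inverse t) * qpoch q (inverse t)"
    using qpoch_step[OF assms(1), of "inverse (q * t)"] assms(2,3) by (simp add: field_simps)
  then have "theta q (q * t) = ((1 - t * q) * qpoch q (t * q)) * ((1 - inverse t) * qpoch q (inverse t))"
    by (simp add: theta_def mult_ac)
  also have "(1 - t * q) * qpoch q (t * q) = qpoch q t"
    using qpoch_step[OF assms(1), of t] by simp
  finally have "theta q (q * t) = qpoch q t * ((1 - inverse t) * qpoch q (inverse t))" .
  moreover have "1 - inverse t = - inverse t * (1 - t)"
    using assms(3) by (simp add: field_simps)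
  ultimately show ?thesis
    by (simp add: theta_def mult_ac)
qed

lemma norm_ee_less_1: "Im \<tau> > 0 \<Longrightarrow> norm (ee \<tau>) < 1"
  by (simp add: norm_ee)

text \<open>The three factors of \<open>theta\<close> account for the points
  \<open>a + b * \<tau>\<close> with b = 0, b < 0 and b > 0.\<close>

lemma theta_ee_eq_0_iff:
  assumes "Im \<tau> > 0"
  shows "theta (ee \<tau>) (ee z) = 0 \<longleftrightarrow> z \<in> period_lattice \<tau>"
proof -
  have q: "norm (ee \<tau>) < 1"
    using assms by (rule norm_ee_less_1)
  have A: "ee x * ee \<tau> ^ j = 1 \<longleftrightarrow> x + of_nat j * \<tau> \<in> \<int>" for x j
    by (simp add: of_nat_mult_ee[symmetric] ee_add[symmetric] ee_eq_1_iff)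
  have "theta (ee \<tau>) (ee z) = 0 \<longleftrightarrow> z \<in> \<int> \<or> (\<exists>j. z + of_nat (Suc j) * \<tau> \<in> \<int>)
     \<or> (\<exists>j. - z + of_nat (Suc j) * \<tau> \<in> \<int>)"
    unfolding theta_def mult_eq_0_iff qpoch_eq_0_iff[OF q] ee_minus[symmetric] A
    using ee_eq_1_iff[of z] by (metis eq_iff_diff_eq_0)
  also have "\<dots> \<longleftrightarrow> z \<in> period_lattice \<tau>"
  proof
    assume "z \<in> \<int> \<or> (\<exists>j. z + of_nat (Suc j) * \<tau> \<in> \<int>) \<or> (\<exists>j. - z + of_nat (Suc j) * \<tau> \<in> \<int>)"
    then consider n where "z = of_int n" | j n where "z + of_nat (Suc j) * \<tau> = of_int n"
      | j n where "- z + of_nat (Suc j) * \<tau> = of_int n"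
      by (auto elim!: Ints_cases)
    then show "z \<in> period_lattice \<tau>"
    proof cases
      case 1
      then show ?thesis
        unfolding period_lattice_def by (intro CollectI exI[of _ n] exI[of _ 0]) auto
    next
      case 2
      then show ?thesis
        unfolding period_lattice_def
        by (intro CollectI exI[of _ n] exI[of _ "- int (Suc j)"]) (simp add: algebra_simps)
    next
      case 3
      then show ?thesis
        unfolding period_lattice_def
        by (intro CollectI exI[of _ "-n"] exI[of _ "int (Suc j)"]) (simp add: algebra_simps)
    qed
  next
    assume "z \<in> period_lattice \<tau>"
    then obtain a b where ab: "z = of_int a + of_int b * \<tau>"
      unfolding period_lattice_def by auto
    consider "b = 0" | j where "b = int (Suc j)" | j where "b = - int (Suc j)"
      by (metis int_cases not0_implies_Suc of_nat_0)
    then show "z \<in> \<int> \<or> (\<exists>j. z + of_nat (Suc j) * \<tau> \<in> \<int>) \<or> (\<exists>j. - z + of_nat (Suc j) * \<tau> \<in> \<int>)"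
    proof cases
      case 1
      then show ?thesis using ab by simp
    next
      case 2
      then have "- z + of_nat (Suc j) * \<tau> = of_int (- a)"
        using ab by simp
      then show ?thesis
        by (metis Ints_of_int)
    next
      case 3
      then have b: "of_int b = (- of_nat (Suc j) :: complex)"
        by (simp only: of_int_minus of_int_of_nat_eq)
      have "z + of_nat (Suc j) * \<tau> = of_int a"
        unfolding ab b by (simp add: algebra_simps)
      then show ?thesis
        by (metis Ints_of_int)
    qed
  qed
  finally show ?thesis .
qed

text \<open>With \<open>x / 0 = 0\<close> both sides also agree where a denominator vanishes, so the
  translation formulas derived from this identity have no exceptional points.\<close>

lemma phi_st_eq_theta:
  assumes "Im \<tau> > 0"
  shows "phi_st z \<tau> \<sigma> = (qpoch (ee \<tau>) 1)\<^sup>2 * theta (ee \<tau>) (ee \<sigma> * ee z) /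
           (theta (ee \<tau>) (ee \<sigma>) * theta (ee \<tau>) (ee z))"
proof -
  define q where "q = ee \<tau>"
  have q: "norm q < 1"
    unfolding q_def using assms by (rule norm_ee_less_1)
  define t where "t = ee z"
  define x where "x = ee \<sigma>"
  define P where "P = (\<lambda>y j. 1 - y * q ^ Suc j)"
  have P: "convergent_prod (P y)" "qpoch q y = prodinf (P y)" for y
    unfolding P_def qpoch_def by (rule convergent_prod_qpoch[OF q], rule refl)
  note mults = prodinf_mult[symmetric] prodinf_divide[symmetric] prodinf_power convergent_prod_mult
     convergent_prod_power
  have "(\<Prod>j. let k = Suc j in
         ((1 - q ^ k)\<^sup>2 * (1 - x * t * q ^ k) * (1 - inverse x * inverse t * q ^ k)) /
         ((1 - x * q ^ k) * (1 - inverse x * q ^ k) * (1 - t * q ^ k) * (1 - inverse t * q ^ k))) =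
     (\<Prod>j. (P 1 j ^ 2 * P (x * t) j * P (inverse x * inverse t) j) /
         (P x j * P (inverse x) j * P t j * P (inverse t) j))"
    by (simp add: P_def Let_def)
  also have "\<dots> = ((qpoch q 1)\<^sup>2 * qpoch q (x * t) * qpoch q (inverse x * inverse t)) /
         (qpoch q x * qpoch q (inverse x) * qpoch q t * qpoch q (inverse t))"
    unfolding P(2) by (simp add: mults P(1))
  finally show ?thesis
    unfolding phi_st_def ee_def[symmetric] q_def[symmetric] t_def[symmetric] x_def[symmetric] Let_def
    by (simp add: theta_def mult_ac)
qed

section \<open>Translation formulas, holomorphy and poles of \<open>phi_st\<close>\<close>

lemma phi_st_add_1:
  assumes "Im \<tau> > 0"
  shows "phi_st (z + 1) \<tau> \<sigma> = phi_st z \<tau> \<sigma>"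
  unfolding phi_st_eq_theta[OF assms] by (simp add: ee_add ee_Ints)

text \<open>With \<zeta> = \<open>ee \<sigma>\<close> and t = \<open>ee z\<close>, the two theta
  functions acquire the multipliers -1/(\<zeta> t) and -1/t; the quotient no longer depends on
  t.\<close>

lemma phi_st_add_tau:
  assumes "Im \<tau> > 0"
  shows "phi_st (z + \<tau>) \<tau> \<sigma> = inverse (ee \<sigma>) * phi_st z \<tau> \<sigma>"
proof -
  have q: "norm (ee \<tau>) < 1"
    using assms by (rule norm_ee_less_1)
  show ?thesis
    using theta_step[OF q, of "ee z"] theta_step[OF q, of "ee \<sigma> * ee z"]
    unfolding phi_st_eq_theta[OF assms] ee_add
    by (simp add: mult_ac)
qed

lemma phi_st_add_of_int:
  assumes "Im \<tau> > 0"
  shows "phi_st (z + of_int n) \<tau> \<sigma> = phi_st z \<tau> \<sigma>"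
proof -
  have "phi_st (z + of_nat m) \<tau> \<sigma> = phi_st z \<tau> \<sigma>" for z m
  proof (induction m)
    case (Suc m)
    then show ?case
      using phi_st_add_1[OF assms, of "z + of_nat m"] by (simp add: algebra_simps)
  qed auto
  note * = this
  show ?thesis
  proof (cases n rule: int_cases2)
    case (nonneg m)
    then show ?thesis using * by simp
  next
    case (nonpos m)
    then show ?thesis using *[of "z + of_int n" m] by simp
  qed
qed

lemma phi_st_add_of_int_tau:
  assumes "Im \<tau> > 0"
  shows "phi_st (z + of_int n * \<tau>) \<tau> \<sigma> = ee (- of_int n * \<sigma>) * phi_st z \<tau> \<sigma>"
proof -
  have *: "phi_st (z + of_nat m * \<tau>) \<tau> \<sigma> = ee (- of_nat m * \<sigma>) * phi_st z \<tau> \<sigma>" for z m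
  proof (induction m)
    case (Suc m)
    then show ?case
      using phi_st_add_tau[OF assms, of "z + of_nat m * \<tau>" \<sigma>]
      by (simp add: algebra_simps ee_add ee_minus)
         (simp add: ee_add[symmetric] ee_minus[symmetric] algebra_simps)
  qed auto
  show ?thesis
  proof (cases n rule: int_cases2)
    case (nonneg m)
    then show ?thesis using * by simp
  next
    case (nonpos m)
    then show ?thesis using *[of "z + of_int n * \<tau>" m] by (simp add: ee_minus)
  qed
qed

text \<open>Only \<open>ee \<sigma>\<close> enters \<open>phi_st\<close>. This permits replacing
  \<open>\<xi> i * \<sigma>\<close> by \<open>s \<bullet> v i\<close>, from which it differs by the
  integer \<open>k * \<eta> i\<close>.\<close>

lemma phi_st_sigma_add_int:
  assumes "m \<in> \<int>"
  shows "phi_st z \<tau> (\<sigma> + m) = phi_st z \<tau> \<sigma>"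
  unfolding phi_st_def ee_def[symmetric] using assms by (simp add: ee_add ee_Ints)

lemma period_lattice_of_real:
  assumes "Im \<tau> > 0" shows "complex_of_real r \<in> period_lattice \<tau> \<longleftrightarrow> r \<in> \<int>"
proof
  assume "complex_of_real r \<in> period_lattice \<tau>"
  then obtain a b where *: "complex_of_real r = of_int a + of_int b * \<tau>"
    unfolding period_lattice_def by auto
  then have "Im (complex_of_real r) = Im (of_int a + of_int b * \<tau>)"
    by simp
  then have "b = 0"
    using assms by simp
  with * show "r \<in> \<int>"
    by (metis Ints_of_int add.right_neutral mult_zero_left of_int_0 of_real_eq_iff of_real_of_int_eq)
next
  assume "r \<in> \<int>"
  then obtain n where "r = of_int n" by (auto elim: Ints_cases)
  then show "complex_of_real r \<in> period_lattice \<tau>"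
    unfolding period_lattice_def by (intro CollectI exI[of _ n] exI[of _ 0]) auto
qed

lemma phi_st_holomorphic:
  assumes "Im \<tau> > 0" "f holomorphic_on A" "\<And>z. z \<in> A \<Longrightarrow> f z \<notin> period_lattice \<tau>"
    and "\<sigma> \<notin> period_lattice \<tau>"
  shows "(\<lambda>z. phi_st (f z) \<tau> \<sigma>) holomorphic_on A"
proof -
  have q: "norm (ee \<tau>) < 1"
    using assms(1) by (rule norm_ee_less_1)
  have "theta (ee \<tau>) (ee \<sigma>) * theta (ee \<tau>) (ee (f z)) \<noteq> 0" if "z \<in> A" for z
    using that assms(3,4) by (simp add: theta_ee_eq_0_iff[OF assms(1)])
  then show ?thesis
    unfolding phi_st_eq_theta[OF assms(1)]
    by (intro holomorphic_on_divide)
       (auto simp: theta_def[abs_def] intro!: holomorphic_intros q assms(2))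
qed

text \<open>The limit does not depend on \<open>\<sigma>\<close>; this is why the residues of the genus can cancel.\<close>
lemma phi_st_pole:
  assumes "Im \<tau> > 0" "\<sigma> \<notin> period_lattice \<tau>"
  shows "((\<lambda>z. z * phi_st z \<tau> \<sigma>) \<longlongrightarrow> - 1 / (2 * pi * \<i>)) (at 0)"
proof -
  define q where "q = ee \<tau>"
  have q: "norm q < 1"
    unfolding q_def using assms(1) by (rule norm_ee_less_1)
  have x: "theta q (ee \<sigma>) \<noteq> 0"
    using assms by (simp add: q_def theta_ee_eq_0_iff)
  have P1: "qpoch q 1 \<noteq> 0"
  proof -
    have "norm (q ^ Suc j) < 1" for j
      using power_Suc_less_one[of "norm q" j] q by (cases "q = 0") (auto simp: norm_power norm_mult)
    then have "q ^ Suc j \<noteq> 1" for j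
      by (metis less_irrefl norm_one)
    then show ?thesis
      by (simp add: qpoch_eq_0_iff[OF q] del: power_Suc)
  qed
  \<comment> \<open>Once \<open>1 - ee z\<close> is split off, the rest of \<open>phi_st\<close> is
    continuous at 0. Its value there is 1: the theta values at \<open>ee \<sigma>\<close> cancel,
    and the normalising factor \<open>(qpoch q 1)\<^sup>2\<close> cancels the two remaining
    products.\<close>
  have hol: "(\<lambda>z. (qpoch q 1)\<^sup>2 * theta q (ee \<sigma> * ee z) / (theta q (ee \<sigma>) *
        (qpoch q (ee z) * qpoch q (inverse (ee z))))) \<midarrow>0\<rightarrow> 
     (qpoch q 1)\<^sup>2 * theta q (ee \<sigma> * ee 0) / (theta q (ee \<sigma>) *
        (qpoch q (ee 0) * qpoch q (inverse (ee 0))))"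
  proof (intro tendsto_intros)
    have c: "isCont g 0" if "g holomorphic_on UNIV" for g :: "complex \<Rightarrow> complex"
      using that holomorphic_on_imp_continuous_on continuous_on_eq_continuous_at open_UNIV by blast
    show "(\<lambda>z. theta q (ee \<sigma> * ee z)) \<midarrow>0\<rightarrow> theta q (ee \<sigma> * ee 0)"
      by (rule isContD, rule c) (auto simp: theta_def[abs_def] intro!: holomorphic_intros q)
    show "(\<lambda>z. qpoch q (ee z)) \<midarrow>0\<rightarrow> qpoch q (ee 0)"
      by (rule isContD, rule c) (auto intro!: holomorphic_intros q)
    show "(\<lambda>z. qpoch q (inverse (ee z))) \<midarrow>0\<rightarrow> qpoch q (inverse (ee 0))"
      by (rule isContD, rule c) (auto intro!: holomorphic_intros q)
    show "theta q (ee \<sigma>) * (qpoch q (ee 0) * qpoch q (inverse (ee 0))) \<noteq> 0"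
      using x P1 by simp
  qed
  have "((\<lambda>z. (ee z - 1) / z) \<longlongrightarrow> 2 * pi * \<i>) (at 0)"
  proof -
    have "(ee has_field_derivative 2 * pi * \<i>) (at 0)"
      unfolding ee_def[abs_def] by (auto intro!: derivative_eq_intros)
    then show ?thesis
      by (simp add: has_field_derivative_iff)
  qed
  from tendsto_minus[OF tendsto_inverse[OF this]]
  have "((\<lambda>z. - inverse ((ee z - 1) / z)) \<longlongrightarrow> - inverse (2 * pi * \<i>)) (at 0)"
    by simp
  moreover have "- inverse ((ee z - 1) / z) = z / (1 - ee z)" for z
    using minus_diff_eq[of "ee z" 1] by (metis inverse_divide minus_divide_right)
  ultimately have "((\<lambda>z. z / (1 - ee z)) \<longlongrightarrow> - inverse (2 * pi * \<i>)) (at 0)"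
    by (simp only:)
  note lim = tendsto_mult[OF this hol]
  have "(z / (1 - ee z)) * ((qpoch q 1)\<^sup>2 * theta q (ee \<sigma> * ee z) / (theta q (ee \<sigma>) *
        (qpoch q (ee z) * qpoch q (inverse (ee z))))) = z * phi_st z \<tau> \<sigma>" for z
    unfolding phi_st_eq_theta[OF assms(1)] q_def[symmetric] theta_def[of q "ee z"]
    by (simp add: divide_inverse mult_ac)
  moreover have "(qpoch q 1)\<^sup>2 * theta q (ee \<sigma> * ee 0) / (theta q (ee \<sigma>) *
        (qpoch q (ee 0) * qpoch q (inverse (ee 0)))) = 1"
    using x P1 by (simp add: power2_eq_square)
  moreover have "- inverse (2 * pi * \<i>) * 1 = - 1 / (2 * pi * \<i>)"
    by (simp only: divide_inverse mult_1_left mult_1_right mult_minus_left)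
  ultimately show ?thesis
    using lim by (simp only:)
qed

section \<open>Quasi-periodic functions\<close>

text \<open>The imaginary part bounds the coefficient of \<tau>; after that the norm bounds the
  other coefficient.\<close>

lemma finite_period_lattice_bounded:
  assumes "Im \<tau> > 0"
  shows "finite {w \<in> period_lattice \<tau>. norm w \<le> R}"
proof (rule finite_subset)
  define B where "B = \<lceil>R / Im \<tau>\<rceil>"
  define A where "A = \<lceil>R + of_int B * norm \<tau>\<rceil>"
  show "finite ((\<lambda>(a, b). of_int a + of_int b * \<tau>) ` ({-A..A} \<times> {-B..B}))"
    by simp
  show "{w \<in> period_lattice \<tau>. norm w \<le> R} \<subseteq> (\<lambda>(a, b). of_int a + of_int b * \<tau>) ` ({-A..A} \<times> {-B..B})"
  proof safe
    fix w assume w: "w \<in> period_lattice \<tau>" "norm w \<le> R"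
    then obtain a b where ab: "w = of_int a + of_int b * \<tau>"
      unfolding period_lattice_def by auto
    have "\<bar>of_int b\<bar> * Im \<tau> = \<bar>Im w\<bar>"
      using assms by (simp add: ab abs_mult)
    also have "\<dots> \<le> R"
      using abs_Im_le_cmod[of w] w(2) by linarith
    finally have "\<bar>of_int b\<bar> \<le> R / Im \<tau>"
      using assms by (simp add: field_simps)
    then have b: "\<bar>of_int b\<bar> \<le> real_of_int B"
      unfolding B_def by linarith
    have "\<bar>of_int a\<bar> = norm (of_int a :: complex)"
      by simp
    also have "of_int a = w - of_int b * \<tau>"
      by (simp add: ab)
    also have "norm \<dots> \<le> norm w + norm (of_int b * \<tau>)"
      by (rule norm_triangle_ineq4)
    also have "\<dots> \<le> R + of_int B * norm \<tau>"
      using w(2) b by (auto simp: norm_mult intro!: add_mono mult_right_mono)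
    finally have "\<bar>of_int a\<bar> \<le> real_of_int A"
      unfolding A_def by linarith
    then show "w \<in> (\<lambda>(a, b). of_int a + of_int b * \<tau>) ` ({-A..A} \<times> {-B..B})"
      using b by (intro image_eqI[of _ _ "(a, b)"]) (auto simp: ab abs_le_iff)
  qed
qed

lemma eventually_notin_period_lattice:
  assumes "Im \<tau> > 0"
  shows "eventually (\<lambda>x. x \<notin> period_lattice \<tau>) (at z)"
proof -
  have "eventually (\<lambda>x. x \<notin> {w \<in> period_lattice \<tau>. norm w \<le> norm z + 1} - {z}) (at z)"
  proof -
    have "closed ({w \<in> period_lattice \<tau>. norm w \<le> norm z + 1} - {z})"
      using finite_period_lattice_bounded[OF assms] by (intro finite_imp_closed) auto
    then have "eventually (\<lambda>x. x \<in> - ({w \<in> period_lattice \<tau>. norm w \<le> norm z + 1} - {z})) (at z)"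
      unfolding closed_def by (rule eventually_at_in_open') simp
    then show ?thesis by eventually_elim auto
  qed
  moreover have "eventually (\<lambda>x. x \<in> ball z 1 - {z}) (at z)"
    by (intro eventually_at_in_open) auto
  ultimately show ?thesis
  proof eventually_elim
    case (elim x)
    have "norm x \<le> norm z + 1"
      using elim(2) norm_triangle_ineq[of z "x - z"] by (simp add: dist_norm norm_minus_commute)
    then show ?case
      using elim by auto
  qed
qed

lemma filterlim_affine_at:
  fixes a b z :: complex
  assumes "b \<noteq> 0"
  shows "filterlim (\<lambda>x. a + b * x) (at (a + b * z)) (at z)"
  using assms by (intro filterlim_atI tendsto_intros) (auto simp: eventually_at_filter)

lemma eventually_affine_notin_period_lattice:
  assumes "Im \<tau> > 0" "b \<noteq> 0"
  shows "eventually (\<lambda>x. a + b * x \<notin> period_lattice \<tau>) (at z)"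
  using eventually_compose_filterlim[OF eventually_notin_period_lattice[OF assms(1)] filterlim_affine_at[OF assms(2)]] .

text \<open>The form in which poles occur along a line: the sign of the slope and the sign of the
  residue of \<open>phi_st\<close> cancel.\<close>

lemma phi_st_affine_pole:
  assumes "Im \<tau> > 0" "\<sigma> \<notin> period_lattice \<tau>" "c \<noteq> 0"
  shows "((\<lambda>z. (z - z0) * phi_st (- c * (z - z0)) \<tau> \<sigma>) \<longlongrightarrow> 1 / (2 * pi * \<i> * c)) (at z0)"
proof -
  have "filterlim (\<lambda>z. - c * (z - z0)) (at 0) (at z0)"
    using filterlim_affine_at[of "- c" "c * z0" z0] assms(3) by (simp add: algebra_simps)
  note lim = tendsto_mult_left[OF filterlim_compose[OF phi_st_pole[OF assms(1,2)] this], of "- 1 / c"]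
  have "- 1 / c * (- c * (z - z0) * phi_st (- c * (z - z0)) \<tau> \<sigma>) = (z - z0) * phi_st (- c * (z - z0)) \<tau> \<sigma>" for z
    using assms(3) by (simp only: mult.assoc[symmetric]) simp
  moreover have "- 1 / c * (- 1 / (2 * pi * \<i>)) = 1 / (2 * pi * \<i> * c)"
    by simp
  ultimately show ?thesis
    using lim by (simp only:)
qed

lemma tendsto_phi_st:
  assumes "Im \<tau> > 0" "\<sigma> \<notin> period_lattice \<tau>" "z \<notin> period_lattice \<tau>" "(f \<longlongrightarrow> z) F"
  shows "((\<lambda>x. phi_st (f x) \<tau> \<sigma>) \<longlongrightarrow> phi_st z \<tau> \<sigma>) F"
proof -
  obtain e where e: "e > 0" "\<And>x. x \<in> ball z e \<Longrightarrow> x \<noteq> z \<Longrightarrow> x \<notin> period_lattice \<tau>"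
    using eventually_notin_period_lattice[OF assms(1), of z]
    by (auto simp: eventually_at dist_commute)
  have "(\<lambda>x. phi_st x \<tau> \<sigma>) holomorphic_on ball z e"
    using e(2) assms(3) by (intro phi_st_holomorphic assms holomorphic_intros) auto
  then have "isCont (\<lambda>x. phi_st x \<tau> \<sigma>) z"
    using holomorphic_on_imp_continuous_on e(1)
    by (metis centre_in_ball continuous_on_eq_continuous_at open_ball)
  then show ?thesis
    using assms(4) isCont_tendsto_compose by blast
qed

text \<open>Since c has modulus 1, the norm of g is doubly periodic, and a bound on the compact
  period parallelogram K holds everywhere.\<close>

lemma quasi_periodic_bounded:
  fixes g :: "complex \<Rightarrow> complex"
  assumes "Im \<tau> > 0" "norm c = 1" "continuous_on UNIV g"
    and per: "\<And>z. g (z + 1) = g z" "\<And>z. g (z + \<tau>) = c * g z"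
  shows "bounded (range g)"
proof -
  define K where "K = (\<lambda>p. of_real (fst p) + of_real (snd p) * \<tau>) ` ({0..1::real} \<times> {0..1::real})"
  have "compact K"
    unfolding K_def by (intro compact_continuous_image continuous_intros compact_Times compact_Icc)
  then have "bounded (g ` K)"
    using assms(3) by (intro compact_imp_bounded compact_continuous_image) (auto intro: continuous_on_subset)
  then obtain M where M: "\<And>z. z \<in> K \<Longrightarrow> norm (g z) \<le> M"
    unfolding bounded_iff by auto
  have 1: "norm (g (z + of_int n)) = norm (g z)" for z n
  proof -
    have "norm (g (z + of_nat m)) = norm (g z)" for z m
    proof (induction m)
      case (Suc m)
      then show ?case using per(1)[of "z + of_nat m"] by (simp add: algebra_simps)
    qed simp
    note * = this
    show ?thesis
    proof (cases n rule: int_cases2)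
      case (nonneg m) then show ?thesis using * by simp
    next
      case (nonpos m) then show ?thesis using *[of "z + of_int n" m] by simp
    qed
  qed
  have 2: "norm (g (z + of_int n * \<tau>)) = norm (g z)" for z n
  proof -
    have "norm (g (z + of_nat m * \<tau>)) = norm (g z)" for z m
    proof (induction m)
      case (Suc m)
      then show ?case using per(2)[of "z + of_nat m * \<tau>"] assms(2) by (simp add: algebra_simps norm_mult)
    qed simp
    note * = this
    show ?thesis
    proof (cases n rule: int_cases2)
      case (nonneg m) then show ?thesis using * by simp
    next
      case (nonpos m) then show ?thesis using *[of "z + of_int n * \<tau>" m] by simp
    qed
  qed
  have "norm (g z) \<le> M" for z
  proof -
    define y where "y = Im z / Im \<tau>"
    define x where "x = Re z - y * Re \<tau>"
    have z: "z = of_real x + of_real y * \<tau>"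
      using assms(1) by (simp add: complex_eq_iff x_def y_def)
    have "z = (of_real (frac x) + of_real (frac y) * \<tau>) + of_int \<lfloor>x\<rfloor> + of_int \<lfloor>y\<rfloor> * \<tau>"
      by (simp add: z frac_def algebra_simps)
    then have "norm (g z) = norm (g (of_real (frac x) + of_real (frac y) * \<tau>))"
      using 1 2 by metis
    also have "\<dots> \<le> M"
      by (rule M, unfold K_def, rule image_eqI[of _ _ "(frac x, frac y)"])
         (auto simp: frac_lt_1 less_imp_le)
    finally show ?thesis .
  qed
  then show ?thesis
    unfolding bounded_iff by auto
qed

text \<open>The hypothesis \<open>lim\<close> says that the singularity is at most a simple pole
  with residue 0. Stated as a limit, it can be computed summand by summand for the genus.\<close>

lemma quasi_periodic_eq_0:
  fixes f :: "complex \<Rightarrow> complex"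
  assumes \<tau>: "Im \<tau> > 0" and c: "norm c = 1" "c \<noteq> 1"
    and sparse: "\<And>z. eventually (\<lambda>x. x \<notin> P) (at z)"
    and hol: "f holomorphic_on - P"
    and lim: "\<And>p. p \<in> P \<Longrightarrow> ((\<lambda>z. (z - p) * f z) \<longlongrightarrow> 0) (at p)"
    and per: "\<And>z. f (z + 1) = f z" "\<And>z. f (z + \<tau>) = c * f z"
    and z: "z \<notin> P"
  shows "f z = 0"
proof -
  have conv: "\<exists>l. isolated_singularity_at f p \<and> f \<midarrow>p\<rightarrow> l \<and> (p \<notin> P \<longrightarrow> l = f p)" for p
  proof -
    obtain e where e: "e > 0" "\<And>x. x \<in> ball p e \<Longrightarrow> x \<noteq> p \<Longrightarrow> x \<notin> P"
      using sparse[of p] by (auto simp: eventually_at dist_commute)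
    have hol': "f holomorphic_on ball p e - {p}"
      using e(2) by (intro holomorphic_on_subset[OF hol]) auto
    then have "isolated_singularity_at f p"
      unfolding isolated_singularity_at_def using e(1)
      by (intro exI[of _ e]) (simp add: analytic_on_open open_delete)
    moreover have "\<exists>g. g holomorphic_on ball p e \<and> (\<forall>z\<in>ball p e - {p}. g z = f z) \<and> (p \<notin> P \<longrightarrow> g p = f p)"
    proof (cases "p \<in> P")
      case True
      then show ?thesis
        using holomorphic_on_extend_lim[OF hol', of] lim[OF True] e(1) by auto
    next
      case False
      then have "f holomorphic_on ball p e"
        using e(2) False by (intro holomorphic_on_subset[OF hol]) (metis ComplI subsetI)
      then show ?thesis by blast
    qed
    then obtain g where g: "g holomorphic_on ball p e" "\<And>z. z\<in>ball p e - {p} \<Longrightarrow> g z = f z" "p \<notin> P \<Longrightarrow> g p = f p"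
      by blast
    have "isCont g p"
      using holomorphic_on_imp_continuous_on[OF g(1)] e(1)
      by (metis centre_in_ball continuous_on_eq_continuous_at open_ball)
    then have "f \<midarrow>p\<rightarrow> g p"
      unfolding isCont_def
      by (rule Lim_transform_within_open[of _ _ _ _ "ball p e"]) (use e(1) g(2) in auto)
    ultimately show ?thesis using g(3) by blast
  qed
  \<comment> \<open>\<open>remove_sings\<close> replaces each value by the limit, so g agrees with f
    off P. The functional equations pass to g by uniqueness of limits, also at the points of
    P.\<close>
  define g where "g = remove_sings f"
  have g: "f \<midarrow>p\<rightarrow> g p" for p
    using conv[of p] unfolding g_def by (metis remove_sings_eqI)
  have gf: "g p = f p" if "p \<notin> P" for p
    using conv[of p] that unfolding g_def by (metis remove_sings_eqI)
  have "g analytic_on UNIV"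
    unfolding g_def analytic_on_analytic_at[of _ UNIV]
    using conv by (auto intro: remove_sings_analytic_at)
  then have hol_g: "g holomorphic_on UNIV"
    by (rule analytic_imp_holomorphic)
  have per1: "g (p + 1) = g p" for p
  proof -
    have "(\<lambda>x. f (x + 1)) \<midarrow>p\<rightarrow> g (p + 1)"
      using LIM_offset[OF g[of "p + 1"], of 1] by simp
    then show ?thesis
      using g[of p] unfolding per by (rule LIM_unique)
  qed
  have per2: "g (p + \<tau>) = c * g p" for p
  proof -
    have "(\<lambda>x. f (x + \<tau>)) \<midarrow>p\<rightarrow> g (p + \<tau>)"
      using LIM_offset[OF g[of "p + \<tau>"], of \<tau>] by simp
    then show ?thesis
      using tendsto_mult_left[OF g[of p], of c] unfolding per by (rule LIM_unique)
  qed
  have "bounded (range g)"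
    using holomorphic_on_imp_continuous_on[OF hol_g] by (intro quasi_periodic_bounded[OF \<tau> c(1) _ per1 per2])
  with hol_g have "g constant_on UNIV"
    by (rule Liouville_theorem)
  then obtain d where "\<And>p. g p = d"
    unfolding constant_on_def by auto
  with per2[of 0] c(2) have "g z = 0"
    by simp
  then show ?thesis
    using gf[OF z] by simp
qed

section \<open>Lattices and transversals\<close>

definition add_subgroup :: "'a::ab_group_add set \<Rightarrow> bool" where
  "add_subgroup G \<longleftrightarrow> 0 \<in> G \<and> (\<forall>x\<in>G. \<forall>y\<in>G. x - y \<in> G)"

lemma add_subgroupD:
  assumes "add_subgroup G"
  shows add_subgroup_0: "0 \<in> G"
    and add_subgroup_diff: "x \<in> G \<Longrightarrow> y \<in> G \<Longrightarrow> x - y \<in> G"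
    and add_subgroup_minus: "x \<in> G \<Longrightarrow> - x \<in> G"
    and add_subgroup_add: "x \<in> G \<Longrightarrow> y \<in> G \<Longrightarrow> x + y \<in> G"
proof -
  show 0: "0 \<in> G" and d: "x \<in> G \<Longrightarrow> y \<in> G \<Longrightarrow> x - y \<in> G" for x y
    using assms by (auto simp: add_subgroup_def)
  show m: "x \<in> G \<Longrightarrow> - x \<in> G" for x
    using d[OF 0] by simp
  show "x \<in> G \<Longrightarrow> y \<in> G \<Longrightarrow> x + y \<in> G"
    using d[OF _ m] by (metis diff_minus_eq_add)
qed

lemma add_subgroup_of_int_scale:
  fixes x :: "'a::real_vector"
  assumes "add_subgroup G" "x \<in> G"
  shows "of_int n *\<^sub>R x \<in> G"
proof -
  have *: "of_nat m *\<^sub>R x \<in> G" for m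
    by (induction m) (auto simp: scaleR_add_left intro: assms add_subgroup_0 add_subgroup_add)
  then show ?thesis
    using add_subgroup_minus[OF assms(1) *] by (cases n rule: int_cases2) auto
qed

lemma add_subgroup_sum:
  "add_subgroup G \<Longrightarrow> (\<And>i. i \<in> A \<Longrightarrow> f i \<in> G) \<Longrightarrow> sum f A \<in> G"
  by (induction A rule: infinite_finite_induct) (auto intro: add_subgroup_0 add_subgroup_add)

lemma add_subgroup_int_span: "add_subgroup (int_span S)"
  unfolding add_subgroup_def
proof (intro conjI ballI)
  show "0 \<in> int_span S"
    unfolding int_span_def by (intro CollectI exI[of _ "{}"]) auto
  fix x y assume "x \<in> int_span S" "y \<in> int_span S"
  then obtain T c T' c' where *: "finite T" "T \<subseteq> S" "x = (\<Sum>b\<in>T. of_int (c b) *\<^sub>R b)"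
      "finite T'" "T' \<subseteq> S" "y = (\<Sum>b\<in>T'. of_int (c' b) *\<^sub>R b)"
    unfolding int_span_def by blast
  \<comment> \<open>Coefficients are extended by 0 to the union of the two supports before they are
    subtracted.\<close>
  define e where "e b = (if b \<in> T then c b else 0) - (if b \<in> T' then c' b else 0)" for b
  have "(\<Sum>b\<in>T \<union> T'. of_int (e b) *\<^sub>R b) =
      (\<Sum>b\<in>T \<union> T'. if b \<in> T then of_int (c b) *\<^sub>R b else 0) -
      (\<Sum>b\<in>T \<union> T'. if b \<in> T' then of_int (c' b) *\<^sub>R b else 0)"
    by (simp only: sum_subtractf[symmetric], intro sum.cong) (auto simp: e_def scaleR_diff_left)
  also have "(\<Sum>b\<in>T \<union> T'. if b \<in> T then of_int (c b) *\<^sub>R b else 0) = x"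
    using *(1,4) by (simp add: *(3) sum.inter_restrict[symmetric] Int_absorb1)
  also have "(\<Sum>b\<in>T \<union> T'. if b \<in> T' then of_int (c' b) *\<^sub>R b else 0) = y"
    using *(1,4) by (simp add: *(6) sum.inter_restrict[symmetric] Int_absorb1)
  finally have "x - y = (\<Sum>b\<in>T \<union> T'. of_int (e b) *\<^sub>R b)" ..
  then show "x - y \<in> int_span S"
    using * unfolding int_span_def by blast
qed

lemma int_span_base: "b \<in> S \<Longrightarrow> b \<in> int_span S"
  unfolding int_span_def by (intro CollectI exI[of _ "{b}"] exI[of _ "\<lambda>_. 1"]) auto

lemma int_span_subset:
  assumes "add_subgroup G" "S \<subseteq> G"
  shows "int_span S \<subseteq> G"
  using assms unfolding int_span_def
  by (auto intro!: add_subgroup_sum add_subgroup_of_int_scale)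

text \<open>The coordinate functional extends linearly to the whole space and is represented by
  \<open>adjoint f 1\<close>; the orthogonal projection to \<open>span S\<close> does not change its
  pairings with the vectors \<open>v j\<close>.\<close>

lemma exists_dual_vector:
  fixes v :: "'i \<Rightarrow> 'v::euclidean_space"
  assumes "inj_on v I" "independent (v ` I)" "v ` I \<subseteq> span S"
  shows "\<exists>u. u \<in> span S \<and> (\<forall>j\<in>I. u \<bullet> v j = (if j = i then 1 else 0))"
proof (cases "i \<in> I")
  case True
  obtain f :: "'v \<Rightarrow> real" where f: "linear f" "\<forall>x\<in>v ` I. f x = (if x = v i then 1 else 0)"
    using linear_independent_extend[OF assms(2), of "\<lambda>x. if x = v i then 1 else 0"] by auto
  obtain y z where yz: "y \<in> span S" "\<And>w. w \<in> span S \<Longrightarrow> orthogonal z w" "adjoint f 1 = y + z"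
    using orthogonal_subspace_decomp_exists[of S "adjoint f 1"] by metis
  have "y \<bullet> v j = (if j = i then 1 else 0)" if "j \<in> I" for j
  proof -
    have "y \<bullet> v j = adjoint f 1 \<bullet> v j"
      using yz(2)[of "v j"] assms(3) that by (auto simp: yz(3) inner_add_left orthogonal_def)
    also have "\<dots> = f (v j)"
      using adjoint_works[OF f(1), of "v j" 1] by (simp add: inner_commute)
    also have "\<dots> = (if j = i then 1 else 0)"
      using f(2) that True assms(1) by (auto simp: inj_on_def)
    finally show ?thesis .
  qed
  with yz(1) show ?thesis by blast
next
  case False
  then show ?thesis
    by (intro exI[of _ 0]) (auto simp: span_zero)
qed

text \<open>Pairing with dual vectors recovers the integral coefficients, so Cauchy-Schwarz leaves
  finitely many choices for each of them.\<close>

lemma finite_int_span_bounded: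
  fixes B :: "'v::euclidean_space set"
  assumes "independent B"
  shows "finite {x \<in> int_span B. norm x \<le> R}"
proof -
  have B: "finite B"
    using assms by (rule independent_imp_finite)
  have "\<forall>b. \<exists>u. \<forall>j\<in>B. u \<bullet> j = (if j = b then 1 else 0)"
    using exists_dual_vector[of "\<lambda>x. x" B B] assms span_superset[of B]
    by (metis image_ident inj_on_id2)
  then obtain d where d: "\<And>b j. j \<in> B \<Longrightarrow> d b \<bullet> j = (if j = b then 1 else 0)"
    by metis
  define M where "M b = \<lceil>norm (d b) * R\<rceil>" for b
  have "{x \<in> int_span B. norm x \<le> R} \<subseteq>
     (\<lambda>c. \<Sum>b\<in>B. real_of_int (c b) *\<^sub>R b) ` (PiE B (\<lambda>b. {- M b..M b}))"
  proof safe
    fix x assume x: "x \<in> int_span B" "norm x \<le> R"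
    then obtain T c where T: "finite T" "T \<subseteq> B" "x = (\<Sum>b\<in>T. of_int (c b) *\<^sub>R b)"
      unfolding int_span_def by blast
    define e where "e = restrict (\<lambda>b. if b \<in> T then c b else 0) B"
    have xe: "x = (\<Sum>b\<in>B. of_int (e b) *\<^sub>R b)"
      unfolding T(3) using T(2) B by (intro sum.mono_neutral_cong_left) (auto simp: e_def)
    have "e b \<in> {- M b..M b}" if "b \<in> B" for b
    proof -
      have "d b \<bullet> x = (\<Sum>a\<in>B. if a = b then of_int (e a) else 0)"
        unfolding xe inner_sum_right by (intro sum.cong) (auto simp: d)
      then have "d b \<bullet> x = of_int (e b)"
        using that B by simp
      moreover have "\<bar>d b \<bullet> x\<bar> \<le> norm (d b) * R"
        using Cauchy_Schwarz_ineq2[of "d b" x] x(2) by (meson mult_left_mono norm_ge_zero order_trans)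
      ultimately have "\<bar>of_int (e b)\<bar> \<le> real_of_int (M b)"
        unfolding M_def by linarith
      then show ?thesis by auto
    qed
    then have "e \<in> PiE B (\<lambda>b. {- M b..M b})"
      by (auto simp: e_def)
    then show "x \<in> (\<lambda>c. \<Sum>b\<in>B. real_of_int (c b) *\<^sub>R b) ` (PiE B (\<lambda>b. {- M b..M b}))"
      using xe by blast
  qed
  moreover have "finite (PiE B (\<lambda>b. {- M b..M b}))"
    using B by (intro finite_PiE) auto
  ultimately show ?thesis
    using finite_surj by blast
qed

text \<open>Needed to see that the exceptional displacements of the line form a countable
  set.\<close>

lemma countable_lattice:
  assumes "is_lattice L"
  shows "countable L"
proof -
  obtain B where B: "independent B" "L = int_span B"
    using assms unfolding is_lattice_def by blast
  have "L = (\<Union>n. {x \<in> int_span B. norm x \<le> real n})"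
    unfolding B(2) using real_arch_simple by blast
  moreover have "countable (\<Union>n. {x \<in> int_span B. norm x \<le> real n})"
    using finite_int_span_bounded[OF B(1)] by (intro countable_UN[OF countableI_type] countable_finite)
  ultimately show ?thesis
    by simp
qed

text \<open>Sums over \<open>A / G\<close> are handled through explicit representatives because
  these can be translated and adapted to a hyperplane, unlike the arbitrary choices made by
  \<open>rep\<close>.\<close>

definition transversal :: "'a::ab_group_add set \<Rightarrow> 'a set \<Rightarrow> 'a set \<Rightarrow> bool" where
  "transversal A G R \<longleftrightarrow> finite R \<and> R \<subseteq> A \<and> (\<forall>x\<in>A. \<exists>!y. y \<in> R \<and> x - y \<in> G)"

lemma transversal_finite: "transversal A G R \<Longrightarrow> finite R"
  and transversal_subset: "transversal A G R \<Longrightarrow> R \<subseteq> A"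
  by (auto simp: transversal_def)

lemma transversal_ex: "transversal A G R \<Longrightarrow> x \<in> A \<Longrightarrow> \<exists>y\<in>R. x - y \<in> G"
  unfolding transversal_def by (meson ex1_implies_ex)

lemma transversal_unique:
  assumes "transversal A G R" "add_subgroup G" "y \<in> R" "y' \<in> R" "y - y' \<in> G"
  shows "y = y'"
  using assms unfolding transversal_def
  by (metis add_subgroup_0 cancel_comm_monoid_add_class.diff_cancel subsetD)

text \<open>The choice of y depends only on the class of x, since the chosen predicate does; the
  chosen elements all lie in the finite set F.\<close>

lemma exists_transversal:
  assumes "add_subgroup G" "finite F" "\<And>x. x \<in> A \<Longrightarrow> \<exists>y\<in>F. y \<in> A \<and> x - y \<in> G"
  shows "\<exists>R. transversal A G R"
proof -
  define c where "c x = (SOME y. y \<in> F \<and> y \<in> A \<and> x - y \<in> G)" for x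
  have c: "c x \<in> F" "c x \<in> A" "x - c x \<in> G" if "x \<in> A" for x
    using someI_ex[of "\<lambda>y. y \<in> F \<and> y \<in> A \<and> x - y \<in> G"] assms(3)[OF that]
    unfolding c_def by blast+
  have c_eq: "c x = c x'" if "x - x' \<in> G" for x x'
  proof -
    have "x - y \<in> G \<longleftrightarrow> x' - y \<in> G" for y
      using add_subgroup_add[OF assms(1) that, of "x' - y"]
        add_subgroup_diff[OF assms(1) _ that, of "x - y"] by auto
    then show ?thesis
      unfolding c_def by simp
  qed
  have "transversal A G (c ` A)"
    unfolding transversal_def
  proof (intro conjI ballI)
    show "finite (c ` A)"
      using assms(2) c(1) by (meson finite_subset image_subsetI)
    show "c ` A \<subseteq> A"
      using c by blast
    fix x assume x: "x \<in> A"
    show "\<exists>!y. y \<in> c ` A \<and> x - y \<in> G"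
    proof (intro ex1I[of _ "c x"])
      show "c x \<in> c ` A \<and> x - c x \<in> G"
        using c x by blast
      fix y assume y: "y \<in> c ` A \<and> x - y \<in> G"
      then obtain a where a: "a \<in> A" "y = c a"
        by blast
      have "c x = c y"
        using y by (blast intro: c_eq)
      also have "\<dots> = c a"
        using c_eq[OF c(3)[OF a(1)]] a(2) by simp
      finally show "y = c x"
        using a(2) by simp
    qed
  qed
  then show ?thesis ..
qed

text \<open>Sending an element of one transversal to the representative of its class in the other is
  a bijection, with f constant along it.\<close>

lemma sum_transversal_eq:
  assumes G: "add_subgroup G" and R: "transversal A G R" "transversal A G R'"
    and f: "\<And>x y. x \<in> A \<Longrightarrow> y \<in> A \<Longrightarrow> x - y \<in> G \<Longrightarrow> f x = f y"
  shows "sum f R = sum f R'"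
proof -
  define p where "p S x = (THE y. y \<in> S \<and> x - y \<in> G)" for S x
  have p: "p S x \<in> S" "x - p S x \<in> G" if "transversal A G S" "x \<in> A" for S x
    using theI'[of "\<lambda>y. y \<in> S \<and> x - y \<in> G"] that unfolding transversal_def p_def by blast+
  have pp: "p S (p S' x) = x" if "transversal A G S" "transversal A G S'" "x \<in> S" for S S' x
  proof -
    have x: "x \<in> A"
      using that transversal_subset by blast
    have x': "p S' x \<in> A"
      using p(1)[OF that(2) x] that(2) transversal_subset by blast
    have "(x - p S' x) + (p S' x - p S (p S' x)) \<in> G"
      using add_subgroup_add[OF G p(2)[OF that(2) x] p(2)[OF that(1) x']] .
    then show ?thesis
      using transversal_unique[OF that(1) G that(3) p(1)[OF that(1) x']] by simp
  qed
  show ?thesis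
  proof (rule sum.reindex_bij_witness[of _ "p R" "p R'"])
    fix x assume "x \<in> R"
    then have "x \<in> A" using R transversal_subset by blast
    then show "p R' x \<in> R'" "f (p R' x) = f x"
      using p[OF R(2)] R(2) transversal_subset f by (blast, metis (full_types) subsetD)
  qed (use pp[OF R] pp[OF R(2,1)] p[OF R(1)] R transversal_subset in blast)+
qed

text \<open>A lattice shift of w is absorbed into the summation over representatives in this
  way.\<close>

lemma transversal_translate:
  assumes "add_subgroup A" "transversal A G R" "a \<in> A"
  shows "transversal A G ((+) a ` R)"
  unfolding transversal_def
proof (intro conjI ballI)
  show "finite ((+) a ` R)" "(+) a ` R \<subseteq> A"
    using assms by (auto simp: transversal_def intro!: add_subgroup_add)
  fix x assume "x \<in> A"
  then have "x - a \<in> A"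
    using assms add_subgroup_diff by blast
  then obtain y where y: "y \<in> R" "x - a - y \<in> G" "\<And>y'. y' \<in> R \<Longrightarrow> x - a - y' \<in> G \<Longrightarrow> y' = y"
    using assms(2) unfolding transversal_def by blast
  show "\<exists>!y. y \<in> (+) a ` R \<and> x - y \<in> G"
  proof (rule ex1I[of _ "a + y"])
    show "a + y \<in> (+) a ` R \<and> x - (a + y) \<in> G"
      using y(1,2) by (simp add: diff_diff_eq)
    fix z assume "z \<in> (+) a ` R \<and> x - z \<in> G"
    then obtain y' where y': "y' \<in> R" "z = a + y'" "x - a - y' \<in> G"
      by (auto simp: diff_diff_eq)
    then show "z = a + y"
      using y(3) by blast
  qed
qed

text \<open>The link to the defining formula: the \<open>SOME\<close> choices of \<open>rep\<close>
  pick one element per class. The transversal R only provides finiteness of the quotient.\<close>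

lemma transversal_rep:
  assumes G: "add_subgroup G" "transversal L G R"
  shows "transversal L G (rep ` (L // {(x, y). x \<in> L \<and> y \<in> L \<and> x - y \<in> G}))"
    and "inj_on rep (L // {(x, y). x \<in> L \<and> y \<in> L \<and> x - y \<in> G})"
proof -
  define cls where "cls x = {y \<in> L. x - y \<in> G}" for x
  define Q where "Q = L // {(x, y). x \<in> L \<and> y \<in> L \<and> x - y \<in> G}"
  have Q: "Q = cls ` L"
    unfolding Q_def quotient_def cls_def by auto
  have cls_eq: "cls x = cls y" if "x - y \<in> G" for x y
  proof -
    have "x - z \<in> G \<longleftrightarrow> y - z \<in> G" for z
      using add_subgroup_add[OF G(1) that, of "y - z"]
        add_subgroup_diff[OF G(1) _ that, of "x - z"] by auto
    then show ?thesis
      unfolding cls_def by simp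
  qed
  have rep: "rep (cls x) \<in> L" "x - rep (cls x) \<in> G" if "x \<in> L" for x
  proof -
    have "x \<in> cls x"
      using that G(1) by (simp add: cls_def add_subgroup_0)
    then have "rep (cls x) \<in> cls x"
      unfolding rep_def by (rule someI)
    then show "rep (cls x) \<in> L" "x - rep (cls x) \<in> G"
      unfolding cls_def by auto
  qed
  have cls_rep: "cls (rep (cls x)) = cls x" if "x \<in> L" for x
    using cls_eq[OF rep(2)[OF that]] by simp
  show "inj_on rep Q"
    unfolding Q using cls_rep by (intro inj_onI) (metis imageE)
  have "Q \<subseteq> cls ` R"
  proof
    fix h assume "h \<in> Q"
    then obtain x where x: "x \<in> L" "h = cls x"
      unfolding Q by blast
    obtain y where "y \<in> R" "x - y \<in> G"
      using transversal_ex[OF G(2) x(1)] by blast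
    then show "h \<in> cls ` R"
      using cls_eq x(2) by blast
  qed
  then have fin: "finite Q"
    using transversal_finite[OF G(2)] finite_surj by blast
  show "transversal L G (rep ` Q)"
    unfolding transversal_def
  proof (intro conjI ballI)
    show "finite (rep ` Q)" "rep ` Q \<subseteq> L"
      using fin rep(1) unfolding Q by auto
    fix x assume x: "x \<in> L"
    show "\<exists>!y. y \<in> rep ` Q \<and> x - y \<in> G"
    proof (rule ex1I[of _ "rep (cls x)"])
      show "rep (cls x) \<in> rep ` Q \<and> x - rep (cls x) \<in> G"
        using rep(2)[OF x] x unfolding Q by blast
      fix y assume y: "y \<in> rep ` Q \<and> x - y \<in> G"
      then obtain x' where "x' \<in> L" "y = rep (cls x')"
        unfolding Q by blast
      moreover have "cls x = cls y"
        using y cls_eq by blast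
      ultimately show "y = rep (cls x)"
        using cls_rep by metis
    qed
  qed
qed

lemma sum_quotient_rep:
  assumes G: "add_subgroup G" "transversal L G R"
    and f: "\<And>x y. x \<in> L \<Longrightarrow> y \<in> L \<Longrightarrow> x - y \<in> G \<Longrightarrow> f x = f y"
  shows "(\<Sum>h\<in>L // {(x, y). x \<in> L \<and> y \<in> L \<and> x - y \<in> G}. f (rep h)) = sum f R"
  using sum.reindex[OF transversal_rep(2)[OF G], of f]
    sum_transversal_eq[OF G(1) transversal_rep(1)[OF G] G(2) f] by (simp add: o_def)

lemma card_quotient_transversal:
  assumes "add_subgroup G" "transversal L G R"
  shows "card (L // {(x, y). x \<in> L \<and> y \<in> L \<and> x - y \<in> G}) = card R"
  using sum_quotient_rep[OF assms, of "\<lambda>_. 1::nat"] by simp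

text \<open>The values of u on L form a discrete group; its least positive element
  \<open>u \<bullet> e\<close> divides all others, by division with remainder, and \<kappa> is its
  inverse. The purpose is to rescale a dual vector to a primitive normal.\<close>

lemma discrete_functional_primitive:
  fixes u :: "'v::euclidean_space"
  assumes L: "add_subgroup L" and x0: "x0 \<in> L" "u \<bullet> x0 = 1"
    and fin: "finite {frac (u \<bullet> x) | x. x \<in> L}"
  obtains \<kappa> e where "\<kappa> > 0" "e \<in> L" "\<kappa> * (u \<bullet> e) = 1" "\<And>x. x \<in> L \<Longrightarrow> \<kappa> * (u \<bullet> x) \<in> \<int>"
proof -
  define D where "D = {u \<bullet> x | x. x \<in> L \<and> 0 < u \<bullet> x \<and> u \<bullet> x \<le> 1}"
  \<comment> \<open>A value in the half-open interval from 0 to 1 is either 1 or its own fractional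
    part.\<close>
  have "D \<subseteq> insert 1 {frac (u \<bullet> x) | x. x \<in> L}"
    unfolding D_def by (smt (verit) frac_eq insertCI mem_Collect_eq subsetI)
  then have "finite D"
    using fin finite_subset by blast
  moreover have "1 \<in> D"
    using x0 by (force simp: D_def)
  ultimately have Min: "Min D \<in> D" "\<And>y. y \<in> D \<Longrightarrow> Min D \<le> y"
    by (auto intro: Min_in)
  then obtain e where e: "e \<in> L" "0 < u \<bullet> e" "u \<bullet> e \<le> 1" "Min D = u \<bullet> e"
    unfolding D_def by auto
  have int: "u \<bullet> x / (u \<bullet> e) \<in> \<int>" if x: "x \<in> L" for x
  proof (rule ccontr)
    assume not_int: "u \<bullet> x / (u \<bullet> e) \<notin> \<int>"
    define y where "y = x - of_int \<lfloor>u \<bullet> x / (u \<bullet> e)\<rfloor> *\<^sub>R e"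
    have y: "y \<in> L"
      unfolding y_def using L x e(1) by (intro add_subgroup_diff add_subgroup_of_int_scale)
    have "u \<bullet> y = frac (u \<bullet> x / (u \<bullet> e)) * (u \<bullet> e)"
      using e(2) by (simp add: y_def frac_def inner_diff_right field_simps)
    moreover have "0 < frac (u \<bullet> x / (u \<bullet> e))" "frac (u \<bullet> x / (u \<bullet> e)) < 1"
      using not_int by (auto simp: frac_lt_1)
    ultimately have "0 < u \<bullet> y" "u \<bullet> y < u \<bullet> e"
      using e(2) by auto
    then have "u \<bullet> y \<in> D"
      unfolding D_def using y e(3) by force
    then show False
      using Min(2) \<open>u \<bullet> y < u \<bullet> e\<close> e(4) by force
  qed
  show thesis
    by (rule that[of "1 / (u \<bullet> e)" e]) (use e int in auto)
qed

section \<open>Dual bases of maximal simplices\<close>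

locale edged_multifan =
  fixes \<Delta> :: "('i, 'v::euclidean_space) multifan" and v :: "'i \<Rightarrow> 'v"
  assumes multifan: "simplicial_multifan \<Delta>" and edges: "edge_vectors \<Delta> v"
begin

abbreviation "L \<equiv> lat \<Delta>"
abbreviation "Top \<equiv> top_simplices \<Delta>"
abbreviation "du \<equiv> dual_vec \<Delta> v"

section \<open>Cones, edge vectors and their independence\<close>

lemma multifanD:
  shows "is_lattice L" "finite (simplices \<Delta>)" "\<forall>J\<in>simplices \<Delta>. finite J"
    "\<forall>J\<in>simplices \<Delta>. \<forall>J'\<subseteq>J. J' \<in> simplices \<Delta>" "Top \<noteq> {}"
    "\<forall>J\<in>simplices \<Delta>. \<exists>I\<in>Top. J \<subseteq> I" "cone_at \<Delta> {} = {0}"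
    "\<forall>J\<in>simplices \<Delta>. strongly_convex_rational_cone L (cone_at \<Delta> J) \<and> dim (cone_at \<Delta> J) = card J"
    "\<forall>I\<in>simplices \<Delta>. bij_betw (cone_at \<Delta>) (Pow I) (cone_faces (cone_at \<Delta> I)) \<and>
        (\<forall>J\<subseteq>I. \<forall>J'\<subseteq>I. J \<subseteq> J' \<longleftrightarrow> cone_at \<Delta> J \<subseteq> cone_at \<Delta> J')"
  using multifan[unfolded simplicial_multifan_def] by - (elim conjE, assumption)+

lemmas is_lattice_L = multifanD(1)
  and finite_simplices = multifanD(2)
  and simplices_finite = bspec[OF multifanD(3)]
  and Top_nonempty = multifanD(5)
  and simplices_extend = bspec[OF multifanD(6)]
  and cone_empty = multifanD(7)
  and cone_rational = bspec[OF multifanD(8), THEN conjunct1]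
  and dim_cone = bspec[OF multifanD(8), THEN conjunct2]
  and cone_bij = bspec[OF multifanD(9), THEN conjunct1]

lemma simplices_mono: "J \<in> simplices \<Delta> \<Longrightarrow> J' \<subseteq> J \<Longrightarrow> J' \<in> simplices \<Delta>"
  using multifanD(4) by blast

lemma cone_order:
  assumes "I \<in> simplices \<Delta>" "J \<subseteq> I" "J' \<subseteq> I"
  shows "J \<subseteq> J' \<longleftrightarrow> cone_at \<Delta> J \<subseteq> cone_at \<Delta> J'"
proof -
  from bspec[OF multifanD(9) assms(1), THEN conjunct2, rule_format, OF assms(2,3)] show ?thesis .
qed

lemma Top_simplices: "I \<in> Top \<Longrightarrow> I \<in> simplices \<Delta>"
  and Top_card: "I \<in> Top \<Longrightarrow> card I = lat_rank \<Delta>"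
  unfolding top_simplices_def by auto

lemma finite_Top: "finite Top"
  using finite_simplices unfolding top_simplices_def by auto

lemma Top_finite: "I \<in> Top \<Longrightarrow> finite I"
  using Top_simplices simplices_finite by blast

lemma add_subgroup_L: "add_subgroup L"
  using is_lattice_L add_subgroup_int_span unfolding is_lattice_def by auto

lemma vertex_of: "J \<in> simplices \<Delta> \<Longrightarrow> i \<in> J \<Longrightarrow> i \<in> vertices \<Delta>"
  unfolding vertices_def using simplices_mono[of J "{i}"] by auto

lemma edge:
  assumes "J \<in> simplices \<Delta>" "i \<in> J"
  shows "v i \<noteq> 0" "v i \<in> L" "v i \<in> cone_at \<Delta> {i}"
  using edges vertex_of[OF assms] unfolding edge_vectors_def by auto

lemma convex_cone_cone: "J \<in> simplices \<Delta> \<Longrightarrow> convex_cone (cone_at \<Delta> J)"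
  using cone_rational convex_cone_convex_cone_hull unfolding strongly_convex_rational_cone_def by metis

lemma cone_pointed: "J \<in> simplices \<Delta> \<Longrightarrow> x \<in> cone_at \<Delta> J \<Longrightarrow> - x \<in> cone_at \<Delta> J \<Longrightarrow> x = 0"
  using cone_rational unfolding strongly_convex_rational_cone_def by blast

lemma cone_face: "I \<in> simplices \<Delta> \<Longrightarrow> J \<subseteq> I \<Longrightarrow> cone_at \<Delta> J face_of cone_at \<Delta> I"
  using cone_bij[of I] unfolding bij_betw_def cone_faces_def by blast

lemma cone_mono: "I \<in> simplices \<Delta> \<Longrightarrow> J \<subseteq> I \<Longrightarrow> cone_at \<Delta> J \<subseteq> cone_at \<Delta> I"
  using cone_face face_of_imp_subset by blast

text \<open>A face is the intersection of the cone with the affine hull of the face, and this affine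
  hull is a linear span because it contains 0.\<close>

lemma cone_span_Int:
  assumes "I \<in> simplices \<Delta>" "J \<subseteq> I" "x \<in> cone_at \<Delta> I" "x \<in> span (cone_at \<Delta> J)"
  shows "x \<in> cone_at \<Delta> J"
proof -
  have "convex (cone_at \<Delta> I)"
    using convex_cone_cone[OF assms(1)] by (simp add: convex_cone_def)
  then have *: "cone_at \<Delta> J = affine hull (cone_at \<Delta> J) \<inter> cone_at \<Delta> I"
    using cone_face[OF assms(1,2)] by (rule face_of_imp_eq_affine_Int)
  have "0 \<in> affine hull (cone_at \<Delta> J)"
    using convex_cone_contains_0[OF convex_cone_cone[OF simplices_mono[OF assms(1,2)]]]
    by (simp add: hull_inc)
  then have "affine hull (cone_at \<Delta> J) = span (cone_at \<Delta> J)"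
    by (rule affine_hull_span_0)
  with * assms(3,4) show ?thesis by blast
qed

lemma edge_in_cone: "J \<in> simplices \<Delta> \<Longrightarrow> i \<in> J \<Longrightarrow> v i \<in> cone_at \<Delta> J"
  using edge(3) cone_mono[of J "{i}"] by blast

text \<open>The cone of a vertex is one-dimensional and pointed, hence it consists of nonnegative
  multiples of \<open>v i\<close>. This turns membership of an edge vector into an inclusion of
  cones, to which the order isomorphism applies.\<close>

lemma ray_subset:
  assumes "J \<in> simplices \<Delta>" "i \<in> J" "convex_cone C" "v i \<in> C"
  shows "cone_at \<Delta> {i} \<subseteq> C"
proof
  have i: "{i} \<in> simplices \<Delta>"
    using simplices_mono[OF assms(1), of "{i}"] assms(2) by auto
  have vi: "v i \<noteq> 0" "v i \<in> cone_at \<Delta> {i}"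
    using edge[OF assms(1,2)] by auto
  have "cone_at \<Delta> {i} \<subseteq> span {v i}"
    using vi dim_cone[OF i] by (intro card_ge_dim_independent) auto
  moreover fix x assume x: "x \<in> cone_at \<Delta> {i}"
  ultimately obtain c where c: "x = c *\<^sub>R v i"
    by (auto simp: span_singleton)
  have "c \<ge> 0"
  proof (rule ccontr)
    assume "\<not> c \<ge> 0"
    then have "(1 / (- c)) *\<^sub>R x \<in> cone_at \<Delta> {i}" and eq: "(1 / (- c)) *\<^sub>R x = - v i"
      using convex_cone_scaleR[OF convex_cone_cone[OF i] _ x, of "1 / (- c)"] by (auto simp: c)
    then show False
      unfolding eq using cone_pointed[OF i vi(2)] vi(1) by blast
  qed
  then show "x \<in> C"
    using c assms(3,4) by (simp add: convex_cone_scaleR)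
qed

lemma edges_independent:
  assumes "J \<in> simplices \<Delta>"
  shows "inj_on v J \<and> independent (v ` J) \<and> span (v ` J) = span (cone_at \<Delta> J)"
proof -
  have "finite J"
    using assms by (rule simplices_finite)
  then show ?thesis
    using assms
  proof (induction J rule: finite_induct)
    case empty
    then show ?case
      by (simp add: cone_empty independent_empty)
  next
    case (insert i J)
    have J: "J \<in> simplices \<Delta>"
      using insert.prems simplices_mono by blast
    note IH = insert.IH[OF J]
    \<comment> \<open>A dependence would put \<open>v i\<close> into the face of J, hence the ray of
      i into that face, and the order isomorphism would make i a vertex of J.\<close>
    have notin: "v i \<notin> span (v ` J)"
    proof
      assume "v i \<in> span (v ` J)"
      then have "v i \<in> cone_at \<Delta> J"
        using IH cone_span_Int[OF insert.prems subset_insertI edge_in_cone[OF insert.prems insertI1]] by simp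
      then have "cone_at \<Delta> {i} \<subseteq> cone_at \<Delta> J"
        using ray_subset[OF insert.prems insertI1 convex_cone_cone[OF J]] by simp
      then have "{i} \<subseteq> J"
        using cone_order[OF insert.prems, of "{i}" J] by auto
      then show False
        using insert.hyps by auto
    qed
    then have inj: "inj_on v (insert i J)"
      using IH span_base[of _ "v ` J"] by (auto simp: inj_on_insert)
    have ind: "independent (v ` insert i J)"
      using IH notin by (simp add: independent_insertI)
    have sub: "v ` insert i J \<subseteq> cone_at \<Delta> (insert i J)"
      using edge_in_cone[OF insert.prems] by blast
    have "cone_at \<Delta> (insert i J) \<subseteq> span (v ` insert i J)"
      using sub ind by (rule card_ge_dim_independent) (simp only: dim_cone[OF insert.prems] card_image[OF inj])
    then have "span (v ` insert i J) = span (cone_at \<Delta> (insert i J))"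
      using sub by (meson span_mono span_minimal subspace_span subset_antisym)
    then show ?case
      using inj ind by blast
  qed
qed

lemma edges_subset_L: "J \<in> simplices \<Delta> \<Longrightarrow> v ` J \<subseteq> L"
  using edge by blast

lemma span_Top:
  assumes "I \<in> Top"
  shows "span (v ` I) = span L"
proof -
  note I = edges_independent[OF Top_simplices[OF assms]]
  have "L \<subseteq> span (v ` I)"
    using edges_subset_L[OF Top_simplices[OF assms]] I
    by (intro card_ge_dim_independent) (auto simp: card_image Top_card[OF assms] lat_rank_def)
  then show ?thesis
    using edges_subset_L[OF Top_simplices[OF assms]]
    by (meson span_mono span_minimal subspace_span subset_antisym)
qed

text \<open>The difference is orthogonal to the edge vectors of I and also lies in their span, so it
  is orthogonal to itself.\<close>

lemma dual_vec_unique: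
  assumes "I \<in> Top" "u \<in> span L" "u' \<in> span L" "\<And>j. j \<in> I \<Longrightarrow> u \<bullet> v j = u' \<bullet> v j"
  shows "u = u'"
proof -
  have "span (v ` I) \<subseteq> {x. (u - u') \<bullet> x = 0}"
    by (intro span_minimal subspace_hyperplane) (auto simp: inner_diff_left assms(4))
  then have "(u - u') \<bullet> (u - u') = 0"
    using span_diff[OF assms(2,3)] span_Top[OF assms(1)] by blast
  then show ?thesis by simp
qed

lemma dual_vec:
  assumes "I \<in> Top"
  shows dual_vec_span: "du I i \<in> span L"
    and dual_vec_inner: "j \<in> I \<Longrightarrow> du I i \<bullet> v j = (if j = i then 1 else 0)"
proof -
  have I: "inj_on v I" "independent (v ` I)" "v ` I \<subseteq> span L"
    using edges_independent[OF Top_simplices[OF assms]] span_superset[of "v ` I"]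
    by (simp_all add: span_Top[OF assms])
  obtain u where u: "u \<in> span L" "\<forall>j\<in>I. u \<bullet> v j = (if j = i then 1 else 0)"
    using exists_dual_vector[OF I, of i] by blast
  have "du I i \<in> span L \<and> (\<forall>j\<in>I. du I i \<bullet> v j = (if j = i then 1 else 0))"
    unfolding dual_vec_def
  proof (rule theI)
    fix u' assume "u' \<in> span L \<and> (\<forall>j\<in>I. u' \<bullet> v j = (if j = i then 1 else 0))"
    then show "u' = u"
      using u by (intro dual_vec_unique[OF assms]) auto
  qed (use u in blast)
  then show "du I i \<in> span L" "j \<in> I \<Longrightarrow> du I i \<bullet> v j = (if j = i then 1 else 0)"
    by blast+
qed

lemma dual_vec_eqI:
  assumes "I \<in> Top" "u \<in> span L" "\<And>j. j \<in> I \<Longrightarrow> u \<bullet> v j = (if j = i then 1 else 0)"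
  shows "du I i = u"
  using assms dual_vec[OF assms(1)] by (intro dual_vec_unique[OF assms(1)]) auto

lemma dual_vec_expansion:
  assumes "I \<in> Top" "x \<in> span L"
  shows "(\<Sum>i\<in>I. (du I i \<bullet> x) *\<^sub>R v i) = x"
proof -
  have "span (v ` I) \<subseteq> {x. (\<Sum>i\<in>I. (du I i \<bullet> x) *\<^sub>R v i) = x}"
  proof (rule span_minimal)
    show "subspace {x. (\<Sum>i\<in>I. (du I i \<bullet> x) *\<^sub>R v i) = x}"
      by (rule subspaceI)
         (auto simp: inner_add_right scaleR_add_left sum.distrib simp flip: scaleR_scaleR scaleR_sum_right)
    have "(\<Sum>i\<in>I. (du I i \<bullet> v j) *\<^sub>R v i) = v j" if "j \<in> I" for j
    proof -
      have "(\<Sum>i\<in>I. (du I i \<bullet> v j) *\<^sub>R v i) = (\<Sum>i\<in>I. if i = j then v i else 0)"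
        using that by (intro sum.cong) (auto simp: dual_vec_inner[OF assms(1)])
      then show ?thesis
        using that Top_finite[OF assms(1)] by simp
    qed
    then show "v ` I \<subseteq> {x. (\<Sum>i\<in>I. (du I i \<bullet> x) *\<^sub>R v i) = x}"
      by auto
  qed
  then show ?thesis
    using assms span_Top by blast
qed

section \<open>Sublattices generated by edge vectors\<close>

lemma sublat_subset_L: "J \<in> simplices \<Delta> \<Longrightarrow> sublat v J \<subseteq> L"
  unfolding sublat_def using edges_subset_L add_subgroup_L by (intro int_span_subset)

lemma add_subgroup_sublat: "add_subgroup (sublat v J)"
  unfolding sublat_def by (rule add_subgroup_int_span)

lemma edge_in_sublat: "i \<in> J \<Longrightarrow> v i \<in> sublat v J"
  unfolding sublat_def by (intro int_span_base) auto

lemma sublat_dual_int: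
  assumes "I \<in> Top" "x \<in> sublat v I"
  shows "du I i \<bullet> x \<in> \<int>"
proof -
  have "sublat v I \<subseteq> {x. du I i \<bullet> x \<in> \<int>}"
    unfolding sublat_def
    by (rule int_span_subset) (auto simp: add_subgroup_def inner_diff_right dual_vec_inner[OF assms(1)])
  then show ?thesis
    using assms(2) by blast
qed

lemma sublatI:
  assumes "I \<in> Top" "J \<subseteq> I" "x \<in> span L" "\<And>j. j \<in> J \<Longrightarrow> du I j \<bullet> x \<in> \<int>"
    and "\<And>j. j \<in> I - J \<Longrightarrow> du I j \<bullet> x = 0"
  shows "x \<in> sublat v J"
proof -
  have "x = (\<Sum>j\<in>I. (du I j \<bullet> x) *\<^sub>R v j)"
    using dual_vec_expansion[OF assms(1,3)] by simp
  also have "\<dots> = (\<Sum>j\<in>J. (du I j \<bullet> x) *\<^sub>R v j)"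
    using assms(2,5) Top_finite[OF assms(1)] by (intro sum.mono_neutral_right) auto
  also have "\<dots> \<in> sublat v J"
  proof (rule add_subgroup_sum[OF add_subgroup_sublat])
    fix j assume j: "j \<in> J"
    then obtain n where "du I j \<bullet> x = of_int n"
      using assms(4) by (auto elim: Ints_cases)
    then show "(du I j \<bullet> x) *\<^sub>R v j \<in> sublat v J"
      using add_subgroup_of_int_scale[OF add_subgroup_sublat edge_in_sublat[OF j]] by simp
  qed
  finally show ?thesis .
qed

text \<open>Removing the integer parts of the coordinates moves a vector into the fundamental
  parallelepiped of the edge vectors, which contains finitely many lattice points. The subgroup A is
  general so as to cover both L and the lattice points of a facet hyperplane.\<close>

lemma exists_transversal_sublat:
  assumes "I \<in> Top" "J \<subseteq> I" "add_subgroup A" "A \<subseteq> L" "v ` J \<subseteq> A"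
    and "\<And>x j. x \<in> A \<Longrightarrow> j \<in> I - J \<Longrightarrow> du I j \<bullet> x = 0"
  shows "\<exists>R. transversal A (sublat v J) R"
proof (rule exists_transversal[OF add_subgroup_sublat])
  obtain B where B: "independent B" "L = int_span B"
    using is_lattice_L unfolding is_lattice_def by blast
  define F where "F = {x \<in> L. norm x \<le> (\<Sum>j\<in>I. norm (v j))}"
  show "finite F"
    unfolding F_def B(2) by (rule finite_int_span_bounded[OF B(1)])
  fix x assume x: "x \<in> A"
  define s where "s = (\<Sum>j\<in>J. of_int \<lfloor>du I j \<bullet> x\<rfloor> *\<^sub>R v j)"
  have s: "s \<in> sublat v J"
    unfolding s_def
    by (intro add_subgroup_sum add_subgroup_of_int_scale add_subgroup_sublat edge_in_sublat)
  have "s \<in> A"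
    unfolding s_def using assms(3,5) by (auto intro!: add_subgroup_sum add_subgroup_of_int_scale)
  then have y: "x - s \<in> A"
    using assms(3) x add_subgroup_diff by blast
  have "x = (\<Sum>j\<in>I. (du I j \<bullet> x) *\<^sub>R v j)"
    using dual_vec_expansion[OF assms(1)] x assms(4) by (metis span_base subsetD)
  also have "\<dots> = (\<Sum>j\<in>J. (du I j \<bullet> x) *\<^sub>R v j)"
    using assms(2,6) x Top_finite[OF assms(1)] by (intro sum.mono_neutral_right) auto
  finally have "x - s = (\<Sum>j\<in>J. frac (du I j \<bullet> x) *\<^sub>R v j)"
    unfolding s_def frac_def by (simp add: sum_subtractf scaleR_diff_left)
  also have "norm \<dots> \<le> (\<Sum>j\<in>J. norm (v j))"
    by (intro sum_norm_le) (auto simp: frac_lt_1 less_imp_le mult_left_le_one_le)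
  also have "\<dots> \<le> (\<Sum>j\<in>I. norm (v j))"
    using assms(2) Top_finite[OF assms(1)] by (intro sum_mono2) auto
  finally have "x - s \<in> F"
    unfolding F_def using y assms(4) by auto
  then show "\<exists>y\<in>F. y \<in> A \<and> x - y \<in> sublat v J"
    using y s by (intro bexI[of _ "x - s"]) auto
qed

lemma exists_transversal_Top:
  assumes "I \<in> Top"
  shows "\<exists>R. transversal L (sublat v I) R"
  using assms edges_subset_L Top_simplices add_subgroup_L
  by (intro exists_transversal_sublat[of I I]) auto

end

section \<open>Facet hyperplanes\<close>

lemma quot_proj_scale: "quot_proj S (c *\<^sub>R x) = c *\<^sub>R quot_proj S x"
proof -
  have "c *\<^sub>R x - c *\<^sub>R quot_proj S x \<in> span S"
    using span_scale[OF quot_proj(1)[of x S], of c] by (simp add: scaleR_diff_right)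
  then have "quot_proj S (c *\<^sub>R x) - c *\<^sub>R quot_proj S x \<in> span S"
    using span_diff[OF _ quot_proj(1)[of "c *\<^sub>R x" S]] by fastforce
  moreover have "quot_proj S (c *\<^sub>R x) - c *\<^sub>R quot_proj S x \<in> orthogonal_comp (span S)"
    using quot_proj(2) subspace_orthogonal_comp subspace_diff subspace_scale by blast
  ultimately show ?thesis
    by (auto simp: orthogonal_comp_def orthogonal_self)
qed

context edged_multifan
begin

text \<open>The fractional part is constant on the classes modulo \<open>sublat v I\<close>, and
  there are finitely many of them.\<close>

lemma finite_frac_dual_vec:
  assumes "I \<in> Top"
  shows "finite {frac (du I i \<bullet> x) | x. x \<in> L}"
proof -
  obtain R where R: "transversal L (sublat v I) R"
    using exists_transversal_Top[OF assms] by blast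
  have "{frac (du I i \<bullet> x) | x. x \<in> L} \<subseteq> (\<lambda>y. frac (du I i \<bullet> y)) ` R"
  proof safe
    fix x assume "x \<in> L"
    then obtain y where y: "y \<in> R" "x - y \<in> sublat v I"
      using transversal_ex[OF R] by blast
    then have "du I i \<bullet> x - du I i \<bullet> y \<in> \<int>"
      using sublat_dual_int[OF assms y(2), of i] by (simp add: inner_diff_right)
    then obtain n where "du I i \<bullet> x = du I i \<bullet> y + of_int n"
      by (auto elim!: Ints_cases simp: algebra_simps)
    then have "frac (du I i \<bullet> x) = frac (du I i \<bullet> y)"
      by (simp add: frac_def)
    then show "frac (du I i \<bullet> x) \<in> (\<lambda>y. frac (du I i \<bullet> y)) ` R"
      using y(1) by blast
  qed
  then show ?thesis
    using transversal_finite[OF R] finite_surj by blast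
qed

end

text \<open>A primitive normal: integrality on L together with height 1 at e splits L as
  \<open>hyp\<close> plus the integer multiples of e.\<close>

locale edged_hyperplane = edged_multifan +
  fixes \<nu> e
  assumes nu_span: "\<nu> \<in> span L" and e_L: "e \<in> L" and nu_e: "\<nu> \<bullet> e = 1"
    and nu_int: "x \<in> L \<Longrightarrow> \<nu> \<bullet> x \<in> \<int>"
begin

text \<open>The vertex i is the one opposite to the facet; the condition forces \<nu> to be nonzero
  on \<open>v i\<close>, as \<open>facet_edge_nonzero\<close> shows.\<close>

definition facet :: "'a set \<Rightarrow> 'a \<Rightarrow> bool" where
  "facet I i \<longleftrightarrow> I \<in> Top \<and> i \<in> I \<and> (\<forall>j\<in>I - {i}. \<nu> \<bullet> v j = 0)"

lemma facetD:
  assumes "facet I i"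
  shows "I \<in> Top" "i \<in> I" "j \<in> I \<Longrightarrow> j \<noteq> i \<Longrightarrow> \<nu> \<bullet> v j = 0"
  using assms by (auto simp: facet_def)

lemma facet_edge_nonzero:
  assumes "facet I i"
  shows "\<nu> \<bullet> v i \<noteq> 0"
proof
  assume *: "\<nu> \<bullet> v i = 0"
  have "\<nu> \<bullet> v j = 0" if "j \<in> I" for j
    using facetD(3)[OF assms that] * by blast
  then have "\<nu> = 0"
    using nu_span by (intro dual_vec_unique[OF facetD(1)[OF assms]]) (auto simp: span_zero)
  then show False
    using nu_e by simp
qed

text \<open>Both vectors vanish on the other edges and pair to 1 with \<open>v i\<close>. Dual
  vectors of different simplices along one hyperplane thus become comparable through \<nu>.\<close>

lemma facet_dual_vec:
  assumes "facet I i"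
  shows "du I i = (1 / (\<nu> \<bullet> v i)) *\<^sub>R \<nu>"
  using assms nu_span facet_edge_nonzero[OF assms]
  by (intro dual_vec_eqI) (auto simp: facet_def intro: span_scale)

definition hyp :: "'b set" where
  "hyp = {x \<in> L. \<nu> \<bullet> x = 0}"

lemma add_subgroup_hyp: "add_subgroup hyp"
  using add_subgroup_L unfolding hyp_def add_subgroup_def by (auto simp: inner_diff_right)

lemma sublat_facet:
  assumes "facet I i"
  shows "sublat v (I - {i}) = {x \<in> sublat v I. \<nu> \<bullet> x = 0}"
proof
  have "add_subgroup {x \<in> sublat v I. \<nu> \<bullet> x = 0}"
    using add_subgroup_sublat[of I] unfolding add_subgroup_def by (auto simp: inner_diff_right)
  then show "sublat v (I - {i}) \<subseteq> {x \<in> sublat v I. \<nu> \<bullet> x = 0}"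
    unfolding sublat_def[of v "I - {i}"]
    by (rule int_span_subset) (auto intro: edge_in_sublat facetD(3)[OF assms])
next
  note I = facetD(1)[OF assms]
  show "{x \<in> sublat v I. \<nu> \<bullet> x = 0} \<subseteq> sublat v (I - {i})"
  proof safe
    fix x assume x: "x \<in> sublat v I" "\<nu> \<bullet> x = 0"
    show "x \<in> sublat v (I - {i})"
    proof (rule sublatI[OF I])
      show "x \<in> span L"
        using x(1) sublat_subset_L[OF Top_simplices[OF I]] by (auto intro: span_base)
      show "du I j \<bullet> x = 0" if "j \<in> I - (I - {i})" for j
        using that x(2) by (auto simp: facet_dual_vec[OF assms])
    qed (use sublat_dual_int[OF I x(1)] in auto)
  qed
qed

lemma exists_transversal_hyp:
  assumes "facet I i"
  shows "\<exists>R. transversal hyp (sublat v (I - {i})) R"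
proof (rule exists_transversal_sublat[OF facetD(1)[OF assms] _ add_subgroup_hyp])
  show "v ` (I - {i}) \<subseteq> hyp"
    using facetD[OF assms] edges_subset_L[OF Top_simplices] unfolding hyp_def by blast
qed (auto simp: hyp_def facet_dual_vec[OF assms])

definition lift :: "'b \<Rightarrow> 'b \<times> int \<Rightarrow> 'b" where
  "lift a p = a + fst p + of_int (snd p) *\<^sub>R e"

lemma nu_lift: "y \<in> hyp \<Longrightarrow> \<nu> \<bullet> lift a (y, c) = \<nu> \<bullet> a + of_int c"
  by (simp add: lift_def hyp_def inner_add_right nu_e)

text \<open>A transversal of \<open>L / L\<^bsub>I,\<V>\<^esub>\<close> adapted to the hyperplane: only the members with
  \<open>c = 0\<close> contribute poles along the translate of the hyperplane through \<open>a\<close>.\<close>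
lemma transversal_lift:
  assumes "facet I i" "transversal hyp (sublat v (I - {i})) R" "a \<in> L"
    and M: "\<nu> \<bullet> v i = of_int M"
  shows "transversal L (sublat v I) (lift a ` (R \<times> {0..<\<bar>M\<bar>}))"
    and "inj_on (lift a) (R \<times> {0..<\<bar>M\<bar>})"
proof -
  note I = facetD(1)[OF assms(1)]
  have M0: "M \<noteq> 0"
    using facet_edge_nonzero[OF assms(1)] M by auto
  have vi: "v i \<in> sublat v I" "v i \<in> L"
    using facetD[OF assms(1)] edge_in_sublat edge(2) Top_simplices by blast+
  have R: "finite R" "R \<subseteq> hyp"
    using assms(2) transversal_finite transversal_subset by blast+
  have lift_L: "lift a p \<in> L" if "p \<in> R \<times> {0..<\<bar>M\<bar>}" for p
    unfolding lift_def using that R(2) add_subgroup_L assms(3) e_L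
    by (intro add_subgroup_add add_subgroup_of_int_scale) (auto simp: hyp_def)
  have unique: "p = p'" if p: "p \<in> R \<times> {0..<\<bar>M\<bar>}" "p' \<in> R \<times> {0..<\<bar>M\<bar>}"
    "lift a p - lift a p' \<in> sublat v I" for p p'
  proof -
    obtain y c y' c' where pp: "p = (y, c)" "p' = (y', c')"
      by fastforce
    have yy: "y \<in> R" "y' \<in> R" "y \<in> hyp" "y' \<in> hyp"
      and c: "0 \<le> c" "c < \<bar>M\<bar>" "0 \<le> c'" "c' < \<bar>M\<bar>"
      using p(1,2) R(2) by (auto simp: pp)
    have "\<nu> \<bullet> (lift a p - lift a p') = of_int (c - c')"
      using yy by (simp add: inner_diff_right pp nu_lift)
    \<comment> \<open>The dual vector of i is \<nu> divided by M, so integrality makes M divide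
      \<open>c - c'\<close>; both lie between 0 and |M|, hence they coincide.\<close>
    moreover have "du I i \<bullet> (lift a p - lift a p') \<in> \<int>"
      using sublat_dual_int[OF I p(3)] .
    ultimately have "of_int (c - c') / real_of_int M \<in> \<int>"
      by (simp add: facet_dual_vec[OF assms(1)] M)
    then obtain k where "of_int (c - c') / real_of_int M = of_int k"
      by (auto elim: Ints_cases)
    then have "real_of_int (c - c') = of_int (k * M)"
      using M0 by (simp add: field_simps)
    then have "c - c' = k * M"
      by (simp only: of_int_eq_iff)
    then have "M dvd c - c'"
      by simp
    then have "c mod \<bar>M\<bar> = c' mod \<bar>M\<bar>"
      by (simp add: mod_eq_dvd_iff)
    then have "c = c'"
      using c by simp
    then have "y - y' \<in> sublat v I" "\<nu> \<bullet> (y - y') = 0"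
      using p(3) yy by (auto simp: pp lift_def hyp_def inner_diff_right)
    then have "y - y' \<in> sublat v (I - {i})"
      unfolding sublat_facet[OF assms(1)] by blast
    then have "y = y'"
      using transversal_unique[OF assms(2) add_subgroup_sublat yy(1,2)] by blast
    with \<open>c = c'\<close> show ?thesis
      by (simp add: pp)
  qed
  show "inj_on (lift a) (R \<times> {0..<\<bar>M\<bar>})"
  proof (rule inj_onI)
    fix p p' assume "p \<in> R \<times> {0..<\<bar>M\<bar>}" "p' \<in> R \<times> {0..<\<bar>M\<bar>}" "lift a p = lift a p'"
    then show "p = p'"
      using unique[of p p'] add_subgroup_0[OF add_subgroup_sublat] by simp
  qed
  show "transversal L (sublat v I) (lift a ` (R \<times> {0..<\<bar>M\<bar>}))"
    unfolding transversal_def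
  proof (intro conjI ballI)
    show "finite (lift a ` (R \<times> {0..<\<bar>M\<bar>}))"
      using R by simp
    show "lift a ` (R \<times> {0..<\<bar>M\<bar>}) \<subseteq> L"
      using lift_L by blast
    fix x assume x: "x \<in> L"
    then have "x - a \<in> L"
      using assms(3) add_subgroup_L add_subgroup_diff by blast
    then obtain t where t: "\<nu> \<bullet> (x - a) = of_int t"
      using nu_int by (auto elim: Ints_cases)
    define c where "c = t mod \<bar>M\<bar>"
    \<comment> \<open>The height M of \<open>v i\<close> may be negative: t is divided by |M|, and
      the sign of M is moved into the quotient.\<close>
    define z where "z = sgn M * (t div \<bar>M\<bar>)"
    have c: "0 \<le> c" "c < \<bar>M\<bar>"
      using M0 by (auto simp: c_def)
    have "t = c + z * M"
    proof -
      have "t = c + \<bar>M\<bar> * (t div \<bar>M\<bar>)"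
        by (simp add: c_def)
      moreover have "\<bar>M\<bar> * (t div \<bar>M\<bar>) = z * M"
        by (simp add: z_def abs_sgn[of M] mult_ac)
      ultimately show ?thesis by simp
    qed
    define r where "r = x - a - of_int c *\<^sub>R e - of_int z *\<^sub>R v i"
    have "r \<in> L"
      unfolding r_def using x assms(3) e_L vi(2) add_subgroup_L
      by (intro add_subgroup_diff add_subgroup_of_int_scale)
    moreover have "\<nu> \<bullet> r = 0"
      using t \<open>t = c + z * M\<close> by (simp add: r_def inner_diff_right nu_e M)
    ultimately have "r \<in> hyp"
      unfolding hyp_def by blast
    then obtain y where y: "y \<in> R" "r - y \<in> sublat v (I - {i})"
      using transversal_ex[OF assms(2)] by blast
    have "x - lift a (y, c) = (r - y) + of_int z *\<^sub>R v i"
      by (simp add: r_def lift_def)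
    also have "\<dots> \<in> sublat v I"
      using y(2) vi(1) unfolding sublat_facet[OF assms(1)]
      by (intro add_subgroup_add add_subgroup_of_int_scale add_subgroup_sublat) auto
    finally have xl: "x - lift a (y, c) \<in> sublat v I" .
    have p: "(y, c) \<in> R \<times> {0..<\<bar>M\<bar>}"
      using y c by auto
    show "\<exists>!y. y \<in> lift a ` (R \<times> {0..<\<bar>M\<bar>}) \<and> x - y \<in> sublat v I"
    proof (rule ex1I)
      show "lift a (y, c) \<in> lift a ` (R \<times> {0..<\<bar>M\<bar>}) \<and> x - lift a (y, c) \<in> sublat v I"
        using xl p by blast
      fix b assume "b \<in> lift a ` (R \<times> {0..<\<bar>M\<bar>}) \<and> x - b \<in> sublat v I"
      then obtain p' where p': "p' \<in> R \<times> {0..<\<bar>M\<bar>}" "b = lift a p'" "x - lift a p' \<in> sublat v I"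
        by blast
      have "lift a p' - lift a (y, c) \<in> sublat v I"
        using add_subgroup_diff[OF add_subgroup_sublat xl p'(3)] by simp
      then show "b = lift a (y, c)"
        using unique[OF p'(1) p] p'(2) by simp
    qed
  qed
qed

lemma facet_span:
  assumes "facet I i" "x \<in> span L" "\<nu> \<bullet> x = 0"
  shows "x \<in> span (v ` (I - {i}))"
proof -
  note I = facetD(1,2)[OF assms(1)]
  have "x = (\<Sum>j\<in>I. (du I j \<bullet> x) *\<^sub>R v j)"
    using dual_vec_expansion[OF I(1) assms(2)] by simp
  also have "\<dots> = (\<Sum>j\<in>I-{i}. (du I j \<bullet> x) *\<^sub>R v j)"
    using Top_finite[OF I(1)] assms(3) by (intro sum.mono_neutral_right) (auto simp: facet_dual_vec[OF assms(1)])
  also have "\<dots> \<in> span (v ` (I - {i}))"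
    by (intro span_sum span_scale span_base) auto
  finally show ?thesis .
qed

text \<open>A facet hyperplane does not cross the cone, since the facet is a face of it.\<close>
lemma facet_cone_side:
  assumes "facet I i" "y \<in> cone_at \<Delta> I"
  shows "(\<nu> \<bullet> y) * (\<nu> \<bullet> v i) \<ge> 0"
proof (rule ccontr)
  assume neg: "\<not> (\<nu> \<bullet> y) * (\<nu> \<bullet> v i) \<ge> 0"
  note I = Top_simplices[OF facetD(1)[OF assms(1)]]
  have J: "I - {i} \<in> simplices \<Delta>" "I - {i} \<subseteq> I"
    using simplices_mono[OF I] by auto
  have vi: "v i \<in> cone_at \<Delta> I"
    using edge_in_cone[OF I facetD(2)[OF assms(1)]] .
  define a where "a = \<nu> \<bullet> y"
  define b where "b = \<nu> \<bullet> v i"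
  have ab: "a * b < 0"
    using neg by (simp add: a_def b_def)
  then have "a \<noteq> b" "a \<noteq> 0" "b \<noteq> 0"
    by (auto simp: not_less)
  \<comment> \<open>The parameter at which \<nu> vanishes on the segment from y to
    \<open>v i\<close>; opposite signs of a and b put it strictly inside.\<close>
  define t where "t = a / (a - b)"
  have t: "0 < t" "t < 1"
    using ab by (auto simp: t_def field_simps mult_less_0_iff)
  define p where "p = (1 - t) *\<^sub>R y + t *\<^sub>R v i"
  have cc: "convex_cone (cone_at \<Delta> I)"
    by (rule convex_cone_cone[OF I])
  have p: "p \<in> cone_at \<Delta> I"
    unfolding p_def using t assms(2) vi by (intro convex_cone_add[OF cc] convex_cone_scaleR[OF cc]) auto
  have "\<nu> \<bullet> p = (1 - t) * a + t * b"
    by (simp add: p_def inner_add_right a_def b_def)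
  also have "\<dots> = 0"
    using \<open>a \<noteq> b\<close> by (simp add: t_def field_simps)
  finally have "\<nu> \<bullet> p = 0" .
  moreover have "p \<in> span L"
  proof -
    have "cone_at \<Delta> I \<subseteq> span (v ` I)"
      using edges_independent[OF I] span_superset by metis
    then show ?thesis
      using p span_Top[OF facetD(1)[OF assms(1)]] by blast
  qed
  ultimately have "p \<in> span (cone_at \<Delta> (I - {i}))"
    using facet_span[OF assms(1)] edges_independent[OF J(1)] by blast
  then have "p \<in> cone_at \<Delta> (I - {i})"
    using cone_span_Int[OF I J(2) p] by blast
  \<comment> \<open>A face containing an interior point of a segment contains its end points, so
    \<open>v i\<close> would lie in the facet, where \<nu> is 0.\<close>
  moreover have "p \<in> open_segment y (v i)"
    unfolding in_segment using t \<open>a \<noteq> b\<close> by (auto simp: p_def a_def b_def intro!: exI[of _ t])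
  ultimately have "v i \<in> cone_at \<Delta> (I - {i})"
    using face_ofD[OF cone_face[OF I J(2)]] assms(2) vi by blast
  then have "v i \<in> span (v ` (I - {i}))"
    using edges_independent[OF J(1)] span_base by blast
  moreover have "span (v ` (I - {i})) \<subseteq> {x. \<nu> \<bullet> x = 0}"
    using facetD(3)[OF assms(1)] by (intro span_minimal subspace_hyperplane) auto
  ultimately show False
    using \<open>b \<noteq> 0\<close> by (auto simp: b_def)
qed

end

section \<open>Completeness in codimension one\<close>

context edged_hyperplane
begin

lemma facet_extend:
  assumes "J \<in> simplices \<Delta>" "card J + 1 = lat_rank \<Delta>" "\<And>j. j \<in> J \<Longrightarrow> \<nu> \<bullet> v j = 0"
    and "I \<in> Top" "J \<subseteq> I"
  obtains i where "facet I i" "I - {i} = J" "I - J = {i}" "(\<Sum>j\<in>I. \<nu> \<bullet> v j) = \<nu> \<bullet> v i"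
proof -
  have "card (I - J) = 1"
    using assms(2) card_Diff_subset[OF simplices_finite[OF assms(1)] assms(5)] Top_card[OF assms(4)] by simp
  then obtain i where i: "I - J = {i}"
    by (auto simp: card_1_singleton_iff)
  then have Ji: "I - {i} = J" "i \<in> I"
    using assms(5) by auto
  have "facet I i"
    unfolding facet_def using assms(3,4) Ji by auto
  moreover have "(\<Sum>j\<in>I. \<nu> \<bullet> v j) = \<nu> \<bullet> v i"
    using sum.remove[OF Top_finite[OF assms(4)] Ji(2), of "\<lambda>j. \<nu> \<bullet> v j"] assms(3) Ji(1) by simp
  ultimately show thesis
    using that i Ji by blast
qed

text \<open>The projected multi-fan at J has rank one, so its maximal cones are half-lines;
  comparing its degrees at two opposite generic vectors balances the weights of the two half-lines.
  Since \<nu> vanishes on J, the sum over all of I is just the height of the extra vertex, written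
  without naming it.\<close>

lemma facet_sign_sum_eq_0:
  assumes complete: "complete_multifan \<Delta>"
    and J: "J \<in> simplices \<Delta>" "card J + 1 = lat_rank \<Delta>" "\<And>j. j \<in> J \<Longrightarrow> \<nu> \<bullet> v j = 0"
  shows "(\<Sum>I\<in>{I \<in> Top. J \<subseteq> I}. real_of_int (weight \<Delta> I) * sgn (\<Sum>i\<in>I. \<nu> \<bullet> v i)) = 0"
proof -
  define P where "P = projected \<Delta> J"
  define q where "q = quot_proj (cone_at \<Delta> J)"
  define T where "T = {I \<in> Top. J \<subseteq> I}"
  define g where "g I = (\<Sum>i\<in>I. \<nu> \<bullet> v i)" for I
  have T: "I \<in> simplices \<Delta>" "I - J \<union> J = I" "I \<union> J = I" if "I \<in> T" for I
    using that Top_simplices Top_finite unfolding T_def by auto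
  have spanJ: "span (cone_at \<Delta> J) = span (v ` J)"
    using edges_independent[OF J(1)] by simp
  have "span (v ` J) \<subseteq> {x. \<nu> \<bullet> x = 0}"
    using J(3) by (intro span_minimal subspace_hyperplane) auto
  then have nu0: "\<nu> \<bullet> x = 0" if "x \<in> span (cone_at \<Delta> J)" for x
    using that unfolding spanJ by blast
  have nu_q: "\<nu> \<bullet> q x = \<nu> \<bullet> x" for x
    using nu0[OF quot_proj(1)[of x "cone_at \<Delta> J"]] unfolding q_def by (simp add: inner_diff_right)
  have q_scale: "q (c *\<^sub>R x) = c *\<^sub>R q x" for c x
    unfolding q_def by (rule quot_proj_scale)
  have facetE: "\<exists>i. facet I i \<and> I - {i} = J \<and> I - J = {i} \<and> g I = \<nu> \<bullet> v i" if "I \<in> T" for I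
  proof -
    have I: "I \<in> Top" "J \<subseteq> I"
      using that by (auto simp: T_def)
    show ?thesis
      using facet_extend[OF J I] unfolding g_def by metis
  qed
  obtain I0 where I0: "I0 \<in> T"
    using simplices_extend[OF J(1)] unfolding T_def by blast
  obtain i0 where i0: "facet I0 i0" "I0 - {i0} = J" "g I0 = \<nu> \<bullet> v i0"
    using facetE[OF I0] by blast
  \<comment> \<open>The image of one extra edge vector spans the quotient line; b and -b represent
    the two half-lines.\<close>
  define b where "b = q (v i0)"
  define m where "m = \<nu> \<bullet> v i0"
  have m: "m \<noteq> 0" "\<nu> \<bullet> b = m"
    using facet_edge_nonzero[OF i0(1)] by (auto simp: m_def b_def nu_q)
  have q_eq: "q x = ((\<nu> \<bullet> x) / m) *\<^sub>R b" if "x \<in> span L" for x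
  proof -
    define y where "y = ((\<nu> \<bullet> x) / m) *\<^sub>R v i0"
    have "\<nu> \<bullet> (x - y) = 0"
      using m(1) by (simp add: y_def m_def inner_diff_right)
    moreover have "x - y \<in> span L"
      unfolding y_def using that edge(2)[OF T(1)[OF I0] facetD(2)[OF i0(1)]]
      by (intro span_diff span_scale) (auto intro: span_base)
    ultimately have "x - y \<in> span (cone_at \<Delta> J)"
      using facet_span[OF i0(1)] unfolding spanJ i0(2) by blast
    then have "q x = q y"
      unfolding q_def quot_proj_eq_iff .
    then show ?thesis
      by (simp add: y_def q_scale b_def)
  qed
  have b0: "b \<noteq> 0"
    using m by auto
  have lat_P: "lat P = q ` L"
    by (simp add: P_def projected_def q_def)
  have v0: "v i0 \<in> L"
    using edge(2)[OF T(1)[OF I0] facetD(2)[OF i0(1)]] .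
  have "dim (q ` L) = 1"
  proof (rule dim_unique[of "{b}"])
    show "{b} \<subseteq> q ` L"
      using v0 by (simp add: b_def)
    show "q ` L \<subseteq> span {b}"
      using q_eq by (auto simp: span_singleton span_base)
  qed (use b0 in auto)
  then have rank_P: "lat_rank P = 1"
    by (simp add: lat_rank_def lat_P)
  have simp_P: "simplices P = {J' - J | J'. J' \<in> simplices \<Delta> \<and> J \<subseteq> J'}"
    by (simp add: P_def projected_def)
  \<comment> \<open>In rank one only the cone at the origin has smaller dimension, so nonzero
    vectors of the line are generic.\<close>
  have generic: "generic P x" if "x = b \<or> x = - b" for x
    unfolding generic_def
  proof (intro conjI ballI impI)
    have "b \<in> span (q ` L)"
      using v0 by (auto simp: b_def intro: span_base)
    then show "x \<in> span (lat P)"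
      using that span_neg lat_P by auto
    fix A assume "A \<in> simplices P" "dim (cone_at P A) < lat_rank P"
    then have "cone_at P A \<subseteq> {0}"
      using rank_P by (simp add: dim_eq_0)
    then have "span (cone_at P A) \<subseteq> {0}"
      by (metis span_empty span_insert_0 span_mono)
    then show "x \<notin> span (cone_at P A)"
      using that b0 by auto
  qed
  have top_P: "top_simplices P = (\<lambda>I. I - J) ` T"
  proof -
    have "card (I - J) = 1 \<longleftrightarrow> card I = lat_rank \<Delta>" if "I \<in> simplices \<Delta>" "J \<subseteq> I" for I
      using J(2) that card_Diff_subset[OF simplices_finite[OF J(1)] that(2)]
        card_mono[OF simplices_finite[OF that(1)] that(2)] by auto
    then show ?thesis
      unfolding top_simplices_def[of P] rank_P simp_P T_def top_simplices_def[of \<Delta>] by auto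
  qed
  have cone_iff: "x \<in> cone_at P (I - J) \<longleftrightarrow> sgn (g I) = sgn (\<nu> \<bullet> x)"
    if x: "x = b \<or> x = - b" and I: "I \<in> T" for x I
  proof -
    obtain i where i: "facet I i" "I - {i} = J" "g I = \<nu> \<bullet> v i"
      using facetE[OF I] by blast
    have nz: "\<nu> \<bullet> v i \<noteq> 0" "\<nu> \<bullet> x \<noteq> 0"
      using facet_edge_nonzero[OF i(1)] x m by auto
    have cone: "cone_at P (I - J) = q ` cone_at \<Delta> I"
      using T(2)[OF I] by (simp add: P_def projected_def q_def)
    show ?thesis
    proof
      assume "x \<in> cone_at P (I - J)"
      then obtain y where y: "y \<in> cone_at \<Delta> I" "x = q y"
        using cone by blast
      have "(\<nu> \<bullet> x) * (\<nu> \<bullet> v i) \<ge> 0"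
        using facet_cone_side[OF i(1) y(1)] by (simp add: y(2) nu_q)
      then show "sgn (g I) = sgn (\<nu> \<bullet> x)"
        using nz by (auto simp: i(3) sgn_if zero_le_mult_iff)
    next
      assume s: "sgn (g I) = sgn (\<nu> \<bullet> x)"
      define c where "c = (\<nu> \<bullet> x) / (\<nu> \<bullet> v i)"
      have c: "c > 0"
        using s nz by (auto simp: c_def i(3) sgn_if zero_less_divide_iff split: if_splits)
      have "v i \<in> L"
        using edge(2)[OF T(1)[OF I] facetD(2)[OF i(1)]] .
      then have "q (c *\<^sub>R v i) = ((\<nu> \<bullet> (c *\<^sub>R v i)) / m) *\<^sub>R b"
        by (intro q_eq span_scale span_base)
      also have "\<dots> = ((\<nu> \<bullet> x) / m) *\<^sub>R b"
        using nz by (simp add: c_def)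
      also have "\<dots> = x"
        using x m by auto
      finally have "q (c *\<^sub>R v i) = x" .
      moreover have "c *\<^sub>R v i \<in> cone_at \<Delta> I"
        using c edge_in_cone[OF T(1)[OF I] facetD(2)[OF i(1)]]
        by (intro convex_cone_scaleR[OF convex_cone_cone[OF T(1)[OF I]]]) auto
      ultimately show "x \<in> cone_at P (I - J)"
        using cone by blast
    qed
  qed
  have inj: "inj_on (\<lambda>I. I - J) A" if "A \<subseteq> T" for A
    using that T(2) by (metis (no_types, lifting) inj_onI subsetD)
  have deg: "(\<Sum>A\<in>{A \<in> top_simplices P. x \<in> cone_at P A}. weight P A) =
      (\<Sum>I\<in>{I \<in> T. sgn (g I) = sgn (\<nu> \<bullet> x)}. weight \<Delta> I)" if x: "x = b \<or> x = - b" for x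
  proof -
    have "{A \<in> top_simplices P. x \<in> cone_at P A} = (\<lambda>I. I - J) ` {I \<in> T. sgn (g I) = sgn (\<nu> \<bullet> x)}"
      unfolding top_P using cone_iff[OF x] by blast
    then have "(\<Sum>A\<in>{A \<in> top_simplices P. x \<in> cone_at P A}. weight P A) =
        (\<Sum>I\<in>{I \<in> T. sgn (g I) = sgn (\<nu> \<bullet> x)}. weight P (I - J))"
      using sum.reindex[OF inj, of "{I \<in> T. sgn (g I) = sgn (\<nu> \<bullet> x)}" "weight P"] by (simp add: o_def)
    also have "\<dots> = (\<Sum>I\<in>{I \<in> T. sgn (g I) = sgn (\<nu> \<bullet> x)}. weight \<Delta> I)"
      by (intro sum.cong) (auto simp: weight_def P_def projected_def T(3))
    finally show ?thesis .
  qed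
  have "pre_complete P"
    using complete J(1) unfolding complete_multifan_def P_def by blast
  then have eq: "(\<Sum>I\<in>{I \<in> T. sgn (g I) = sgn m}. weight \<Delta> I) =
      (\<Sum>I\<in>{I \<in> T. sgn (g I) = - sgn m}. weight \<Delta> I)"
    using generic deg[of b] deg[of "- b"] unfolding pre_complete_def by (fastforce simp: m sgn_minus)
  have fin: "finite T"
    using finite_Top unfolding T_def by simp
  have nz: "g I \<noteq> 0" if "I \<in> T" for I
    using facetE[OF that] facet_edge_nonzero by auto
  have T_split: "T = {I \<in> T. sgn (g I) = sgn m} \<union> {I \<in> T. sgn (g I) = - sgn m}"
    using nz m(1) by (auto simp: sgn_if)
  have "(\<Sum>I\<in>T. of_int (weight \<Delta> I) * sgn (g I)) =
     (\<Sum>I\<in>{I \<in> T. sgn (g I) = sgn m}. of_int (weight \<Delta> I) * sgn (g I)) +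
     (\<Sum>I\<in>{I \<in> T. sgn (g I) = - sgn m}. of_int (weight \<Delta> I) * sgn (g I))"
    by (subst T_split, rule sum.union_disjoint) (use fin m(1) in \<open>auto simp: sgn_if split: if_splits\<close>)
  also have "\<dots> = (\<Sum>I\<in>{I \<in> T. sgn (g I) = sgn m}. of_int (weight \<Delta> I)) * sgn m -
     (\<Sum>I\<in>{I \<in> T. sgn (g I) = - sgn m}. of_int (weight \<Delta> I)) * sgn m"
    by (simp add: sum_distrib_right flip: sum_negf)
  also have "\<dots> = 0"
    using arg_cong[OF eq, of real_of_int] by simp
  finally show ?thesis
    unfolding T_def g_def .
qed

end

section \<open>The genus after reduction to a character\<close>

lemma cpair_simps [simp]:
  "cpair u (x + y) = cpair u x + cpair u y"
  "cpair u (x - y) = cpair u x - cpair u y"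
  "cpair u (- x) = - cpair u x"
  "cpair u (cscale c x) = c * cpair u x"
  "cpair u (of_lat a) = of_real (u \<bullet> a)"
  "cpair (r *\<^sub>R u) x = of_real r * cpair u x"
  "cpair (u - u') x = cpair u x - cpair u' x"
  by (simp_all add: cpair_def cscale_def of_lat_def complex_eq_iff inner_add_right inner_diff_right
      inner_diff_left)

lemma cscale_of_lat: "cscale c (of_lat x) = (Re c *\<^sub>R x, Im c *\<^sub>R x)"
  by (simp add: cscale_def of_lat_def)

text \<open>In the application s is (k/N) u. Non-integrality keeps \<open>s \<bullet> v i\<close>
  off the period lattice and later yields a direction with nontrivial multiplier.\<close>

locale edged_genus = edged_multifan +
  fixes \<tau> :: complex and s :: 'b
  assumes tau: "Im \<tau> > 0" and s: "i \<in> vertices \<Delta> \<Longrightarrow> s \<bullet> v i \<notin> \<int>"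
begin

text \<open>The vector u is kept arbitrary so that a pole can be described by a primitive normal as
  well as by a dual vector.\<close>

definition parg :: "'b \<Rightarrow> 'b \<Rightarrow> 'b \<Rightarrow> 'b \<times> 'b \<Rightarrow> complex" where
  "parg u a b w = \<tau> * of_real (u \<bullet> a) - of_real (u \<bullet> b) - cpair u w"

definition gterm :: "'a set \<Rightarrow> 'b \<Rightarrow> 'b \<Rightarrow> 'b \<times> 'b \<Rightarrow> complex" where
  "gterm I a b w = ee (s \<bullet> a) * (\<Prod>i\<in>I. phi_st (parg (du I i) a b w) \<tau> (s \<bullet> v i))"

definition gpart :: "'a set \<Rightarrow> 'b \<times> 'b \<Rightarrow> complex" where
  "gpart I w = (\<Sum>(h1, h2)\<in>quot_group \<Delta> v I \<times> quot_group \<Delta> v I. gterm I (rep h1) (rep h2) w) /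
     of_nat (card (quot_group \<Delta> v I))"

definition genus :: "'b \<times> 'b \<Rightarrow> complex" where
  "genus w = (\<Sum>I\<in>Top. of_int (weight \<Delta> I) * gpart I w)"

lemma s_notin_period:
  assumes "I \<in> Top" "i \<in> I"
  shows "complex_of_real (s \<bullet> v i) \<notin> period_lattice \<tau>"
  using s[OF vertex_of[OF Top_simplices[OF assms(1)] assms(2)]] tau
  by (simp add: period_lattice_of_real)

lemma s_expansion:
  assumes "I \<in> Top" "x \<in> span L"
  shows "s \<bullet> x = (\<Sum>i\<in>I. (du I i \<bullet> x) * (s \<bullet> v i))"
proof -
  have "s \<bullet> x = s \<bullet> (\<Sum>i\<in>I. (du I i \<bullet> x) *\<^sub>R v i)"
    using dual_vec_expansion[OF assms] by simp
  then show ?thesis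
    by (simp add: inner_sum_right)
qed

text \<open>Shifting a by x in \<open>sublat v I\<close> multiplies each factor by a power of
  \<open>ee (s \<bullet> v i)\<close>. By \<open>s_expansion\<close> these multiply to
  \<open>ee (- (s \<bullet> x))\<close>, which the character in front compensates.\<close>

lemma gterm_cong_left:
  assumes "I \<in> Top" "a - a' \<in> sublat v I"
  shows "gterm I a b w = gterm I a' b w"
proof -
  define x where "x = a - a'"
  have a: "a = a' + x"
    by (simp add: x_def)
  define m where "m i = \<lfloor>du I i \<bullet> x\<rfloor>" for i
  have m: "du I i \<bullet> x = of_int (m i)" for i
    using sublat_dual_int[OF assms, of i] by (simp add: m_def x_def)
  have "x \<in> span L"
    using assms(2) sublat_subset_L[OF Top_simplices[OF assms(1)]] unfolding x_def by (auto intro: span_base)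
  from s_expansion[OF assms(1) this]
  have sx: "complex_of_real (s \<bullet> x) = (\<Sum>i\<in>I. of_int (m i) * of_real (s \<bullet> v i))"
    by (simp add: m)
  have "parg (du I i) a b w = parg (du I i) a' b w + of_int (m i) * \<tau>" for i
    by (simp add: parg_def a inner_add_right m algebra_simps)
  then have "(\<Prod>i\<in>I. phi_st (parg (du I i) a b w) \<tau> (s \<bullet> v i)) =
      (\<Prod>i\<in>I. ee (- of_int (m i) * of_real (s \<bullet> v i)) * phi_st (parg (du I i) a' b w) \<tau> (s \<bullet> v i))"
    by (simp only: phi_st_add_of_int_tau[OF tau])
  also have "\<dots> = ee (- complex_of_real (s \<bullet> x)) * (\<Prod>i\<in>I. phi_st (parg (du I i) a' b w) \<tau> (s \<bullet> v i))"
    unfolding sx prod.distrib ee_sum[OF Top_finite[OF assms(1)], symmetric] by (simp add: sum_negf)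
  finally show ?thesis
    by (simp add: gterm_def a inner_add_right ee_add ee_minus)
qed

lemma gterm_cong_right:
  assumes "I \<in> Top" "b - b' \<in> sublat v I"
  shows "gterm I a b w = gterm I a b' w"
proof -
  have "phi_st (parg (du I i) a b w) \<tau> (s \<bullet> v i) = phi_st (parg (du I i) a b' w) \<tau> (s \<bullet> v i)" for i
  proof -
    obtain m where "du I i \<bullet> (b - b') = of_int m"
      using sublat_dual_int[OF assms, of i] by (auto elim: Ints_cases)
    then have "du I i \<bullet> b = du I i \<bullet> b' + of_int m"
      by (simp add: inner_diff_right)
    then have "parg (du I i) a b w = parg (du I i) a b' w + of_int (- m)"
      by (simp add: parg_def)
    then show ?thesis
      by (simp only: phi_st_add_of_int[OF tau])
  qed
  then show ?thesis
    by (simp add: gterm_def)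
qed

text \<open>The two variables may use different transversals, since they will be based at different
  points of L.\<close>

lemma gpart_transversal:
  assumes I: "I \<in> Top" and R: "transversal L (sublat v I) R" "transversal L (sublat v I) R'"
  shows "gpart I w = (\<Sum>a\<in>R. \<Sum>b\<in>R'. gterm I a b w) / of_nat (card R)"
proof -
  define Q where "Q = quot_group \<Delta> v I"
  note Q = Q_def[unfolded quot_group_def]
  have "(\<Sum>(h1, h2)\<in>Q \<times> Q. gterm I (rep h1) (rep h2) w) = (\<Sum>h1\<in>Q. \<Sum>h2\<in>Q. gterm I (rep h1) (rep h2) w)"
    by (simp add: sum.cartesian_product)
  also have "\<dots> = (\<Sum>h1\<in>Q. \<Sum>b\<in>R'. gterm I (rep h1) b w)"
    unfolding Q
    by (intro sum.cong refl sum_quotient_rep[OF add_subgroup_sublat R(2)] gterm_cong_right[OF I])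
  also have "\<dots> = (\<Sum>a\<in>R. \<Sum>b\<in>R'. gterm I a b w)"
    unfolding Q
    by (intro sum_quotient_rep[OF add_subgroup_sublat R(1)] sum.cong refl gterm_cong_left[OF I])
  finally show ?thesis
    unfolding gpart_def Q_def[symmetric]
    using card_quotient_transversal[OF add_subgroup_sublat R(1)] by (simp add: Q)
qed

lemma gpart_add_lat:
  assumes "I \<in> Top" "x \<in> L"
  shows "gpart I (w + of_lat x) = gpart I w"
proof -
  obtain R where R: "transversal L (sublat v I) R"
    using exists_transversal_Top[OF assms(1)] by blast
  have "gterm I a b (w + of_lat x) = gterm I a (x + b) w" for a b
    by (simp add: gterm_def parg_def inner_add_right algebra_simps)
  then have "(\<Sum>a\<in>R. \<Sum>b\<in>R. gterm I a b (w + of_lat x)) = (\<Sum>a\<in>R. \<Sum>b\<in>(+) x ` R. gterm I a b w)"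
    by (simp add: sum.reindex)
  then show ?thesis
    using gpart_transversal[OF assms(1) R R, of "w + of_lat x"]
      gpart_transversal[OF assms(1) R transversal_translate[OF add_subgroup_L R assms(2)], of w]
    by (simp only:)
qed

text \<open>The shift of w is absorbed by replacing a with \<open>a - x\<close>; the character
  \<open>ee (s \<bullet> a)\<close> then releases the multiplier.\<close>

lemma gpart_add_tau_lat:
  assumes "I \<in> Top" "x \<in> L"
  shows "gpart I (w + cscale \<tau> (of_lat x)) = ee (s \<bullet> x) * gpart I w"
proof -
  obtain R where R: "transversal L (sublat v I) R"
    using exists_transversal_Top[OF assms(1)] by blast
  have x: "- x \<in> L"
    using add_subgroup_minus[OF add_subgroup_L assms(2)] .
  have "gterm I a b (w + cscale \<tau> (of_lat x)) = ee (s \<bullet> x) * gterm I (- x + a) b w" for a b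
    by (simp add: gterm_def parg_def inner_add_right inner_diff_right algebra_simps flip: ee_add)
  then have "(\<Sum>a\<in>R. \<Sum>b\<in>R. gterm I a b (w + cscale \<tau> (of_lat x))) =
      ee (s \<bullet> x) * (\<Sum>a\<in>(+) (- x) ` R. \<Sum>b\<in>R. gterm I a b w)"
    by (simp add: sum.reindex sum_distrib_left)
  moreover have "card ((+) (- x) ` R) = card R"
    by (intro card_image) simp
  ultimately show ?thesis
    using gpart_transversal[OF assms(1) R R, of "w + cscale \<tau> (of_lat x)"]
      gpart_transversal[OF assms(1) transversal_translate[OF add_subgroup_L R x] R, of w]
    by (simp only: times_divide_eq_right)
qed

text \<open>All a, b in L are allowed, so no representatives are involved;
  \<open>polar_transversal\<close> reduces the condition to finitely many pairs.\<close>

definition polar :: "('b \<times> 'b) set" where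
  "polar = {w. \<exists>I\<in>Top. \<exists>i\<in>I. \<exists>a\<in>L. \<exists>b\<in>L. parg (du I i) a b w \<in> period_lattice \<tau>}"

text \<open>Since \<open>du I i\<close> is 1 on \<open>v i\<close>, changing a and b by multiples of
  \<open>v i\<close> moves any period to 0. From here on only zeros of \<open>parg\<close> have to
  be studied.\<close>

lemma parg_period_shift:
  assumes "I \<in> Top" "i \<in> I" "a \<in> L" "b \<in> L" "parg (du I i) a b w \<in> period_lattice \<tau>"
  shows "\<exists>a'\<in>L. \<exists>b'\<in>L. parg (du I i) a' b' w = 0"
proof -
  obtain m n where mn: "parg (du I i) a b w = of_int m + of_int n * \<tau>"
    using assms(5) unfolding period_lattice_def by auto
  have vi: "v i \<in> L"
    using edge(2)[OF Top_simplices[OF assms(1)] assms(2)] .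
  have "a - of_int n *\<^sub>R v i \<in> L" "b + of_int m *\<^sub>R v i \<in> L"
    using assms(3,4) vi add_subgroup_L by (auto intro: add_subgroup_add add_subgroup_diff add_subgroup_of_int_scale)
  moreover have "parg (du I i) (a - of_int n *\<^sub>R v i) (b + of_int m *\<^sub>R v i) w = 0"
    using mn dual_vec_inner[OF assms(1,2), of i]
    by (simp add: parg_def inner_add_right inner_diff_right algebra_simps)
  ultimately show ?thesis by blast
qed

lemma polarE:
  assumes "w \<in> polar"
  obtains I i a b where "I \<in> Top" "i \<in> I" "a \<in> L" "b \<in> L" "parg (du I i) a b w = 0"
  using assms parg_period_shift unfolding polar_def by blast

lemma polar_transversal:
  assumes "\<And>I. I \<in> Top \<Longrightarrow> transversal L (sublat v I) (R I)"
  shows "w \<in> polar \<longleftrightarrow> (\<exists>I\<in>Top. \<exists>i\<in>I. \<exists>a\<in>R I. \<exists>b\<in>R I. parg (du I i) a b w \<in> period_lattice \<tau>)"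
proof
  assume "w \<in> polar"
  then obtain I i a b where *: "I \<in> Top" "i \<in> I" "a \<in> L" "b \<in> L" "parg (du I i) a b w = 0"
    by (rule polarE)
  obtain a' b' where ab: "a' \<in> R I" "a - a' \<in> sublat v I" "b' \<in> R I" "b - b' \<in> sublat v I"
    using transversal_ex[OF assms[OF *(1)]] *(3,4) by metis
  obtain m n where mn: "du I i \<bullet> (a - a') = of_int m" "du I i \<bullet> (b - b') = of_int n"
    using sublat_dual_int[OF *(1)] ab(2,4) by (metis Ints_cases)
  have "parg (du I i) a' b' w = parg (du I i) a b w - \<tau> * of_real (du I i \<bullet> (a - a')) + of_real (du I i \<bullet> (b - b'))"
    by (simp add: parg_def inner_diff_right algebra_simps)
  also have "\<dots> = of_int n + of_int (- m) * \<tau>"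
    unfolding *(5) mn by simp
  also have "\<dots> \<in> period_lattice \<tau>"
    unfolding period_lattice_def by blast
  finally show "\<exists>I\<in>Top. \<exists>i\<in>I. \<exists>a\<in>R I. \<exists>b\<in>R I. parg (du I i) a b w \<in> period_lattice \<tau>"
    using *(1,2) ab(1,3) by blast
next
  assume "\<exists>I\<in>Top. \<exists>i\<in>I. \<exists>a\<in>R I. \<exists>b\<in>R I. parg (du I i) a b w \<in> period_lattice \<tau>"
  then show "w \<in> polar"
    using assms transversal_subset unfolding polar_def by blast
qed

lemma exists_transversals:
  obtains R where "\<And>I. I \<in> Top \<Longrightarrow> transversal L (sublat v I) (R I)"
  using exists_transversal_Top by metis

lemma tendsto_parg:
  assumes "((\<lambda>x. cpair (du I i) (f x)) \<longlongrightarrow> cpair (du I i) w) F"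
  shows "((\<lambda>x. parg (du I i) a b (f x)) \<longlongrightarrow> parg (du I i) a b w) F"
  unfolding parg_def by (intro tendsto_intros assms)

text \<open>Only the pairings have to converge, along any filter, so the lemma serves both complex
  lines and real displacements of w.\<close>

lemma tendsto_gpart:
  assumes "I \<in> Top" and lim: "\<And>i. i \<in> I \<Longrightarrow> ((\<lambda>x. cpair (du I i) (f x)) \<longlongrightarrow> cpair (du I i) w) F"
    and "\<And>i a b. i \<in> I \<Longrightarrow> a \<in> L \<Longrightarrow> b \<in> L \<Longrightarrow> parg (du I i) a b w \<notin> period_lattice \<tau>"
  shows "((\<lambda>x. gpart I (f x)) \<longlongrightarrow> gpart I w) F"
proof -
  obtain R where R: "transversal L (sublat v I) R"
    using exists_transversal_Top[OF assms(1)] by blast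
  have "card R \<noteq> 0"
    using transversal_finite[OF R] transversal_ex[OF R add_subgroup_0[OF add_subgroup_L]] by auto
  moreover have "parg (du I i) a b w \<notin> period_lattice \<tau>" if "i \<in> I" "a \<in> R" "b \<in> R" for i a b
    using assms(3) that transversal_subset[OF R] by blast
  ultimately show ?thesis
    unfolding gpart_transversal[OF assms(1) R R] gterm_def
    by (intro tendsto_intros tendsto_phi_st[OF tau s_notin_period[OF assms(1)]] tendsto_parg lim) auto
qed

lemma tendsto_genus:
  assumes "\<And>I i. I \<in> Top \<Longrightarrow> i \<in> I \<Longrightarrow> ((\<lambda>x. cpair (du I i) (f x)) \<longlongrightarrow> cpair (du I i) w) F"
    and "w \<notin> polar"
  shows "((\<lambda>x. genus (f x)) \<longlongrightarrow> genus w) F"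
  unfolding genus_def using assms
  by (intro tendsto_intros tendsto_gpart) (auto simp: polar_def)

section \<open>Restriction of the genus to complex lines\<close>

definition line :: "'b \<times> 'b \<Rightarrow> 'b \<Rightarrow> complex \<Rightarrow> 'b \<times> 'b" where
  "line w d z = w + cscale z (of_lat d)"

lemma cpair_line [simp]: "cpair u (line w d z) = cpair u w + z * of_real (u \<bullet> d)"
  by (simp add: line_def)

lemma parg_line: "parg u a b (line w d z) = parg u a b w + (- of_real (u \<bullet> d)) * z"
  by (simp add: parg_def)

lemma genus_line_add_1:
  assumes "d \<in> L"
  shows "genus (line w d (z + 1)) = genus (line w d z)"
proof -
  have "line w d (z + 1) = line w d z + of_lat d"
    by (simp add: line_def cscale_def of_lat_def scaleR_add_left)
  then show ?thesis
    unfolding genus_def using gpart_add_lat[OF _ assms] by simp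
qed

lemma genus_line_add_tau:
  assumes "d \<in> L"
  shows "genus (line w d (z + \<tau>)) = ee (s \<bullet> d) * genus (line w d z)"
proof -
  have "line w d (z + \<tau>) = line w d z + cscale \<tau> (of_lat d)"
    by (simp add: line_def cscale_def of_lat_def scaleR_add_left)
  then show ?thesis
    unfolding genus_def using gpart_add_tau_lat[OF _ assms]
    by (simp add: sum_distrib_left mult_ac)
qed

text \<open>A direction not killed by any dual vector makes every \<open>parg\<close> a nonconstant
  affine function of z, and transversals leave finitely many of these.\<close>

lemma eventually_line_notin_polar:
  assumes "\<And>I i. I \<in> Top \<Longrightarrow> i \<in> I \<Longrightarrow> du I i \<bullet> d \<noteq> 0"
  shows "eventually (\<lambda>z. line w d z \<notin> polar) (at z0)"
proof -
  obtain R where R: "\<And>I. I \<in> Top \<Longrightarrow> transversal L (sublat v I) (R I)"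
    using exists_transversals by blast
  have "eventually (\<lambda>z. \<forall>I\<in>Top. \<forall>i\<in>I. \<forall>a\<in>R I. \<forall>b\<in>R I. parg (du I i) a b (line w d z) \<notin> period_lattice \<tau>) (at z0)"
    using assms transversal_finite[OF R] unfolding parg_line
    by (intro eventually_ball_finite finite_Top ballI Top_finite
        eventually_affine_notin_period_lattice[OF tau]) auto
  then show ?thesis
    by (rule eventually_mono) (simp add: polar_transversal[OF R])
qed

lemma genus_line_holomorphic:
  "(\<lambda>z. genus (line w d z)) holomorphic_on - {z. line w d z \<in> polar}"
proof -
  have "(\<lambda>z. gpart I (line w d z)) holomorphic_on - {z. line w d z \<in> polar}" if I: "I \<in> Top" for I
  proof -
    obtain R where R: "transversal L (sublat v I) R"
      using exists_transversal_Top[OF I] by blast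
    have np: "parg (du I i) a b (line w d z) \<notin> period_lattice \<tau>"
      if "i \<in> I" "a \<in> R" "b \<in> R" "line w d z \<notin> polar" for i a b z
      using that I transversal_subset[OF R] unfolding polar_def by blast
    have "card R \<noteq> 0"
      using transversal_finite[OF R] transversal_ex[OF R add_subgroup_0[OF add_subgroup_L]] by auto
    then show ?thesis
      unfolding gpart_transversal[OF I R R] gterm_def using np
      by (intro holomorphic_intros phi_st_holomorphic[OF tau] s_notin_period[OF I])
         (auto simp: parg_line intro!: holomorphic_intros)
  qed
  then show ?thesis
    unfolding genus_def by (intro holomorphic_intros) auto
qed

end

section \<open>Cancellation of residues\<close>

lemma sum_delta_times:
  fixes M :: int and h :: "'a \<Rightarrow> 'c::comm_monoid_add"
  assumes "M \<noteq> 0"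
  shows "(\<Sum>p\<in>R \<times> {0..<\<bar>M\<bar>}. if snd p = 0 then h (fst p) else 0) = sum h R"
proof -
  have "(\<Sum>p\<in>R \<times> {0..<\<bar>M\<bar>}. if snd p = 0 then h (fst p) else 0) =
      (\<Sum>y\<in>R. \<Sum>c\<in>{0..<\<bar>M\<bar>}. if c = 0 then h y else 0)"
    unfolding sum.cartesian_product by (intro sum.cong) auto
  also have "\<dots> = sum h R"
    using assms by (intro sum.cong) (auto simp: sum.delta)
  finally show ?thesis .
qed

text \<open>Comparing imaginary and then real parts shows that M divides c and c', which are too
  small for that unless both are 0. So all other members of the adapted transversals give regular
  terms.\<close>

lemma fraction_notin_period_lattice:
  assumes "Im \<tau> > 0" "0 \<le> c" "c < \<bar>M\<bar>" "0 \<le> c'" "c' < \<bar>M\<bar>" "c \<noteq> 0 \<or> c' \<noteq> (0::int)"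
  shows "(of_int c * \<tau> - of_int c') / of_int M \<notin> period_lattice \<tau>"
proof
  assume "(of_int c * \<tau> - of_int c') / of_int M \<in> period_lattice \<tau>"
  then obtain m n where mn: "(of_int c * \<tau> - of_int c') / of_int M = of_int m + of_int n * \<tau>"
    unfolding period_lattice_def by auto
  have M: "M \<noteq> 0"
    using assms(2,3) by auto
  have eq: "of_int c * \<tau> - of_int c' = of_int (m * M) + of_int (n * M) * \<tau>"
    using mn M by (simp add: field_simps)
  then have "Im (of_int c * \<tau> - of_int c') = Im (of_int (m * M) + of_int (n * M) * \<tau>)"
    by simp
  then have "real_of_int c * Im \<tau> = real_of_int (n * M) * Im \<tau>"
    by simp
  then have "real_of_int c = real_of_int (n * M)"
    using assms(1) by (metis less_numeral_extra(3) mult_right_cancel)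
  then have c: "c = n * M"
    by (simp only: of_int_eq_iff)
  have "(of_int (- c') :: complex) = of_int (m * M)"
    using eq unfolding c by simp
  then have c': "- c' = m * M"
    by (simp only: of_int_eq_iff)
  have "M dvd c" "M dvd c'"
    using c c' by (auto, metis dvd_minus_iff dvd_triv_right)
  then have "c = 0" "c' = 0"
    using assms(2-5) by (metis abs_dvd_iff zdvd_not_zless order_le_imp_less_or_eq)+
  then show False
    using assms(6) by simp
qed

text \<open>The point w is a pole on a line in direction d. The assumption
  \<open>facet_of_pole\<close> expresses genericity: every term singular at w is singular along a
  hyperplane parallel to that of \<nu>.\<close>

locale edged_pole = edged_genus \<Delta> v \<tau> s + edged_hyperplane \<Delta> v \<nu> e
  for \<Delta> :: "('i, 'v::euclidean_space) multifan" and v \<tau> s \<nu> e +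
  fixes a0 b0 d :: 'v and w :: "'v \<times> 'v"
  assumes a0: "a0 \<in> L" and b0: "b0 \<in> L" and pole: "parg \<nu> a0 b0 w = 0"
    and d: "\<nu> \<bullet> d \<noteq> 0"
    and w: "w \<in> complexified L"
    and facet_of_pole: "I \<in> Top \<Longrightarrow> i \<in> I \<Longrightarrow> a \<in> L \<Longrightarrow> b \<in> L \<Longrightarrow> parg (du I i) a b w = 0 \<Longrightarrow> facet I i"
begin

text \<open>At most one factor of each term is singular, so the poles are simple.\<close>

lemma facet_unique: "facet I i \<Longrightarrow> facet I j \<Longrightarrow> i = j"
  using facetD(3)[of I j i] facetD(2)[of I i] facet_edge_nonzero[of I i] by blast

lemma parg_regular:
  assumes "I \<in> Top" "i \<in> I" "\<not> facet I i" "a \<in> L" "b \<in> L"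
  shows "parg (du I i) a b w \<notin> period_lattice \<tau>"
  using parg_period_shift[OF assms(1,2,4,5)] facet_of_pole[OF assms(1,2)] assms(3) by blast

lemma tendsto_line: "((\<lambda>z. cpair u (line w d z)) \<longlongrightarrow> cpair u w) (at 0)"
proof -
  have "((\<lambda>z. cpair u w + z * of_real (u \<bullet> d)) \<longlongrightarrow> cpair u w + 0 * of_real (u \<bullet> d)) (at 0)"
    by (intro tendsto_intros)
  then show ?thesis by simp
qed

lemma residue_no_facet:
  assumes "I \<in> Top" "\<And>i. \<not> facet I i"
  shows "((\<lambda>z. z * gpart I (line w d z)) \<longlongrightarrow> 0) (at 0)"
proof -
  have "((\<lambda>z. z * gpart I (line w d z)) \<longlongrightarrow> 0 * gpart I w) (at 0)"
    using assms parg_regular by (intro tendsto_intros tendsto_gpart tendsto_line) auto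
  then show ?thesis by simp
qed

text \<open>The choice depends on J only, so all simplices around J use the same
  representatives.\<close>

definition reps :: "'i set \<Rightarrow> 'v set" where
  "reps J = (SOME R. transversal hyp (sublat v J) R)"

lemma reps:
  assumes "facet I i"
  shows "transversal hyp (sublat v (I - {i})) (reps (I - {i}))"
  unfolding reps_def using exists_transversal_hyp[OF assms] by (rule someI_ex)

text \<open>The regular part of \<open>gterm\<close> at the pole, with the singular factor
  omitted.\<close>

definition fterm :: "'i set \<Rightarrow> 'i set \<Rightarrow> 'v \<Rightarrow> 'v \<Rightarrow> complex" where
  "fterm I J a b = ee (s \<bullet> a) * (\<Prod>j\<in>J. phi_st (parg (du I j) a b w) \<tau> (s \<bullet> v j))"

definition fsum :: "'i set \<Rightarrow> 'i set \<Rightarrow> complex" where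
  "fsum I J = (\<Sum>y\<in>reps J. \<Sum>y'\<in>reps J. fterm I J (a0 + y) (b0 + y'))"

lemma parg_nu_lift:
  "y \<in> hyp \<Longrightarrow> y' \<in> hyp \<Longrightarrow> parg \<nu> (lift a0 (y, c)) (lift b0 (y', c')) w = of_int c * \<tau> - of_int c'"
  using pole by (simp add: parg_def nu_lift algebra_simps)

text \<open>The argument of the factor at i has slope \<open>- (\<nu> \<bullet> d) / M\<close>,
  whence the factor M. The nested conditionals match \<open>sum_delta_times\<close>.\<close>

lemma residue_gterm:
  assumes I: "facet I i" and M: "\<nu> \<bullet> v i = of_int M"
    and y: "y \<in> hyp" "y' \<in> hyp" and c: "0 \<le> c" "c < \<bar>M\<bar>" "0 \<le> c'" "c' < \<bar>M\<bar>"
  shows "((\<lambda>z. z * gterm I (lift a0 (y, c)) (lift b0 (y', c')) (line w d z)) \<longlongrightarrow>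
     (if c = 0 then if c' = 0 then fterm I (I - {i}) (a0 + y) (b0 + y') * (of_int M / (2 * pi * \<i> * of_real (\<nu> \<bullet> d))) else 0 else 0))
     (at 0)"
proof -
  define a where "a = lift a0 (y, c)"
  define b where "b = lift b0 (y', c')"
  note T = facetD(1,2)[OF I]
  have M0: "M \<noteq> 0"
    using c by auto
  have ab: "a \<in> L" "b \<in> L"
    using y a0 b0 e_L add_subgroup_L unfolding a_def b_def lift_def hyp_def
    by (auto intro!: add_subgroup_add add_subgroup_of_int_scale)
  have du: "du I i = (1 / of_int M) *\<^sub>R \<nu>"
    using facet_dual_vec[OF I] M by simp
  have p0: "parg (du I i) a b w = (of_int c * \<tau> - of_int c') / of_int M"
  proof -
    have "parg (du I i) a b w = parg \<nu> a b w / of_int M"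
      by (simp add: du parg_def diff_divide_distrib)
    then show ?thesis
      unfolding a_def b_def parg_nu_lift[OF y] .
  qed
  have split: "gterm I a b (line w d z) =
     phi_st (parg (du I i) a b (line w d z)) \<tau> (s \<bullet> v i) *
     (ee (s \<bullet> a) * (\<Prod>j\<in>I-{i}. phi_st (parg (du I j) a b (line w d z)) \<tau> (s \<bullet> v j)))" for z
    unfolding gterm_def using prod.remove[OF Top_finite[OF T(1)] T(2)] by simp
  have rest: "((\<lambda>z. ee (s \<bullet> a) * (\<Prod>j\<in>I-{i}. phi_st (parg (du I j) a b (line w d z)) \<tau> (s \<bullet> v j)))
     \<longlongrightarrow> fterm I (I - {i}) a b) (at 0)"
    unfolding fterm_def
    using facet_unique[OF I] T ab
    by (intro tendsto_intros tendsto_phi_st[OF tau s_notin_period[OF T(1)]] parg_regular tendsto_parg tendsto_line) auto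
  have "((\<lambda>z. (z * phi_st (parg (du I i) a b (line w d z)) \<tau> (s \<bullet> v i)) *
     (ee (s \<bullet> a) * (\<Prod>j\<in>I-{i}. phi_st (parg (du I j) a b (line w d z)) \<tau> (s \<bullet> v j)))) \<longlongrightarrow>
     (if c = 0 \<and> c' = 0 then of_int M / (2 * pi * \<i> * of_real (\<nu> \<bullet> d)) else 0) * fterm I (I - {i}) a b) (at 0)"
  proof (rule tendsto_mult[OF _ rest])
    show "((\<lambda>z. z * phi_st (parg (du I i) a b (line w d z)) \<tau> (s \<bullet> v i)) \<longlongrightarrow>
      (if c = 0 \<and> c' = 0 then of_int M / (2 * pi * \<i> * of_real (\<nu> \<bullet> d)) else 0)) (at 0)"
    proof (cases "c = 0 \<and> c' = 0")
      case True
      define k where "k = complex_of_real (\<nu> \<bullet> d) / of_int M"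
      have "parg (du I i) a b (line w d z) = - k * (z - 0)" for z
        using p0 True by (simp add: parg_line du k_def)
      moreover have "k \<noteq> 0"
        using d M0 by (simp add: k_def)
      ultimately have "((\<lambda>z. z * phi_st (parg (du I i) a b (line w d z)) \<tau> (s \<bullet> v i)) \<longlongrightarrow> 1 / (2 * pi * \<i> * k)) (at 0)"
        using phi_st_affine_pole[OF tau s_notin_period[OF T], of k 0] by simp
      moreover have "1 / (2 * pi * \<i> * k) = of_int M / (2 * pi * \<i> * of_real (\<nu> \<bullet> d))"
        by (simp add: k_def)
      ultimately show ?thesis
        using True by (simp only: if_True simp_thms)
    next
      case False
      then have "parg (du I i) a b w \<notin> period_lattice \<tau>"
        unfolding p0 using c by (intro fraction_notin_period_lattice tau) auto
      then have "((\<lambda>z. z * phi_st (parg (du I i) a b (line w d z)) \<tau> (s \<bullet> v i)) \<longlongrightarrow>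
          0 * phi_st (parg (du I i) a b w) \<tau> (s \<bullet> v i)) (at 0)"
        by (intro tendsto_intros tendsto_phi_st[OF tau s_notin_period[OF T]] tendsto_parg tendsto_line)
      then show ?thesis
        unfolding if_not_P[OF False] by simp
    qed
  qed
  moreover have "(if c = 0 \<and> c' = 0 then of_int M / (2 * pi * \<i> * of_real (\<nu> \<bullet> d)) else 0) * fterm I (I - {i}) a b =
     (if c = 0 then if c' = 0 then fterm I (I - {i}) (a0 + y) (b0 + y') * (of_int M / (2 * pi * \<i> * of_real (\<nu> \<bullet> d))) else 0 else 0)"
    by (simp add: a_def b_def lift_def)
  ultimately show ?thesis
    unfolding a_def[symmetric] b_def[symmetric] split by (simp only: mult.assoc)
qed

text \<open>The order of \<open>H_I\<close> is \<open>card R\<close> times |M|, and it divides the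
  double sum once; M / |M| is the sign that remains.\<close>

lemma residue_facet:
  assumes I: "facet I i"
  shows "((\<lambda>z. z * gpart I (line w d z)) \<longlongrightarrow>
     fsum I (I - {i}) / (of_nat (card (reps (I - {i}))) * (2 * pi * \<i> * of_real (\<nu> \<bullet> d))) * of_real (sgn (\<nu> \<bullet> v i))) (at 0)"
proof -
  define R where "R = reps (I - {i})"
  have R: "transversal hyp (sublat v (I - {i})) R"
    unfolding R_def by (rule reps[OF I])
  note T = facetD(1,2)[OF I]
  have "v i \<in> L"
    using edge(2)[OF Top_simplices[OF T(1)] T(2)] .
  then obtain M where M: "\<nu> \<bullet> v i = of_int M"
    using nu_int by (auto elim: Ints_cases)
  have M0: "M \<noteq> 0"
    using facet_edge_nonzero[OF I] M by auto
  define B where "B = R \<times> {0..<\<bar>M\<bar>}"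
  define K where "K = of_int M / (2 * pi * \<i> * of_real (\<nu> \<bullet> d))"
  have card: "card (lift a0 ` B) = card R * nat \<bar>M\<bar>"
    using card_image[OF transversal_lift(2)[OF I R a0 M]] by (simp add: B_def card_cartesian_product)
  have gp: "gpart I w' = (\<Sum>p\<in>B. \<Sum>p'\<in>B. gterm I (lift a0 p) (lift b0 p') w') / of_nat (card R * nat \<bar>M\<bar>)" for w'
  proof -
    have "(\<Sum>a\<in>lift a0 ` B. \<Sum>b\<in>lift b0 ` B. gterm I a b w') = (\<Sum>p\<in>B. \<Sum>p'\<in>B. gterm I (lift a0 p) (lift b0 p') w')"
      unfolding B_def sum.reindex[OF transversal_lift(2)[OF I R a0 M]] sum.reindex[OF transversal_lift(2)[OF I R b0 M]]
      by (simp add: o_def)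
    then show ?thesis
      using gpart_transversal[OF T(1) transversal_lift(1)[OF I R a0 M] transversal_lift(1)[OF I R b0 M], of w']
      unfolding B_def[symmetric] card by (simp only:)
  qed
  have "((\<lambda>z. (\<Sum>p\<in>B. \<Sum>p'\<in>B. z * gterm I (lift a0 p) (lift b0 p') (line w d z)) / of_nat (card R * nat \<bar>M\<bar>)) \<longlongrightarrow>
    (\<Sum>p\<in>B. \<Sum>p'\<in>B. if snd p = 0 then if snd p' = 0 then fterm I (I - {i}) (a0 + fst p) (b0 + fst p') * K else 0 else 0)
      / of_nat (card R * nat \<bar>M\<bar>)) (at 0)"
  proof (intro tendsto_divide tendsto_sum tendsto_const)
    fix p p' assume "p \<in> B" "p' \<in> B"
    then have "fst p \<in> hyp" "fst p' \<in> hyp" "0 \<le> snd p" "snd p < \<bar>M\<bar>" "0 \<le> snd p'" "snd p' < \<bar>M\<bar>"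
      using transversal_subset[OF R] by (auto simp: B_def)
    then show "((\<lambda>z. z * gterm I (lift a0 p) (lift b0 p') (line w d z)) \<longlongrightarrow>
       (if snd p = 0 then if snd p' = 0 then fterm I (I - {i}) (a0 + fst p) (b0 + fst p') * K else 0 else 0)) (at 0)"
      using residue_gterm[OF I M, of "fst p" "fst p'" "snd p" "snd p'"]
      unfolding K_def prod.collapse by blast
  next
    have "card R \<noteq> 0"
      using transversal_finite[OF R] transversal_ex[OF R add_subgroup_0[OF add_subgroup_hyp]] by auto
    then show "(of_nat (card R * nat \<bar>M\<bar>) :: complex) \<noteq> 0"
      using M0 by simp
  qed
  moreover have "(\<Sum>p\<in>B. \<Sum>p'\<in>B. z * gterm I (lift a0 p) (lift b0 p') (line w d z)) / of_nat (card R * nat \<bar>M\<bar>) =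
     z * gpart I (line w d z)" for z
    unfolding gp by (simp add: sum_distrib_left)
  moreover have "(\<Sum>p\<in>B. \<Sum>p'\<in>B. if snd p = 0 then if snd p' = 0 then fterm I (I - {i}) (a0 + fst p) (b0 + fst p') * K else 0 else 0)
      = fsum I (I - {i}) * K"
  proof -
    have "(\<Sum>p'\<in>B. if snd p = 0 then if snd p' = 0 then fterm I (I - {i}) (a0 + fst p) (b0 + fst p') * K else 0 else 0) =
        (if snd p = 0 then \<Sum>y'\<in>R. fterm I (I - {i}) (a0 + fst p) (b0 + y') * K else 0)" for p :: "'v \<times> int"
      using sum_delta_times[OF M0, of "\<lambda>y'. fterm I (I - {i}) (a0 + fst p) (b0 + y') * K" R]
      unfolding B_def by (cases "snd p = 0") auto
    then show ?thesis
      using sum_delta_times[OF M0, of "\<lambda>y. \<Sum>y'\<in>R. fterm I (I - {i}) (a0 + y) (b0 + y') * K" R]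
      unfolding B_def fsum_def R_def by (simp add: sum_distrib_right)
  qed
  moreover have "fsum I (I - {i}) * K / of_nat (card R * nat \<bar>M\<bar>) =
      fsum I (I - {i}) / (of_nat (card R) * (2 * pi * \<i> * of_real (\<nu> \<bullet> d))) * of_real (sgn (\<nu> \<bullet> v i))"
  proof -
    have "of_int M / (of_nat (nat \<bar>M\<bar>) :: complex) = of_real (sgn (\<nu> \<bullet> v i))"
      unfolding M using M0 by (cases "M > 0") (auto simp: sgn_if)
    then have "K / of_nat (nat \<bar>M\<bar>) = of_real (sgn (\<nu> \<bullet> v i)) / (2 * pi * \<i> * of_real (\<nu> \<bullet> d))"
      unfolding K_def by (metis divide_divide_eq_left' divide_divide_eq_left mult.commute)
    moreover have "fsum I (I - {i}) * K / of_nat (card R * nat \<bar>M\<bar>) = fsum I (I - {i}) / of_nat (card R) * (K / of_nat (nat \<bar>M\<bar>))"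
      by simp
    ultimately show ?thesis
      by simp
  qed
  ultimately show ?thesis
    unfolding R_def by (simp only:)
qed

lemma fsum_cong:
  assumes "facet I i" "facet I' i'" "I - {i} = J" "I' - {i'} = J"
  shows "fsum I J = fsum I' J"
  unfolding fsum_def fterm_def
proof (intro sum.cong refl arg_cong2[of _ _ _ _ "(*)"] prod.cong)
  fix y y' j assume y: "y \<in> reps J" "y' \<in> reps J" and j: "j \<in> J"
  have hyp: "y \<in> hyp" "y' \<in> hyp"
    using y transversal_subset[OF reps[OF assms(1)]] unfolding assms(3) by auto
  define a where "a = a0 + y"
  define b where "b = b0 + y'"
  \<comment> \<open>At the pole, x lies in the complexified hyperplane, which \<open>v\<close>
    J\<open>spans. The dual vectors of j for I and I' agree on\<close>v \<open>J\<close>, hence at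
    x.\<close>
  define x where "x = cscale \<tau> (of_lat a) - of_lat b - w"
  have parg: "parg u a b w = cpair u x" for u
    by (simp add: parg_def x_def)
  have "a \<in> L" "b \<in> L"
    using hyp a0 b0 add_subgroup_L unfolding a_def b_def hyp_def by (auto intro: add_subgroup_add)
  then have span: "fst x \<in> span L" "snd x \<in> span L"
    using w unfolding x_def complexified_def
    by (auto simp: cscale_def of_lat_def intro!: span_diff span_scale intro: span_base)
  have "cpair \<nu> x = 0"
    using pole hyp unfolding parg[symmetric] by (simp add: parg_def a_def b_def hyp_def inner_add_right)
  then have nu: "\<nu> \<bullet> fst x = 0" "\<nu> \<bullet> snd x = 0"
    by (auto simp: cpair_def complex_eq_iff)
  have "du I j \<bullet> x' = du I' j \<bullet> x'" if "x' \<in> span L" "\<nu> \<bullet> x' = 0" for x'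
  proof -
    have "(du I j - du I' j) \<bullet> v k = 0" if "k \<in> J" for k
    proof -
      have "k \<in> I" "k \<in> I'"
        using that assms(3,4) by blast+
      then show ?thesis
        by (simp add: inner_diff_left dual_vec_inner facetD(1)[OF assms(1)] facetD(1)[OF assms(2)])
    qed
    then have "span (v ` J) \<subseteq> {x. (du I j - du I' j) \<bullet> x = 0}"
      by (intro span_minimal subspace_hyperplane) auto
    then show ?thesis
      using facet_span[OF assms(1) that] unfolding assms(3) by (auto simp: inner_diff_left)
  qed
  then have "cpair (du I j) x = cpair (du I' j) x"
    using span nu by (simp add: cpair_def)
  then show "phi_st (parg (du I j) (a0 + y) (b0 + y') w) \<tau> (s \<bullet> v j) = phi_st (parg (du I' j) (a0 + y) (b0 + y') w) \<tau> (s \<bullet> v j)"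
    unfolding a_def[symmetric] b_def[symmetric] parg by simp
qed

text \<open>Recovers the facet from I and \<nu> without naming the opposite vertex, so that
  simplices can be grouped by it.\<close>

definition face_in :: "'i set \<Rightarrow> 'i set" where
  "face_in I = {j \<in> I. \<nu> \<bullet> v j = 0}"

lemma face_in_facet: "facet I i \<Longrightarrow> face_in I = I - {i}"
  using facetD(3)[of I i] facet_edge_nonzero[of I i] unfolding face_in_def by blast

lemma residue_genus:
  assumes "complete_multifan \<Delta>"
  shows "((\<lambda>z. z * genus (line w d z)) \<longlongrightarrow> 0) (at 0)"
proof -
  define T where "T = {I \<in> Top. \<exists>i. facet I i}"
  define g where "g I = (\<Sum>i\<in>I. \<nu> \<bullet> v i)" for I
  \<comment> \<open>Any simplex with facet J may be chosen, because \<open>fsum_cong\<close> makes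
    the residue coefficient \<open>C J\<close> common to all of them.\<close>
  define ext where "ext J = (SOME I. I \<in> T \<and> face_in I = J)" for J
  define C where "C J = fsum (ext J) J / (of_nat (card (reps J)) * (2 * pi * \<i> * of_real (\<nu> \<bullet> d)))" for J
  define l where "l I = (if I \<in> T then C (face_in I) * of_real (sgn (g I)) else 0)" for I
  have gpart_lim: "((\<lambda>z. z * gpart I (line w d z)) \<longlongrightarrow> l I) (at 0)" if I: "I \<in> Top" for I
  proof (cases "I \<in> T")
    case False
    then have "((\<lambda>z. z * gpart I (line w d z)) \<longlongrightarrow> 0) (at 0)"
      using residue_no_facet[OF I] I unfolding T_def by blast
    then show ?thesis
      using False by (simp add: l_def)
  next
    case True
    then obtain i where i: "facet I i"
      unfolding T_def by blast
    have "ext (face_in I) \<in> T \<and> face_in (ext (face_in I)) = face_in I"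
      unfolding ext_def by (rule someI[of _ I]) (use True in auto)
    then obtain i' where i': "facet (ext (face_in I)) i'" "ext (face_in I) - {i'} = face_in I"
      unfolding T_def using face_in_facet by auto
    have "fsum (ext (face_in I)) (face_in I) = fsum I (face_in I)"
      using fsum_cong[OF i'(1) i i'(2)] face_in_facet[OF i] by simp
    moreover have "g I = \<nu> \<bullet> v i"
      using sum.remove[OF Top_finite[OF I] facetD(2)[OF i], of "\<lambda>j. \<nu> \<bullet> v j"] facetD(3)[OF i]
      by (simp add: g_def)
    ultimately show ?thesis
      using residue_facet[OF i] True face_in_facet[OF i] by (simp add: l_def C_def)
  qed
  have "((\<lambda>z. \<Sum>I\<in>Top. of_int (weight \<Delta> I) * (z * gpart I (line w d z))) \<longlongrightarrow>
      (\<Sum>I\<in>Top. of_int (weight \<Delta> I) * l I)) (at 0)"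
    by (intro tendsto_intros gpart_lim)
  moreover have "(\<Sum>I\<in>Top. of_int (weight \<Delta> I) * (z * gpart I (line w d z))) = z * genus (line w d z)" for z
    unfolding genus_def by (simp add: sum_distrib_left mult_ac)
  moreover have "(\<Sum>I\<in>Top. of_int (weight \<Delta> I) * l I) = 0"
  proof -
    have T: "finite T" "T \<subseteq> Top"
      using finite_Top unfolding T_def by auto
    have "(\<Sum>I\<in>Top. of_int (weight \<Delta> I) * l I) = (\<Sum>I\<in>T. of_int (weight \<Delta> I) * l I)"
      using T finite_Top by (intro sum.mono_neutral_right) (auto simp: l_def)
    also have "\<dots> = (\<Sum>J\<in>face_in ` T. \<Sum>I\<in>{I \<in> T. face_in I = J}. of_int (weight \<Delta> I) * l I)"
      by (rule sum.image_gen[OF T(1)])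
    also have "\<dots> = 0"
    proof (rule sum.neutral, rule ballI)
      fix J assume "J \<in> face_in ` T"
      then obtain I1 i1 where I1: "facet I1 i1" "I1 \<in> T" "J = I1 - {i1}"
        unfolding T_def using face_in_facet by blast
      have J: "J \<in> simplices \<Delta>" "card J + 1 = lat_rank \<Delta>" "\<And>j. j \<in> J \<Longrightarrow> \<nu> \<bullet> v j = 0"
      proof -
        note I1' = facetD(1,2)[OF I1(1)]
        show "J \<in> simplices \<Delta>"
          using simplices_mono[OF Top_simplices[OF I1'(1)]] I1(3) by auto
        show "card J + 1 = lat_rank \<Delta>"
          using card.remove[OF Top_finite[OF I1'(1)] I1'(2)] Top_card[OF I1'(1)] I1(3) by simp
        show "\<nu> \<bullet> v j = 0" if "j \<in> J" for j
          using facetD(3)[OF I1(1)] that I1(3) by blast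
      qed
      \<comment> \<open>The simplices grouped under J are all maximal simplices containing J, as the
        sign identity requires.\<close>
      have eq: "{I \<in> T. face_in I = J} = {I \<in> Top. J \<subseteq> I}"
      proof (intro set_eqI iffI)
        fix I assume "I \<in> {I \<in> T. face_in I = J}"
        then show "I \<in> {I \<in> Top. J \<subseteq> I}"
          using T(2) by (auto simp: face_in_def)
      next
        fix I assume I: "I \<in> {I \<in> Top. J \<subseteq> I}"
        then have "I \<in> Top" "J \<subseteq> I"
          by auto
        then obtain i where "facet I i" "I - {i} = J"
          using facet_extend[OF J] by metis
        then show "I \<in> {I \<in> T. face_in I = J}"
          using face_in_facet[of I i] I unfolding T_def by auto
      qed
      have "(\<Sum>I\<in>{I \<in> T. face_in I = J}. of_int (weight \<Delta> I) * l I) =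
          C J * of_real (\<Sum>I\<in>{I \<in> T. face_in I = J}. real_of_int (weight \<Delta> I) * sgn (g I))"
        unfolding of_real_sum sum_distrib_left by (intro sum.cong) (auto simp: l_def)
      also have "\<dots> = 0"
        using facet_sign_sum_eq_0[OF assms J] unfolding eq g_def by simp
      finally show "(\<Sum>I\<in>{I \<in> T. face_in I = J}. of_int (weight \<Delta> I) * l I) = 0" .
    qed
    finally show ?thesis .
  qed
  ultimately show ?thesis by (simp only:)
qed

end

section \<open>Rigidity\<close>

lemma finite_affine_zeros:
  fixes a b :: real
  assumes "a \<noteq> 0 \<or> b \<noteq> 0"
  shows "finite {k::nat. a + real k * b = 0}"
proof (cases "b = 0")
  case False
  have "k = nat \<lfloor>- a / b\<rfloor>" if "a + real k * b = 0" for k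
  proof -
    have "real k = - a / b"
      using that False by (simp add: field_simps add_eq_0_iff)
    then show ?thesis
      by (metis floor_of_nat nat_int)
  qed
  then have "{k::nat. a + real k * b = 0} \<subseteq> {nat \<lfloor>- a / b\<rfloor>}"
    by blast
  then show ?thesis
    using finite_subset by blast
qed (use assms in auto)

text \<open>Among the vectors \<open>y + k x\<close>, each functional excludes only finitely many k:
  the old ones are nonzero on x, the new one on y.\<close>

lemma exists_generic_lattice_vector:
  assumes "add_subgroup L" "finite G" "\<And>g. g \<in> G \<Longrightarrow> \<exists>x\<in>L. g \<bullet> x \<noteq> 0"
  shows "\<exists>x\<in>L. \<forall>g\<in>G. g \<bullet> x \<noteq> 0"
  using assms(2,3)
proof (induction G rule: finite_induct)
  case empty
  then show ?case
    using assms(1) add_subgroup_0 by blast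
next
  case (insert g G)
  obtain x where x: "x \<in> L" "\<forall>h\<in>G. h \<bullet> x \<noteq> 0"
    using insert by auto
  obtain y where y: "y \<in> L" "g \<bullet> y \<noteq> 0"
    using insert.prems by auto
  have "finite (\<Union>h\<in>insert g G. {k::nat. h \<bullet> y + real k * (h \<bullet> x) = 0})"
    using insert.hyps x(2) y(2) by (intro finite_UN_I finite_affine_zeros) auto
  then obtain k where k: "k \<notin> (\<Union>h\<in>insert g G. {k::nat. h \<bullet> y + real k * (h \<bullet> x) = 0})"
    using ex_new_if_finite infinite_UNIV_nat by blast
  have "y + of_int (int k) *\<^sub>R x \<in> L"
    using x(1) y(1) assms(1) by (intro add_subgroup_add add_subgroup_of_int_scale)
  moreover have "\<forall>h\<in>insert g G. h \<bullet> (y + of_int (int k) *\<^sub>R x) \<noteq> 0"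
    using k by (simp add: inner_add_right)
  ultimately show ?case by blast
qed

context edged_genus
begin

lemma exists_direction:
  assumes "J \<in> simplices \<Delta>" "i \<in> J"
  obtains d where "d \<in> L" "s \<bullet> d \<notin> \<int>" "\<And>I i. I \<in> Top \<Longrightarrow> i \<in> I \<Longrightarrow> du I i \<bullet> d \<noteq> 0"
proof -
  define G where "G = (\<Union>I\<in>Top. du I ` I)"
  have fin: "finite G"
    unfolding G_def using finite_Top Top_finite by auto
  have G: "du I i \<in> G" if "I \<in> Top" "i \<in> I" for I i
    using that unfolding G_def by blast
  have "\<exists>x\<in>L. g \<bullet> x \<noteq> 0" if g: "g \<in> G" for g
  proof -
    obtain I i where I: "I \<in> Top" "i \<in> I" "g = du I i"
      using g unfolding G_def by auto
    then have "g \<bullet> v i \<noteq> 0"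
      by (simp add: dual_vec_inner)
    then show ?thesis
      using edge(2)[OF Top_simplices[OF I(1)] I(2)] by blast
  qed
  then obtain x where x: "x \<in> L" "\<And>g. g \<in> G \<Longrightarrow> g \<bullet> x \<noteq> 0"
    using exists_generic_lattice_vector[OF add_subgroup_L fin] by blast
  define D where "D k = v i + of_int (int k) *\<^sub>R x" for k
  have vi: "v i \<in> L" "s \<bullet> v i \<notin> \<int>"
    using edge(2)[OF assms] s[OF vertex_of[OF assms]] by auto
  have D: "D k \<in> L" for k
    unfolding D_def using x(1) vi(1) add_subgroup_L by (intro add_subgroup_add add_subgroup_of_int_scale)
  define B where "B = (\<Union>g\<in>G. {k::nat. g \<bullet> v i + real k * (g \<bullet> x) = 0})"
  have "finite B"
    unfolding B_def using fin x(2) by (intro finite_UN_I finite_affine_zeros) auto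
  then obtain k0 where k0: "B \<subseteq> {..<k0}"
    using finite_nat_iff_bounded by blast
  have gD: "g \<bullet> D k \<noteq> 0" if "g \<in> G" "k \<ge> k0" for g k
    using subsetD[OF k0, of k] that by (auto simp: B_def D_def inner_add_right)
  \<comment> \<open>If two consecutive vectors paired integrally with s, so would x and therefore
    \<open>v i\<close>.\<close>
  have "s \<bullet> D k0 \<notin> \<int> \<or> s \<bullet> D (Suc k0) \<notin> \<int>"
  proof (rule ccontr)
    assume "\<not> ?thesis"
    then have 1: "s \<bullet> D k0 \<in> \<int>" and "s \<bullet> D (Suc k0) - s \<bullet> D k0 \<in> \<int>"
      by (auto intro: Ints_diff)
    then have "s \<bullet> x \<in> \<int>"
      by (simp add: D_def inner_add_right algebra_simps)
    then have "s \<bullet> D k0 - of_nat k0 * (s \<bullet> x) \<in> \<int>"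
      using 1 by (intro Ints_diff Ints_mult) auto
    then show False
      using vi(2) by (simp add: D_def inner_add_right)
  qed
  then obtain k where k: "k \<ge> k0" "s \<bullet> D k \<notin> \<int>"
    by (meson le_SucI order_refl)
  show thesis
    using that[OF D k(2)] gD[OF G k(1)] by blast
qed

text \<open>The hypothesis \<open>gen\<close> says that poles meeting at one point of the line
  belong to parallel hyperplanes; it supplies \<open>facet_of_pole\<close> at each pole.\<close>

lemma genus_generic_eq_0:
  assumes complete: "complete_multifan \<Delta>"
    and w: "w \<in> complexified L" "w \<notin> polar"
    and d: "d \<in> L" "s \<bullet> d \<notin> \<int>" "\<And>I i. I \<in> Top \<Longrightarrow> i \<in> I \<Longrightarrow> du I i \<bullet> d \<noteq> 0"
    and gen: "\<And>I i a b I' i' a' b' z. I \<in> Top \<Longrightarrow> i \<in> I \<Longrightarrow> a \<in> L \<Longrightarrow> b \<in> L \<Longrightarrow>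
      I' \<in> Top \<Longrightarrow> i' \<in> I' \<Longrightarrow> a' \<in> L \<Longrightarrow> b' \<in> L \<Longrightarrow>
      parg (du I i) a b (line w d z) = 0 \<Longrightarrow> parg (du I' i') a' b' (line w d z) = 0 \<Longrightarrow>
      (du I i \<bullet> d) *\<^sub>R du I' i' = (du I' i' \<bullet> d) *\<^sub>R du I i"
  shows "genus w = 0"
proof -
  define P where "P = {z. line w d z \<in> polar}"
  have line0: "line w d 0 = w"
    by (simp add: line_def cscale_def of_lat_def zero_prod_def)
  have "genus (line w d 0) = 0"
  proof (rule quasi_periodic_eq_0[where f = "\<lambda>z. genus (line w d z)" and P = P and c = "ee (s \<bullet> d)", OF tau])
    show "norm (ee (s \<bullet> d)) = 1"
      by (simp add: norm_ee)
    show "ee (s \<bullet> d) \<noteq> 1"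
      using d(2) by (simp add: ee_eq_1_iff)
    show "eventually (\<lambda>x. x \<notin> P) (at z)" for z
      using eventually_line_notin_polar[OF d(3)] by (simp add: P_def)
    show "(\<lambda>z. genus (line w d z)) holomorphic_on - P"
      unfolding P_def by (rule genus_line_holomorphic)
    show "genus (line w d (z + 1)) = genus (line w d z)" for z
      by (rule genus_line_add_1[OF d(1)])
    show "genus (line w d (z + \<tau>)) = ee (s \<bullet> d) * genus (line w d z)" for z
      by (rule genus_line_add_tau[OF d(1)])
    show "0 \<notin> P"
      using w(2) line0 by (simp add: P_def)
    fix p assume "p \<in> P"
    then obtain I0 i0 a0 b0 where I0: "I0 \<in> Top" "i0 \<in> I0" "a0 \<in> L" "b0 \<in> L"
      and p: "parg (du I0 i0) a0 b0 (line w d p) = 0"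
      unfolding P_def by (auto elim: polarE)
    have vi0: "v i0 \<in> L" "du I0 i0 \<bullet> v i0 = 1"
      using edge(2)[OF Top_simplices[OF I0(1)] I0(2)] dual_vec_inner[OF I0(1,2)] by auto
    obtain \<kappa> e where \<kappa>: "\<kappa> > 0" "e \<in> L" "\<kappa> * (du I0 i0 \<bullet> e) = 1" "\<And>x. x \<in> L \<Longrightarrow> \<kappa> * (du I0 i0 \<bullet> x) \<in> \<int>"
      using discrete_functional_primitive[OF add_subgroup_L vi0 finite_frac_dual_vec[OF I0(1)]] by metis
    define \<nu> where "\<nu> = \<kappa> *\<^sub>R du I0 i0"
    interpret H: edged_hyperplane \<Delta> v \<nu> e
      by unfold_locales (use \<kappa> dual_vec_span[OF I0(1)] in \<open>auto simp: \<nu>_def intro: span_scale\<close>)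
    interpret edged_pole \<Delta> v \<tau> s \<nu> e a0 b0 d "line w d p"
    proof unfold_locales
      show "parg \<nu> a0 b0 (line w d p) = 0"
      proof -
        have "parg \<nu> a0 b0 (line w d p) = of_real \<kappa> * parg (du I0 i0) a0 b0 (line w d p)"
          by (simp add: parg_def \<nu>_def algebra_simps)
        then show ?thesis using p by simp
      qed
      show "\<nu> \<bullet> d \<noteq> 0"
        using \<kappa>(1) d(3)[OF I0(1,2)] by (simp add: \<nu>_def)
      show "line w d p \<in> complexified L"
        using w(1) d(1) unfolding complexified_def line_def
        by (auto simp: cscale_of_lat intro!: span_add span_scale intro: span_base)
      fix I i a b assume I: "I \<in> Top" "i \<in> I" "a \<in> L" "b \<in> L" "parg (du I i) a b (line w d p) = 0"
      \<comment> \<open>Both coefficients are nonzero, so \<nu> is proportional to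
        \<open>du I i\<close> and vanishes on the other edges of I.\<close>
      have eq: "(du I0 i0 \<bullet> d) *\<^sub>R du I i = (du I i \<bullet> d) *\<^sub>R du I0 i0"
        by (rule gen[OF I0 I(1-4) p I(5)])
      have "\<nu> \<bullet> v j = 0" if "j \<in> I - {i}" for j
      proof -
        have "(du I i \<bullet> d) * (du I0 i0 \<bullet> v j) = (du I0 i0 \<bullet> d) * (du I i \<bullet> v j)"
          using arg_cong[OF eq, of "\<lambda>x. x \<bullet> v j"] by simp
        also have "\<dots> = 0"
          using that dual_vec_inner[OF I(1)] by simp
        finally show ?thesis
          using d(3)[OF I(1,2)] by (simp add: \<nu>_def)
      qed
      then show "H.facet I i"
        using I by (simp add: H.facet_def)
    qed (use I0 in auto)
    have "line (line w d p) d z = line w d (p + z)" for z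
      by (simp add: line_def cscale_of_lat scaleR_add_left)
    then have "(\<lambda>z. (p + z - p) * genus (line w d (p + z))) \<midarrow>0\<rightarrow> 0"
      using residue_genus[OF complete] by simp
    then show "(\<lambda>z. (z - p) * genus (line w d z)) \<midarrow>p\<rightarrow> 0"
      by (rule LIM_offset_zero_cancel)
  qed
  then show ?thesis
    by (simp only: line0)
qed

text \<open>Displacing w by a real multiple of a generic y avoids all coincidences of non-parallel
  poles except for countably many parameters. Every interval contains good parameters, so continuity
  gives the value at w. The vertex i is there to supply the direction d.\<close>

lemma genus_eq_0:
  assumes complete: "complete_multifan \<Delta>" and J: "J \<in> simplices \<Delta>" "i \<in> J"
    and w: "w \<in> complexified L" "w \<notin> polar"
  shows "genus w = 0"
proof -
  obtain d where d: "d \<in> L" "s \<bullet> d \<notin> \<int>" "\<And>I i. I \<in> Top \<Longrightarrow> i \<in> I \<Longrightarrow> du I i \<bullet> d \<noteq> 0"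
    using exists_direction[OF J] by metis
  define U where "U = (\<Union>I\<in>Top. du I ` I)"
  have U: "finite U" "\<And>I i. I \<in> Top \<Longrightarrow> i \<in> I \<Longrightarrow> du I i \<in> U"
    unfolding U_def using finite_Top Top_finite by auto
  have U_D: "u \<in> span L \<and> u \<bullet> d \<noteq> 0" if "u \<in> U" for u
    using that d(3) dual_vec_span unfolding U_def by auto
  \<comment> \<open>The combination of u and u' that vanishes on d, so its pairing is constant along
    the line; it is 0 exactly when the two hyperplanes are parallel.\<close>
  define cr where "cr u u' = (u \<bullet> d) *\<^sub>R u' - (u' \<bullet> d) *\<^sub>R u" for u u'
  define G where "G = U \<union> ((\<Union>u\<in>U. cr u ` U) - {0})"
  have "\<exists>x\<in>L. g \<bullet> x \<noteq> 0" if "g \<in> G" for g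
  proof (rule ccontr)
    assume "\<not> ?thesis"
    then have "span L \<subseteq> {x. g \<bullet> x = 0}"
      by (intro span_minimal subspace_hyperplane) auto
    moreover have "g \<in> span L" "g \<noteq> 0"
      using that U_D U_D[of 0] unfolding G_def cr_def by (auto intro!: span_diff span_scale)
    ultimately show False by auto
  qed
  moreover have "finite G"
    unfolding G_def using U(1) by auto
  ultimately obtain y where y: "y \<in> L" "\<And>g. g \<in> G \<Longrightarrow> g \<bullet> y \<noteq> 0"
    using exists_generic_lattice_vector[OF add_subgroup_L] by metis
  define W where "W r = line w y (complex_of_real r)" for r
  define \<kappa> :: "'b \<times> 'b \<times> 'b \<Rightarrow> complex" where "\<kappa> = (\<lambda>(u, a, b). \<tau> * complex_of_real (u \<bullet> a) - complex_of_real (u \<bullet> b))"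
  define X where "X = U \<times> L \<times> L"
  have X: "countable X"
    unfolding X_def using countable_lattice[OF is_lattice_L] U(1) by (simp add: countable_finite)
  \<comment> \<open>The first part are the r with \<open>W r\<close> in \<open>polar\<close>; the
    second part are the r for which two non-parallel poles can meet on the line through
    \<open>W r\<close>. Each single equation fixes at most one r, as y is generic for G.\<close>
  define bad where "bad = (\<Union>x\<in>X. {r. cpair (fst x) (W r) = \<kappa> x}) \<union>
     (\<Union>(x, x')\<in>X \<times> X. if cr (fst x) (fst x') = 0 then {} else
        {r. cpair (cr (fst x) (fst x')) (W r) = of_real (fst x \<bullet> d) * \<kappa> x' - of_real (fst x' \<bullet> d) * \<kappa> x})"
  have G: "u \<in> G" "cr u u' \<noteq> 0 \<Longrightarrow> cr u u' \<in> G" if "u \<in> U" "u' \<in> U" for u u'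
    using that unfolding G_def by blast+
  have single: "countable {r. cpair g (W r) = c}" if "g \<in> G" for g c
  proof -
    have eq: "r = r'" if "cpair g (W r) = c" "cpair g (W r') = c" for r r'
    proof -
      have "complex_of_real (r * (g \<bullet> y)) = complex_of_real (r' * (g \<bullet> y))"
        using that unfolding W_def cpair_line of_real_mult by (metis add_left_imp_eq)
      then show ?thesis
        using y(2)[OF \<open>g \<in> G\<close>] unfolding of_real_eq_iff mult_cancel_right by blast
    qed
    show ?thesis
    proof (cases "\<exists>r. cpair g (W r) = c")
      case True
      then obtain r where r: "cpair g (W r) = c" ..
      have "{r. cpair g (W r) = c} \<subseteq> {r}"
        using eq[OF _ r] by auto
      then show ?thesis
        by (rule countable_subset) simp
    qed simp
  qed
  have "countable bad"
    unfolding bad_def using X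
    by (intro countable_Un countable_UN countable_SIGMA) (auto simp: X_def intro!: single intro: G)
  have good: "genus (W r) = 0" if r: "r \<notin> bad" for r
  proof (rule genus_generic_eq_0[OF complete _ _ d])
    show "W r \<in> complexified L"
      using w(1) y(1) unfolding complexified_def W_def line_def
      by (auto simp: cscale_of_lat intro!: span_add span_scale intro: span_base span_zero)
    show "W r \<notin> polar"
    proof
      assume "W r \<in> polar"
      then obtain I i a b where *: "I \<in> Top" "i \<in> I" "a \<in> L" "b \<in> L" "parg (du I i) a b (W r) = 0"
        by (rule polarE)
      then have "(du I i, a, b) \<in> X" "cpair (du I i) (W r) = \<kappa> (du I i, a, b)"
        using U(2) by (auto simp: X_def \<kappa>_def parg_def)
      then show False
        using r unfolding bad_def by force
    qed
    fix I i a b I' i' a' b' z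
    assume I: "I \<in> Top" "i \<in> I" "a \<in> L" "b \<in> L" and I': "I' \<in> Top" "i' \<in> I'" "a' \<in> L" "b' \<in> L"
      and p: "parg (du I i) a b (line (W r) d z) = 0" "parg (du I' i') a' b' (line (W r) d z) = 0"
    define x where "x = (du I i, a, b)"
    define x' where "x' = (du I' i', a', b')"
    have xX: "x \<in> X" "x' \<in> X"
      using I I' U(2) by (auto simp: x_def x'_def X_def)
    have k: "\<kappa> x = cpair (du I i) (W r) + z * of_real (du I i \<bullet> d)"
       "\<kappa> x' = cpair (du I' i') (W r) + z * of_real (du I' i' \<bullet> d)"
      using p by (auto simp: parg_def \<kappa>_def x_def x'_def)
    \<comment> \<open>Eliminating z from the two pole equations leaves a condition on r
      alone.\<close>
    have "cpair (cr (fst x) (fst x')) (W r) = of_real (fst x \<bullet> d) * \<kappa> x' - of_real (fst x' \<bullet> d) * \<kappa> x"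
      unfolding k by (simp add: cr_def x_def x'_def algebra_simps)
    then have "cr (fst x) (fst x') = 0"
      using r xX unfolding bad_def by (auto split: if_splits)
    then show "(du I i \<bullet> d) *\<^sub>R du I' i' = (du I' i' \<bullet> d) *\<^sub>R du I i"
      by (simp add: cr_def x_def x'_def)
  qed
  have "((\<lambda>r. genus (W r)) \<longlongrightarrow> genus w) (at (0::real))"
  proof (rule tendsto_genus[OF _ w(2)])
    fix I i
    have "((\<lambda>r. cpair (du I i) w + complex_of_real r * of_real (du I i \<bullet> y)) \<longlongrightarrow>
        cpair (du I i) w + complex_of_real 0 * of_real (du I i \<bullet> y)) (at (0::real))"
      by (intro tendsto_intros)
    then show "((\<lambda>r. cpair (du I i) (W r)) \<longlongrightarrow> cpair (du I i) w) (at (0::real))"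
      by (simp add: W_def)
  qed
  show ?thesis
  proof (rule ccontr)
    \<comment> \<open>A nonzero limit would make all small nonzero r bad, although an interval is
      uncountable.\<close>
    assume "genus w \<noteq> 0"
    with \<open>((\<lambda>r. genus (W r)) \<longlongrightarrow> genus w) (at (0::real))\<close>
    have "eventually (\<lambda>r. genus (W r) \<noteq> 0) (at (0::real))"
      by (rule tendsto_imp_eventually_ne)
    then have "eventually (\<lambda>r. r \<in> bad) (at (0::real))"
      using good by (auto elim!: eventually_mono)
    then obtain \<epsilon> where "\<epsilon> > 0" "\<And>r. r \<noteq> 0 \<Longrightarrow> dist r 0 < \<epsilon> \<Longrightarrow> r \<in> bad"
      unfolding eventually_at by blast
    then have "{0<..<\<epsilon>} \<subseteq> bad"
      by auto
    then show False
      using \<open>countable bad\<close> \<open>\<epsilon> > 0\<close> uncountable_open_interval countable_subset by blast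
  qed
qed

section \<open>Comparison with the defining formula\<close>

lemma genus_arg_parg: "genus_arg \<Delta> v \<tau> w I h1 h2 i = parg (du I i) (rep h1) (rep h2) w"
  by (simp add: genus_arg_def parg_def)

lemma quot_group_transversal:
  assumes "I \<in> Top"
  shows "transversal L (sublat v I) (rep ` quot_group \<Delta> v I)"
proof -
  obtain R where R: "transversal L (sublat v I) R"
    using exists_transversal_Top[OF assms] by blast
  show ?thesis
    unfolding quot_group_def by (rule transversal_rep(1)[OF add_subgroup_sublat R])
qed

lemma genus_domain_eq: "genus_domain \<Delta> v \<tau> = complexified L - polar"
  unfolding genus_domain_def genus_arg_parg
  by (auto simp: polar_transversal[of "\<lambda>I. rep ` quot_group \<Delta> v I", OF quot_group_transversal])

end

theorem theorem4p1:
  fixes \<Delta> :: "('i, 'v::euclidean_space) multifan"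
    and v :: "'i \<Rightarrow> 'v" and \<xi> \<eta> :: "'i \<Rightarrow> real" and u :: 'v
    and N k :: nat and \<tau> :: complex
  assumes "simplicial_multifan \<Delta>" and "complete_multifan \<Delta>"
    and "edge_vectors \<Delta> v"
    and "\<xi> \<in> H2T_rat \<Delta>"
    and "N > 1"
    and "T_Cartier \<Delta> v \<eta>" and "u \<in> rat_dual_lattice (lat_edge \<Delta> v)"
    and "\<xi> = (\<lambda>i. real N * \<eta> i + divisor_of \<Delta> v u i)"
    and "0 < k" and "k < N"
    and "Im \<tau> > 0"
    and "\<forall>i\<in>vertices \<Delta>. complex_of_real (\<xi> i) * (of_nat k / of_nat N) \<notin> period_lattice \<tau>"
  shows "(\<exists>c. \<forall>w\<in>genus_domain \<Delta> v \<tau>.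
             orbifold_elliptic_genus \<Delta> v \<xi> \<tau> (of_nat k / of_nat N) w = c) \<and>
         (\<xi> \<notin> {\<lambda>i. real N * \<theta> i | \<theta>. \<theta> \<in> H2T \<Delta>} \<longrightarrow>
           (\<forall>w\<in>genus_domain \<Delta> v \<tau>.
             orbifold_elliptic_genus \<Delta> v \<xi> \<tau> (of_nat k / of_nat N) w = 0))"
proof -
  define \<sigma> where "\<sigma> = real k / real N"
  \<comment> \<open>Modulo integers only u matters: \<sigma> times \<open>\<xi> i\<close> is
    \<open>s \<bullet> v i\<close> plus the integer \<open>k * \<eta> i\<close>.\<close>
  define s where "s = \<sigma> *\<^sub>R u"
  have sigma: "of_nat k / of_nat N = complex_of_real \<sigma>"
    by (simp add: \<sigma>_def)
  have eta_int: "\<eta> i \<in> \<int>" if "i \<in> vertices \<Delta>" for i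
    using assms(6) that unfolding T_Cartier_def H2T_def by blast
  have xi_sigma: "\<xi> i * \<sigma> = s \<bullet> v i + real k * \<eta> i" if "i \<in> vertices \<Delta>" for i
    using that assms(5) unfolding assms(8) by (simp add: divisor_of_def s_def \<sigma>_def field_simps)
  have keta_int: "real k * \<eta> i \<in> \<int>" if "i \<in> vertices \<Delta>" for i
    using eta_int[OF that] by auto
  interpret edged_genus \<Delta> v \<tau> s
  proof unfold_locales
    show "simplicial_multifan \<Delta>" "edge_vectors \<Delta> v" "Im \<tau> > 0" by fact+
    fix i assume i: "i \<in> vertices \<Delta>"
    show "s \<bullet> v i \<notin> \<int>"
    proof
      assume "s \<bullet> v i \<in> \<int>"
      then have "\<xi> i * \<sigma> \<in> \<int>"
        unfolding xi_sigma[OF i] using keta_int[OF i] by auto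
      then have "complex_of_real (\<xi> i) * (of_nat k / of_nat N) \<in> period_lattice \<tau>"
        unfolding sigma of_real_mult[symmetric] period_lattice_of_real[OF assms(11)] .
      then show False
        using assms(12) i by blast
    qed
  qed
  show ?thesis
  proof (cases "lat_rank \<Delta> = 0")
    case True
    \<comment> \<open>In rank 0 the only simplex is empty: all products are empty, so the value is
      independent of w. There are no vertices, so \<xi> is 0 and lies in the N-fold
      divisors.\<close>
    then have empty: "I = {}" if "I \<in> Top" for I
      using Top_card[OF that] Top_finite[OF that] by simp
    have const: "orbifold_elliptic_genus \<Delta> v \<xi> \<tau> \<sigma>' w = orbifold_elliptic_genus \<Delta> v \<xi> \<tau> \<sigma>' 0" for w \<sigma>'
      unfolding orbifold_elliptic_genus_def
      by (intro sum.cong refl arg_cong2[of _ _ _ _ "(*)"]) (auto dest!: empty)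
    have "vertices \<Delta> = {}"
      using simplices_extend empty unfolding vertices_def by blast
    then have "\<xi> = (\<lambda>i. real N * (\<lambda>_. 0) i) \<and> (\<lambda>_. 0) \<in> H2T \<Delta>"
      using assms(4) by (auto simp: H2T_rat_def H2T_def)
    then have "\<xi> \<in> {\<lambda>i. real N * \<theta> i | \<theta>. \<theta> \<in> H2T \<Delta>}"
      by (intro CollectI exI)
    moreover have "\<exists>c. \<forall>w\<in>genus_domain \<Delta> v \<tau>. orbifold_elliptic_genus \<Delta> v \<xi> \<tau> (of_nat k / of_nat N) w = c"
      by (rule exI[of _ "orbifold_elliptic_genus \<Delta> v \<xi> \<tau> (of_nat k / of_nat N) 0"], rule ballI, rule const)
    ultimately show ?thesis
      by (simp only: not_True_eq_False simp_thms)
  next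
    case False
    obtain I where I: "I \<in> Top"
      using Top_nonempty by blast
    then obtain i where "i \<in> I"
      using False Top_card[OF I] by (cases "I = {}") auto
    have fin_vertices: "finite (vertices \<Delta>)"
    proof (rule finite_subset)
      show "vertices \<Delta> \<subseteq> \<Union> (simplices \<Delta>)"
        by (auto simp: vertices_def)
      show "finite (\<Union> (simplices \<Delta>))"
        using finite_simplices simplices_finite by blast
    qed
    \<comment> \<open>The T-Cartier condition enters here: the contribution of \<eta> to the
      exponent is k times the pairing of \<open>iota \<Delta> v I \<eta>\<close> with a, an integer,
      so the prefactors multiply to a character of L that is the same for every I.\<close>
    have factor: "(\<Prod>i\<in>I. exp (2 * pi * \<i> * (\<xi> i * (du I i \<bullet> a)) * \<sigma>)) = ee (s \<bullet> a)"
      if I: "I \<in> Top" and a: "a \<in> L" for I a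
    proof -
      have vert: "i \<in> vertices \<Delta>" if "i \<in> I" for i
        using vertex_of[OF Top_simplices[OF I] that] .
      have "iota \<Delta> v I \<eta> = (\<Sum>i\<in>I. \<eta> i *\<^sub>R du I i)"
        unfolding iota_def using fin_vertices vert by (intro sum.mono_neutral_cong_right) auto
      moreover have "iota \<Delta> v I \<eta> \<bullet> a \<in> \<int>"
        using assms(6) I a unfolding T_Cartier_def dual_lattice_def by blast
      ultimately have int: "real k * (\<Sum>i\<in>I. \<eta> i * (du I i \<bullet> a)) \<in> \<int>"
        by (simp add: inner_sum_left)
      have "(\<Sum>i\<in>I. \<xi> i * (du I i \<bullet> a) * \<sigma>) = (\<Sum>i\<in>I. (s \<bullet> v i + real k * \<eta> i) * (du I i \<bullet> a))"
        using vert xi_sigma by (intro sum.cong) (auto simp: mult_ac)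
      also have "\<dots> = (\<Sum>i\<in>I. (du I i \<bullet> a) * (s \<bullet> v i)) + real k * (\<Sum>i\<in>I. \<eta> i * (du I i \<bullet> a))"
        by (simp add: algebra_simps sum.distrib sum_distrib_left)
      also have "(\<Sum>i\<in>I. (du I i \<bullet> a) * (s \<bullet> v i)) = s \<bullet> a"
        using s_expansion[OF I span_base[OF a]] by simp
      finally have eq: "(\<Sum>i\<in>I. \<xi> i * (du I i \<bullet> a) * \<sigma>) = s \<bullet> a + real k * (\<Sum>i\<in>I. \<eta> i * (du I i \<bullet> a))" .
      have "(\<Prod>i\<in>I. exp (2 * pi * \<i> * (\<xi> i * (du I i \<bullet> a)) * \<sigma>)) = (\<Prod>i\<in>I. ee (of_real (\<xi> i * (du I i \<bullet> a) * \<sigma>)))"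
        by (simp add: ee_def mult.assoc)
      also have "\<dots> = ee (of_real (\<Sum>i\<in>I. \<xi> i * (du I i \<bullet> a) * \<sigma>))"
        unfolding of_real_sum by (rule ee_sum[OF Top_finite[OF I], symmetric])
      also have "\<dots> = ee (s \<bullet> a)"
        unfolding eq of_real_add ee_add ee_Ints[OF Ints_of_real[OF int]] by (rule mult_1_right)
      finally show ?thesis .
    qed
    have inner: "(\<Sum>(h1, h2)\<in>quot_group \<Delta> v I \<times> quot_group \<Delta> v I.
           \<Prod>i\<in>I. exp (2 * pi * \<i> * (\<xi> i * (du I i \<bullet> rep h1)) * \<sigma>) *
                phi_st (genus_arg \<Delta> v \<tau> w I h1 h2 i) \<tau> (\<xi> i * complex_of_real \<sigma>)) =
        (\<Sum>(h1, h2)\<in>quot_group \<Delta> v I \<times> quot_group \<Delta> v I. gterm I (rep h1) (rep h2) w)"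
      if I: "I \<in> Top" for I w
    proof (rule sum.cong[OF refl])
      fix h assume h: "h \<in> quot_group \<Delta> v I \<times> quot_group \<Delta> v I"
      obtain h1 h2 where h12: "h = (h1, h2)" "h1 \<in> quot_group \<Delta> v I"
        using h by auto
      have a: "rep h1 \<in> L"
        using transversal_subset[OF quot_group_transversal[OF I]] h12(2) by blast
      have phi: "phi_st z \<tau> (complex_of_real (\<xi> i) * complex_of_real \<sigma>) = phi_st z \<tau> (s \<bullet> v i)" if "i \<in> I" for i z
      proof -
        have i: "i \<in> vertices \<Delta>"
          using vertex_of[OF Top_simplices[OF I] that] .
        show ?thesis
          unfolding of_real_mult[symmetric] xi_sigma[OF i] of_real_add
          by (rule phi_st_sigma_add_int) (rule Ints_of_real[OF keta_int[OF i]])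
      qed
      show "(case h of (h1, h2) \<Rightarrow> \<Prod>i\<in>I. exp (2 * pi * \<i> * (\<xi> i * (du I i \<bullet> rep h1)) * \<sigma>) *
                phi_st (genus_arg \<Delta> v \<tau> w I h1 h2 i) \<tau> (\<xi> i * complex_of_real \<sigma>)) =
           (case h of (h1, h2) \<Rightarrow> gterm I (rep h1) (rep h2) w)"
        unfolding h12 prod.case prod.distrib factor[OF I a] gterm_def genus_arg_parg
        using phi by (intro arg_cong2[of _ _ _ _ "(*)"] prod.cong refl) auto
    qed
    have "orbifold_elliptic_genus \<Delta> v \<xi> \<tau> (of_nat k / of_nat N) w = genus w" for w
      unfolding orbifold_elliptic_genus_def genus_def gpart_def sigma
      by (intro sum.cong refl) (simp only: inner times_divide_eq_left times_divide_eq_right)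
    moreover have "genus w = 0" if "w \<in> genus_domain \<Delta> v \<tau>" for w
      using genus_eq_0[OF assms(2) Top_simplices[OF I] \<open>i \<in> I\<close>] that unfolding genus_domain_eq by blast
    ultimately show ?thesis
      by simp
  qed
qed

end
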